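(* Let $\Omega\subseteq\mathbf{R}^d$ be a closed convex set with $\mathcal{L}^d(\Omega)\ge 1$, let $\mu,\nu\in\mathcal{P}_2(\Omega)$, and set $\tilde\mu:=\mathrm{P}^2_\Omega[\mu]$, $\tilde\nu:=\mathrm{P}^2_\Omega[\nu]$. Let $\eta\in\Pi(\tilde\mu,\tilde\nu)$ be the optimal transport plan for $W_2(\tilde\mu,\tilde\nu)$, and let $T,U:\Omega\to\Omega$ be the optimal transport maps (for the cost $|x-y|^2$) from $\tilde\mu$ to $\mu$ and from $\tilde\nu$ to $\nu$, respectively. Define $\gamma:=(T,U)_\sharp\eta\in\Pi(\mu,\nu)$, i.e. the push-forward of $\eta$ under $(x,y)\mapsto(T(x),U(y))$. Then $$W_2^2(\tilde\mu,\tilde\nu)\le\int_{\Omega\times\Omega}|x-y|^2\,\mathrm{d}\gamma(x,y).$$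
   Context: $\mathcal{L}^d$ is Lebesgue measure. For a closed convex set $\Omega\subseteq\mathbf{R}^d$ and $p\ge1$, $\mathcal{P}_p(\Omega)$ is the set of Borel probability measures supported in $\Omega$ with finite $p$-th moment, $\Pi(\mu,\nu)$ is the set of transport plans (couplings) of $\mu,\nu$, and $W_p^p(\mu,\nu)=\inf_{\gamma\in\Pi(\mu,\nu)}\int|x-y|^p\,\mathrm{d}\gamma$. Let $\mathcal{K}_p(\Omega)$ be the set of $\rho\in\mathcal{P}_p(\Omega)$ that are absolutely continuous with respect to Lebesgue measure with density satisfying $0\le\rho\le1$ a.e. For $p>1$ and $\mathcal{L}^d(\Omega)\ge1$, $\mathrm{P}^p_\Omega[\mu]$ denotes the metric projection of $\mu\in\mathcal{P}_p(\Omega)$ onto $\mathcal{K}_p(\Omega)$, i.e. the minimizer of $\rho\mapsto W_p^p(\rho,\mu)$ over $\rho\in\mathcal{K}_p(\Omega)$, which is known to exist and be unique. Since $\tilde\mu,\tilde\nu$ are absolutely continuous, the optimal plan $\eta$ and the maps $T,U$ exist and are unique (the maps up to null sets of $\tilde\mu$, $\tilde\nu$). *)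

theory Defs
  imports "HOL-Probability.Probability"
begin

definition prob_measures :: "real \<Rightarrow> 'a::euclidean_space set \<Rightarrow> 'a measure set" where
  "prob_measures p \<Omega> =
     {\<mu>. sets \<mu> = sets borel \<and> prob_space \<mu> \<and> (AE x in \<mu>. x \<in> \<Omega>) \<and>
         (\<integral>\<^sup>+x. ennreal (norm x powr p) \<partial>\<mu>) < \<infinity>}"

definition transport_plans ::
  "'a::euclidean_space measure \<Rightarrow> 'a measure \<Rightarrow> ('a \<times> 'a) measure set" where
  "transport_plans \<mu> \<nu> =
     {\<gamma>. sets \<gamma> = sets borel \<and> distr \<gamma> borel fst = \<mu> \<and> distr \<gamma> borel snd = \<nu>}"

definition transport_cost :: "real \<Rightarrow> ('a::euclidean_space \<times> 'a) measure \<Rightarrow> ennreal" where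
  "transport_cost p \<gamma> = (\<integral>\<^sup>+(x, y). ennreal (norm (x - y) powr p) \<partial>\<gamma>)"

(* This is the p-th power of the Wasserstein distance, not the distance itself. *)
definition wasserstein_pow ::
  "real \<Rightarrow> 'a::euclidean_space measure \<Rightarrow> 'a measure \<Rightarrow> ennreal" where
  "wasserstein_pow p \<mu> \<nu> = (INF \<gamma>\<in>transport_plans \<mu> \<nu>. transport_cost p \<gamma>)"

definition optimal_plan ::
  "real \<Rightarrow> 'a::euclidean_space measure \<Rightarrow> 'a measure \<Rightarrow> ('a \<times> 'a) measure \<Rightarrow> bool" where
  "optimal_plan p \<mu> \<nu> \<gamma> \<longleftrightarrow>
     \<gamma> \<in> transport_plans \<mu> \<nu> \<and> transport_cost p \<gamma> = wasserstein_pow p \<mu> \<nu>"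

(* Maps from \<Omega> to \<Omega> are represented by Borel maps of the whole space that send \<Omega> to \<Omega>;
   values outside \<Omega> are irrelevant for measures supported in \<Omega>. *)
definition optimal_map ::
  "real \<Rightarrow> 'a::euclidean_space set \<Rightarrow> 'a measure \<Rightarrow> 'a measure \<Rightarrow> ('a \<Rightarrow> 'a) \<Rightarrow> bool" where
  "optimal_map p \<Omega> \<mu> \<nu> T \<longleftrightarrow>
     T \<in> borel_measurable borel \<and> T \<in> \<Omega> \<rightarrow> \<Omega> \<and> distr \<mu> borel T = \<nu> \<and>
     (\<integral>\<^sup>+x. ennreal (norm (x - T x) powr p) \<partial>\<mu>) = wasserstein_pow p \<mu> \<nu>"

definition bounded_density_measures ::
  "real \<Rightarrow> 'a::euclidean_space set \<Rightarrow> 'a measure set" where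
  "bounded_density_measures p \<Omega> =
     {\<rho> \<in> prob_measures p \<Omega>.
        \<exists>f :: 'a \<Rightarrow> real. f \<in> borel_measurable borel \<and>
          (AE x in lborel. 0 \<le> f x \<and> f x \<le> 1) \<and>
          \<rho> = density lborel (\<lambda>x. ennreal (f x))}"

definition is_projection ::
  "real \<Rightarrow> 'a::euclidean_space set \<Rightarrow> 'a measure \<Rightarrow> 'a measure \<Rightarrow> bool" where
  "is_projection p \<Omega> \<mu> \<rho> \<longleftrightarrow>
     is_arg_min (\<lambda>\<rho>. wasserstein_pow p \<rho> \<mu>) (\<lambda>\<rho>. \<rho> \<in> bounded_density_measures p \<Omega>) \<rho>"

end

theory Submission
  imports Defs
begin

text \<open>Let $\<mu>_t$ be the law of $(1-t)x + ty$ under $\<eta>$. By displacement convexity (McCann), $\<mu>_t$ again has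
  density at most $1$, so it competes with $\<mu>'$ in the projection problem for $\<mu>$. Coupling it to $\<mu>$ through
  $((1-t)x + ty, T(x))$ and letting $t \<rightarrow> 0$ gives $\<integral> (x - Tx) \<bullet> (y - x) d\<eta> \<ge> 0$; symmetrically
  $\<integral> (y - Uy) \<bullet> (x - y) d\<eta> \<ge> 0$. With $D = x - y$ and $E = Tx - Uy$, the sum says
  $\<integral> D \<bullet> (E - D) d\<eta> \<ge> 0$, whence $\<integral> |D|^2 d\<eta> \<le> \<integral> |E|^2 d\<eta>$.

  The density bound needs no Alexandrov theorem: the map $z = (1-t)x + ty \<mapsto> x$ extends to the Lipschitz gradient
  of a convex function on the whole space, so Rademacher's theorem, the symmetry of its derivative and AM-GM for
  the eigenvalues are enough.\<close>

section \<open>Rademacher's theorem\<close>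

text \<open>The obstacle is regularity: the gradient of a convex potential of the optimal plan may
  be multivalued and discontinuous. Interpolating with 0 < t < 1 smooths it. If phi is the
  potential, then z is a subgradient at x of t phi + (1-t)|x|^2/2. This function is strongly convex,
  so its conjugate has a gradient with Lipschitz constant 1/(1-t), and that gradient sends z to x. A
  bound on the second coordinates keeps phi finite everywhere, hence a truncation to norm at most n
  and a monotone limit. The density bound is a charging argument: z determines both x and y, and
  where the map to x expands volume the map to y does not. The mass over a set of z is paid for by
  Lebesgue measure on two disjoint pieces, through \<mu>' on one and through \<nu>' on the other. In
  the first variation an upper bound for the cost from the interpolant to \<mu> suffices, so one
  explicit coupling is enough. Expanding its square yields 0 <= 2tm + t^2 k, and small t forces m >=
  0.\<close>

text \<open>Vitali covering: the short intervals on which \<open>f\<close> stretches by at most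
  \<open>p\<close> cover \<open>E\<close> finely, so countably many disjoint ones inside an open
  superset cover \<open>E\<close> up to a null set, and monotonicity keeps their images disjoint.
  Outer measure appears because \<open>E\<close> comes without measurability.\<close>

lemma outer_measure_image_le:
  fixes f :: "real \<Rightarrow> real"
  assumes mono: "strict_mono f"
    and lip: "\<And>x y. \<bar>f x - f y\<bar> \<le> M * \<bar>x - y\<bar>"
    and p: "0 < p"
    and E: "\<And>x d. x \<in> E \<Longrightarrow> 0 < d \<Longrightarrow>
        \<exists>a b. a < b \<and> a \<le> x \<and> x \<le> b \<and> b - a < d \<and> f b - f a \<le> p * (b - a)"
  shows "outer_measure_of lborel (f ` E) \<le> ennreal p * outer_measure_of lborel E"
proof -
  have open_case: "outer_measure_of lborel (f ` E) \<le> ennreal p * emeasure lborel G"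
    if G: "open G" "E \<subseteq> G" for G
  proof -
    define K where "K = {(a, b). a < b \<and> {a..b} \<subseteq> G \<and> f b - f a \<le> p * (b - a)}"
    \<comment> \<open>Centre and radius of an interval, since the covering theorem is phrased for
      balls.\<close>
    define c where "c = (\<lambda>(a, b). (a + b) / 2 :: real)"
    define r where "r = (\<lambda>(a, b). (b - a) / 2 :: real)"
    have cb: "cball (c i) (r i) = {fst i..snd i}" for i
      by (auto simp: c_def r_def cball_def dist_real_def abs_le_iff field_simps split: prod.splits)
    have r_pos: "0 < r i" if "i \<in> K" for i
      using that by (auto simp: K_def r_def)
    have fine: "\<exists>i. i \<in> K \<and> x \<in> cball (c i) (r i) \<and> r i < d" if "x \<in> E" "0 < d" for x d
    proof -
      obtain e where e: "e > 0" "ball x e \<subseteq> G"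
        using G \<open>x \<in> E\<close> by (meson open_contains_ball subsetD)
      obtain a b where ab: "a < b" "a \<le> x" "x \<le> b" "b - a < min d e" "f b - f a \<le> p * (b - a)"
        using E[OF \<open>x \<in> E\<close>, of "min d e"] \<open>0 < d\<close> e by auto
      have "{a..b} \<subseteq> ball x e"
        using ab by (auto simp: dist_real_def)
      then have "(a, b) \<in> K" using ab e by (auto simp: K_def)
      moreover have "x \<in> cball (c (a, b)) (r (a, b))" using ab by (simp add: cb)
      moreover have "r (a, b) < d" using ab by (auto simp: r_def)
      ultimately show ?thesis by blast
    qed
    obtain C where C: "countable C" "C \<subseteq> K"
      "pairwise (\<lambda>i j. disjnt (cball (c i) (r i)) (cball (c j) (r j))) C"
      "negligible (E - (\<Union>i\<in>C. cball (c i) (r i)))"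
      by (rule Vitali_covering_theorem_cballs[of K r E c, OF r_pos fine])
    define N where "N = E - (\<Union>i\<in>C. cball (c i) (r i))"
    have negN: "negligible (f ` N)"
    proof (rule negligible_locally_Lipschitz_image)
      show "negligible N" using C by (simp add: N_def)
      fix x assume "x \<in> N"
      show "\<exists>T B. open T \<and> x \<in> T \<and> (\<forall>y\<in>N \<inter> T. norm (f y - f x) \<le> B * norm (y - x))"
        using lip by (intro exI[of _ UNIV] exI[of _ M]) auto
    qed simp
    then obtain N' where N': "f ` N \<subseteq> N'" "N' \<in> null_sets lborel"
      using null_sets_completionI negligible_iff_null_sets completion.null_sets_outer
      by (metis null_sets_completion_iff2)
    have disj: "disjoint_family_on (\<lambda>i. {fst i..snd i}) C"
      using C(3) by (auto simp: disjoint_family_on_def pairwise_def disjnt_def cb)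
    have disj': "disjoint_family_on (\<lambda>i. {f (fst i)..f (snd i)}) C"
    proof -
      have le: "f u \<le> f v \<longleftrightarrow> u \<le> v" for u v
        using mono by (simp add: strict_mono_less_eq)
      have "{f (fst i)..f (snd i)} \<inter> {f (fst j)..f (snd j)} = {}" if "i \<in> C" "j \<in> C" "i \<noteq> j" for i j
      proof -
        have "{fst i..snd i} \<inter> {fst j..snd j} = {}"
          using disj that by (auto simp: disjoint_family_on_def)
        moreover have "fst i < snd i" "fst j < snd j" using that C(2) by (auto simp: K_def)
        ultimately have "snd i < fst j \<or> snd j < fst i"
          by auto
        then show ?thesis using mono by (auto simp: strict_mono_def) (metis leD order_less_le_trans order.trans)+
      qed
      then show ?thesis by (auto simp: disjoint_family_on_def)
    qed
    have cover: "f ` E \<subseteq> (\<Union>i\<in>C. {f (fst i)..f (snd i)}) \<union> N'"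
    proof
      fix y assume "y \<in> f ` E"
      then obtain x where x: "x \<in> E" "y = f x" by auto
      show "y \<in> (\<Union>i\<in>C. {f (fst i)..f (snd i)}) \<union> N'"
      proof (cases "x \<in> N")
        case True then show ?thesis using N' x by auto
      next
        case False
        then obtain i where "i \<in> C" "x \<in> {fst i..snd i}" using x by (auto simp: N_def cb)
        then show ?thesis using x mono by (auto simp: strict_mono_less_eq)
      qed
    qed
    have meas: "(\<Union>i\<in>C. {f (fst i)..f (snd i)}) \<in> sets lborel"
      using C(1) by (intro sets.countable_UN') auto
    have "outer_measure_of lborel (f ` E) \<le> outer_measure_of lborel ((\<Union>i\<in>C. {f (fst i)..f (snd i)}) \<union> N')"
      by (rule outer_measure_of_mono[OF cover])
    also have "\<dots> = emeasure lborel ((\<Union>i\<in>C. {f (fst i)..f (snd i)}) \<union> N')"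
      using meas N' by (intro outer_measure_of_eq) auto
    also have "\<dots> = emeasure lborel (\<Union>i\<in>C. {f (fst i)..f (snd i)})"
      using meas N' by (intro emeasure_Un_null_set) auto
    also have "\<dots> = (\<integral>\<^sup>+i. emeasure lborel {f (fst i)..f (snd i)} \<partial>count_space C)"
      using C(1) disj' by (intro emeasure_UN_countable) auto
    also have "\<dots> \<le> (\<integral>\<^sup>+i. ennreal p * emeasure lborel {fst i..snd i} \<partial>count_space C)"
    proof (rule nn_integral_mono)
      fix i assume "i \<in> space (count_space C)"
      then have "fst i < snd i" "f (snd i) - f (fst i) \<le> p * (snd i - fst i)"
        using C(2) by (auto simp: K_def)
      moreover then have "f (fst i) \<le> f (snd i)" using mono by (simp add: strict_mono_less_eq)
      ultimately show "emeasure lborel {f (fst i)..f (snd i)} \<le> ennreal p * emeasure lborel {fst i..snd i}"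
        using p by (simp add: ennreal_mult'[symmetric] ennreal_leI)
    qed
    also have "\<dots> = ennreal p * (\<integral>\<^sup>+i. emeasure lborel {fst i..snd i} \<partial>count_space C)"
      by (rule nn_integral_cmult) auto
    also have "(\<integral>\<^sup>+i. emeasure lborel {fst i..snd i} \<partial>count_space C) = emeasure lborel (\<Union>i\<in>C. {fst i..snd i})"
      using C(1) disj by (intro emeasure_UN_countable[symmetric]) auto
    also have "\<dots> \<le> emeasure lborel G"
      using C(2) G by (intro emeasure_mono) (auto simp: K_def subset_iff)
    finally show ?thesis by (simp add: mult_left_mono)
  qed
  have "outer_measure_of lborel (f ` E) \<le> ennreal p * emeasure lborel B" if B: "B \<in> sets lborel" "E \<subseteq> B" for B
  proof (rule ennreal_le_epsilon)
    fix e :: real assume "0 < e"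
    \<comment> \<open>The slack \<open>e / p\<close> becomes \<open>e\<close> after multiplication
      by \<open>p\<close>.\<close>
    then obtain U where U: "open U" "B \<subseteq> U" "emeasure lborel (U - B) < e / p"
      using outer_regular_lborel[of B "e / p"] B p by auto
    have "emeasure lborel U \<le> emeasure lborel B + emeasure lborel (U - B)"
      using B U by (subst plus_emeasure) (auto intro!: emeasure_mono)
    then have "ennreal p * emeasure lborel U \<le> ennreal p * (emeasure lborel B + ennreal (e / p))"
      using U(3) by (intro mult_left_mono) (auto intro: order_trans add_left_mono less_imp_le)
    also have "\<dots> = ennreal p * emeasure lborel B + ennreal e"
      using p \<open>0 < e\<close> by (simp add: distrib_left ennreal_mult'[symmetric])
    finally show "outer_measure_of lborel (f ` E) \<le> ennreal p * emeasure lborel B + ennreal e"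
      using open_case[of U] U B by (auto intro: order_trans)
  qed
  then show ?thesis
    using outer_measure_of_attain[of E lborel] by auto
qed

text \<open>Small slopes at fine scales give |f(E)| <= p |E|; large slopes, read through the inverse
  \<open>g\<close>, give |E| <= |f(E)| / q. Hence |E| <= (p/q) |E|, and finiteness of |E| forces |E|
  = 0. The lower slope bound 1 is what makes \<open>f\<close> a bijection with a 1-Lipschitz
  inverse.\<close>

lemma dini_gap_null:
  fixes f :: "real \<Rightarrow> real"
  assumes slope: "\<And>x y. x < y \<Longrightarrow> y - x \<le> f y - f x \<and> f y - f x \<le> M * (y - x)"
    and pq: "0 < p" "p < q" and bdd: "E \<subseteq> {-N..N}"
    and lower: "\<And>x d. x \<in> E \<Longrightarrow> 0 < d \<Longrightarrow>
        \<exists>a b. a < b \<and> a \<le> x \<and> x \<le> b \<and> b - a < d \<and> f b - f a \<le> p * (b - a)"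
    and upper: "\<And>x d. x \<in> E \<Longrightarrow> 0 < d \<Longrightarrow>
        \<exists>a b. a < b \<and> a \<le> x \<and> x \<le> b \<and> b - a < d \<and> q * (b - a) \<le> f b - f a"
  shows "negligible E"
proof -
  have M: "1 \<le> M" using slope[of 0 1] by simp
  have mono: "strict_mono f" using slope by (force intro!: strict_monoI)
  have lip: "\<bar>f x - f y\<bar> \<le> M * \<bar>x - y\<bar>" for x y
    using slope[of x y] slope[of y x] by (cases x y rule: linorder_cases) (auto simp: abs_if)
  have cont: "continuous_on A f" for A
    by (rule lipschitz_on_continuous_on[of M], rule lipschitz_onI)
      (use lip M in \<open>auto simp: dist_real_def\<close>)
  have "surj f"
  proof -
    have "\<exists>x. f x = y" for y
    proof -
      \<comment> \<open>Slopes are at least 1, so going \<open>\<bar>y - f 0\<bar> + 1\<close> away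
        from 0 passes the value \<open>y\<close> on either side.\<close>
      define a where "a = - \<bar>y - f 0\<bar> - 1"
      define b where "b = \<bar>y - f 0\<bar> + 1"
      have "f a \<le> y" "y \<le> f b" "a \<le> b"
        using slope[of a 0] slope[of 0 b] unfolding a_def b_def by linarith+
      then show ?thesis using IVT'[of f a y b] cont by blast
    qed
    then show ?thesis by (metis surjI)
  qed
  define g where "g = inv f"
  have fg: "f (g y) = y" for y using \<open>surj f\<close> by (simp add: g_def surj_f_inv_f)
  have gf: "g (f x) = x" for x using mono by (simp add: g_def strict_mono_imp_inj_on)
  have gmono: "strict_mono g"
    by (metis fg mono strict_monoI strict_mono_less)
  have glip: "\<bar>g x - g y\<bar> \<le> 1 * \<bar>x - y\<bar>" for x y
    using slope[of "g x" "g y"] slope[of "g y" "g x"]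
    by (cases "g x" "g y" rule: linorder_cases) (auto simp: fg abs_if)
  have 1: "outer_measure_of lborel (f ` E) \<le> ennreal p * outer_measure_of lborel E"
    using mono lip pq(1) lower by (rule outer_measure_image_le)
  have 2: "outer_measure_of lborel (g ` (f ` E)) \<le> ennreal (1 / q) * outer_measure_of lborel (f ` E)"
  proof (rule outer_measure_image_le[OF gmono glip])
    show "0 < 1 / q" using pq by simp
    fix y d :: real assume "y \<in> f ` E" "0 < d"
    then obtain x where x: "x \<in> E" "y = f x" by auto
    \<comment> \<open>\<open>f\<close> lengthens intervals by a factor of at most \<open>M\<close>,
      so scale \<open>d / M\<close> before \<open>f\<close> gives scale \<open>d\<close> after
      it.\<close>
    obtain a b where ab: "a < b" "a \<le> x" "x \<le> b" "b - a < d / M" "q * (b - a) \<le> f b - f a"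
      using upper[OF x(1), of "d / M"] \<open>0 < d\<close> M by auto
    have "f b - f a \<le> M * (b - a)" using slope ab by blast
    also have "\<dots> < d" using ab M by (simp add: field_simps)
    finally have "f b - f a < d" .
    moreover have "g (f b) - g (f a) \<le> 1 / q * (f b - f a)"
      using ab pq by (simp add: gf field_simps)
    moreover have "f a < f b" "f a \<le> y" "y \<le> f b"
      using ab mono x by (auto simp: strict_mono_less strict_mono_less_eq)
    ultimately show "\<exists>a b. a < b \<and> a \<le> y \<and> y \<le> b \<and> b - a < d \<and> g b - g a \<le> 1 / q * (b - a)"
      by blast
  qed
  have "g ` f ` E = E" by (auto simp: gf image_image)
  define m where "m = outer_measure_of lborel E"
  have "m \<le> ennreal (1 / q) * (ennreal p * m)"
    using 2 mult_left_mono[OF 1, of "ennreal (1 / q)"] \<open>g ` f ` E = E\<close>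
    by (simp add: m_def)
  then have le: "m \<le> ennreal (p / q) * m"
    using pq by (simp add: mult.assoc[symmetric] ennreal_mult'[symmetric])
  have "m \<le> outer_measure_of lborel {-N..N}"
    unfolding m_def by (rule outer_measure_of_mono[OF bdd])
  also have "\<dots> < \<infinity>" by (subst outer_measure_of_eq) (auto simp: emeasure_lborel_Icc_eq)
  finally have fin: "m < \<infinity>" .
  then obtain r where r: "m = ennreal r" "0 \<le> r" by (cases m) auto
  have "r \<le> p / q * r" using le r pq by (simp add: ennreal_mult'[symmetric])
  then have "r * (1 - p / q) \<le> 0" by (simp add: algebra_simps)
  moreover have "0 < 1 - p / q" using pq by simp
  ultimately have "r = 0" using r(2) by (metis linorder_not_less mult_pos_pos order_antisym_conv)
  then have "outer_measure_of lborel E = 0" using r by (simp add: m_def)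
  then obtain B where "B \<in> sets lborel" "E \<subseteq> B" "emeasure lborel B = 0"
    using outer_measure_of_attain[of E lborel] by auto
  then have "B \<in> null_sets lebesgue" by (auto intro: null_sets_completionI)
  then show ?thesis using \<open>E \<subseteq> B\<close> negligible_iff_null_sets negligible_subset by blast
qed

text \<open>Where the derivative fails to exist, two rationals \<open>p < q\<close> fit strictly
  between the lower and the upper derivate. There are countably many such pairs, each giving a null
  set by \<open>dini_gap_null\<close> after cutting to bounded intervals.\<close>

theorem lipschitz_real_differentiable_ae:
  fixes f :: "real \<Rightarrow> real"
  assumes lip: "\<And>x y. \<bar>f x - f y\<bar> \<le> M * \<bar>x - y\<bar>"
  shows "negligible {x. \<not> f differentiable (at x)}"
proof -
  \<comment> \<open>The tilt moves all slopes into \<open>[1, 2 * M + 1]\<close>, as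
    \<open>dini_gap_null\<close> demands, without affecting differentiability.\<close>
  define h where "h x = f x + (M + 1) * x" for x
  have slope: "y - x \<le> h y - h x \<and> h y - h x \<le> (2 * M + 1) * (y - x)" if "x < y" for x y
    using lip[of y x] that by (auto simp: h_def algebra_simps abs_le_iff)
  define lo where "lo p x \<longleftrightarrow> (\<forall>d>0. \<exists>a b. a < b \<and> a \<le> x \<and> x \<le> b \<and> b - a < d \<and> h b - h a \<le> p * (b - a))" for p x
  define up where "up q x \<longleftrightarrow> (\<forall>d>0. \<exists>a b. a < b \<and> a \<le> x \<and> x \<le> b \<and> b - a < d \<and> q * (b - a) \<le> h b - h a)" for q x
  define E where "E p q n = {x. x \<in> {- real n..real n} \<and> lo p x \<and> up q x}" for p q n
  have null: "negligible (E p q n)" if "0 < p" "p < q" for p q n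
    by (rule dini_gap_null[OF slope that, of _ "real n"]) (auto simp: E_def lo_def up_def)
  define I :: "(real \<times> real \<times> nat) set"
    where "I = {(p, q, n). p \<in> \<rat> \<and> q \<in> \<rat> \<and> 0 < p \<and> p < q}"
  have "I \<subseteq> \<rat> \<times> \<rat> \<times> UNIV" by (auto simp: I_def)
  then have "countable I" by (rule countable_subset) (auto intro: countable_rat)
  then have "negligible (\<Union>(p, q, n)\<in>I. E p q n)"
    by (intro negligible_countable_Union countable_image) (auto simp: I_def null)
  moreover have "{x. \<not> f differentiable (at x)} \<subseteq> (\<Union>(p, q, n)\<in>I. E p q n)"
  proof
    fix x assume "x \<in> {x. \<not> f differentiable (at x)}"
    then have nd: "\<not> f differentiable (at x)" by simp
    define Q where "Q y = (h y - h x) / (y - x)" for y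
    have Q_bd: "1 \<le> Q y \<and> Q y \<le> 2 * M + 1" if "y \<noteq> x" for y
      using slope[of x y] slope[of y x] that
      by (cases x y rule: linorder_cases) (auto simp: Q_def field_simps)
    define A where "A = Liminf (at x) (\<lambda>y. ereal (Q y))"
    define B where "B = Limsup (at x) (\<lambda>y. ereal (Q y))"
    have ev: "\<forall>\<^sub>F y in at x. y \<noteq> x" by (simp add: eventually_at_filter)
    have A1: "1 \<le> A" unfolding A_def
      by (rule Liminf_bounded, rule eventually_mono[OF ev]) (use Q_bd in auto)
    have B1: "B \<le> ereal (2 * M + 1)" unfolding B_def
      by (rule Limsup_bounded, rule eventually_mono[OF ev]) (use Q_bd in auto)
    have AB: "A \<le> B" unfolding A_def B_def by (rule Liminf_le_Limsup) simp
    have "A \<noteq> B"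
    proof
      assume eq: "A = B"
      then obtain l where l: "A = ereal l" using A1 B1 by (cases A) auto
      have "((\<lambda>y. ereal (Q y)) \<longlongrightarrow> ereal l) (at x)"
        by (rule Liminf_eq_Limsup) (use l eq in \<open>auto simp: A_def B_def\<close>)
      then have "(Q \<longlongrightarrow> l) (at x)" by simp
      then have "(h has_field_derivative l) (at x)"
        unfolding has_field_derivative_iff Q_def .
      then have "((\<lambda>x. h x - (M + 1) * x) has_field_derivative (l - (M + 1))) (at x)"
        by (auto intro!: derivative_eq_intros)
      then have "(f has_field_derivative (l - (M + 1))) (at x)" by (simp add: h_def)
      then show False using nd by (auto simp: has_field_derivative_def differentiable_def)
    qed
    then have "A < B" using AB by simp
    then obtain p' where p: "A < ereal (real_of_rat p')" "ereal (real_of_rat p') < B"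
      using ereal_dense3 by blast
    then obtain q' where q: "ereal (real_of_rat p') < ereal (real_of_rat q')" "ereal (real_of_rat q') < B"
      using ereal_dense3 by blast
    define p where "p = real_of_rat p'"
    define q where "q = real_of_rat q'"
    have "ereal 1 < ereal p" unfolding p_def using A1 p(1) by (metis one_ereal_def order_le_less_trans)
    then have "0 < p" by simp
    have "lo p x" unfolding lo_def
    proof (intro allI impI)
      fix d :: real assume "0 < d"
      have "\<exists>y. y \<noteq> x \<and> dist y x < d \<and> Q y < p"
      proof (rule ccontr)
        assume "\<nexists>y. y \<noteq> x \<and> dist y x < d \<and> Q y < p"
        then have "\<forall>\<^sub>F y in at x. ereal p \<le> ereal (Q y)"
          unfolding eventually_at using \<open>0 < d\<close> by (intro exI[of _ d]) force
        then have "ereal p \<le> A" unfolding A_def by (rule Liminf_bounded)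
        then show False using p by (simp add: p_def)
      qed
      then obtain y where y: "y \<noteq> x" "dist y x < d" "Q y < p" by blast
      show "\<exists>a b. a < b \<and> a \<le> x \<and> x \<le> b \<and> b - a < d \<and> h b - h a \<le> p * (b - a)"
      proof (cases "x < y")
        case True with y show ?thesis
          by (intro exI[of _ x] exI[of _ y]) (auto simp: Q_def dist_real_def field_simps)
      next
        case False with y show ?thesis
          by (intro exI[of _ y] exI[of _ x]) (auto simp: Q_def dist_real_def field_simps)
      qed
    qed
    moreover have "up q x" unfolding up_def
    proof (intro allI impI)
      fix d :: real assume "0 < d"
      have "\<exists>y. y \<noteq> x \<and> dist y x < d \<and> q < Q y"
      proof (rule ccontr)
        assume "\<nexists>y. y \<noteq> x \<and> dist y x < d \<and> q < Q y"
        then have "\<forall>\<^sub>F y in at x. ereal (Q y) \<le> ereal q"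
          unfolding eventually_at using \<open>0 < d\<close> by (intro exI[of _ d]) force
        then have "B \<le> ereal q" unfolding B_def by (rule Limsup_bounded)
        then show False using q by (simp add: q_def)
      qed
      then obtain y where y: "y \<noteq> x" "dist y x < d" "q < Q y" by blast
      show "\<exists>a b. a < b \<and> a \<le> x \<and> x \<le> b \<and> b - a < d \<and> q * (b - a) \<le> h b - h a"
      proof (cases "x < y")
        case True with y show ?thesis
          by (intro exI[of _ x] exI[of _ y]) (auto simp: Q_def dist_real_def field_simps)
      next
        case False with y show ?thesis
          by (intro exI[of _ y] exI[of _ x]) (auto simp: Q_def dist_real_def field_simps)
      qed
    qed
    moreover obtain n :: nat where "\<bar>x\<bar> \<le> real n" using real_arch_simple by blast
    ultimately have "x \<in> E p q n" by (auto simp: E_def)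
    moreover have "(p, q, n) \<in> I" using \<open>0 < p\<close> q by (auto simp: I_def p_def q_def)
    ultimately show "x \<in> (\<Union>(p, q, n)\<in>I. E p q n)" by blast
  qed
  ultimately show ?thesis by (rule negligible_subset)
qed

text \<open>Testing only rational increments reduces convergence of a difference quotient to
  countably many conditions, which makes the exceptional set in
  \<open>AE_directional_derivative\<close> Borel. Continuity away from 0 carries the estimate over
  to real increments.\<close>

lemma tendsto_at_0_if_Cauchy_on_rationals:
  fixes Q :: "real \<Rightarrow> real"
  assumes cont: "\<And>t. t \<noteq> 0 \<Longrightarrow> isCont Q t"
    and cauchy: "\<And>e. 0 < e \<Longrightarrow>
      \<exists>d>0. \<forall>s\<in>\<rat>. \<forall>t\<in>\<rat>. 0 < \<bar>s\<bar> \<and> \<bar>s\<bar> < d \<and> 0 < \<bar>t\<bar> \<and> \<bar>t\<bar> < d \<longrightarrow> \<bar>Q s - Q t\<bar> \<le> e"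
  shows "\<exists>l. (Q \<longlongrightarrow> l) (at 0)"
proof -
  have rat_approx: "\<exists>s'\<in>\<rat>. 0 < \<bar>s'\<bar> \<and> \<bar>s'\<bar> < d \<and> \<bar>Q s - Q s'\<bar> < e"
    if "0 < \<bar>s\<bar>" "\<bar>s\<bar> < d" "0 < e" for s d e
  proof -
    have "s \<noteq> 0" using that by auto
    then obtain r where r: "0 < r" "\<And>x. \<bar>x - s\<bar> < r \<Longrightarrow> \<bar>Q x - Q s\<bar> < e"
      using cont[of s] \<open>0 < e\<close> by (auto simp: continuous_at_eps_delta dist_real_def)
    \<comment> \<open>The three bounds keep \<open>s'\<close> in the continuity neighbourhood, away
      from 0, and within distance \<open>d\<close> of 0.\<close>
    define m where "m = Min {r, \<bar>s\<bar>, d - \<bar>s\<bar>}"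
    have "0 < m" using r that by (auto simp: m_def)
    then obtain s' where s': "s' \<in> \<rat>" "s - m < s'" "s' < s + m"
      using Rats_dense_in_real[of "s - m" "s + m"] by auto
    have "\<bar>s' - s\<bar> < m" using s' by auto
    then have "\<bar>s' - s\<bar> < r" "\<bar>s' - s\<bar> < \<bar>s\<bar>" "\<bar>s' - s\<bar> < d - \<bar>s\<bar>"
      by (auto simp: m_def)
    then show ?thesis using r s' by (intro bexI[of _ s']) (auto simp: abs_minus_commute)
  qed
  have real_cauchy: "\<exists>d>0. \<forall>s t. 0 < \<bar>s\<bar> \<and> \<bar>s\<bar> < d \<and> 0 < \<bar>t\<bar> \<and> \<bar>t\<bar> < d \<longrightarrow> \<bar>Q s - Q t\<bar> \<le> e"
    if "0 < e" for e
  proof -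
    obtain d where d: "d > 0" "\<And>s t. s \<in> \<rat> \<Longrightarrow> t \<in> \<rat> \<Longrightarrow> 0 < \<bar>s\<bar> \<Longrightarrow> \<bar>s\<bar> < d \<Longrightarrow> 0 < \<bar>t\<bar> \<Longrightarrow> \<bar>t\<bar> < d \<Longrightarrow> \<bar>Q s - Q t\<bar> \<le> e/3"
      using cauchy[of "e/3"] \<open>0 < e\<close> by auto
    have "\<bar>Q s - Q t\<bar> \<le> e" if st: "0 < \<bar>s\<bar>" "\<bar>s\<bar> < d" "0 < \<bar>t\<bar>" "\<bar>t\<bar> < d" for s t
    proof -
      obtain s' where s': "s'\<in>\<rat>" "0 < \<bar>s'\<bar>" "\<bar>s'\<bar> < d" "\<bar>Q s - Q s'\<bar> < e/3"
        using rat_approx[of s d "e/3"] st \<open>0 < e\<close> by auto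
      obtain t' where t': "t'\<in>\<rat>" "0 < \<bar>t'\<bar>" "\<bar>t'\<bar> < d" "\<bar>Q t - Q t'\<bar> < e/3"
        using rat_approx[of t d "e/3"] st \<open>0 < e\<close> by auto
      show ?thesis using d(2)[of s' t'] s' t' by linarith
    qed
    then show ?thesis using d(1) by blast
  qed
  define a where "a n = Q (1 / real (Suc n))" for n
  have "Cauchy a"
  proof (rule metric_CauchyI)
    fix e :: real assume "0 < e"
    then obtain d where d: "d > 0" "\<And>s t. 0 < \<bar>s\<bar> \<Longrightarrow> \<bar>s\<bar> < d \<Longrightarrow> 0 < \<bar>t\<bar> \<Longrightarrow> \<bar>t\<bar> < d \<Longrightarrow> \<bar>Q s - Q t\<bar> \<le> e/2"
      using real_cauchy[of "e/2"] by auto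
    obtain N where N: "1 / real (Suc N) < d" using d(1) nat_approx_posE by blast
    have small: "1 / real (Suc n) < d" if "n \<ge> N" for n
    proof -
      have "1 / real (Suc n) \<le> 1 / real (Suc N)" using that by (intro divide_left_mono) auto
      then show ?thesis using N by linarith
    qed
    have "dist (a m) (a n) < e" if "m \<ge> N" "n \<ge> N" for m n
    proof -
      have "\<bar>a m - a n\<bar> \<le> e/2"
        unfolding a_def by (rule d(2)) (use small[OF that(1)] small[OF that(2)] in auto)
      then show ?thesis using \<open>0 < e\<close> by (simp add: dist_real_def)
    qed
    then show "\<exists>N. \<forall>m\<ge>N. \<forall>n\<ge>N. dist (a m) (a n) < e" by blast
  qed
  then obtain l where l: "a \<longlonglongrightarrow> l" using Cauchy_convergent convergent_def by blast
  have "(Q \<longlongrightarrow> l) (at 0)"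
  proof (rule LIM_I)
    fix e :: real assume "0 < e"
    then obtain d where d: "d > 0" "\<And>s t. 0 < \<bar>s\<bar> \<Longrightarrow> \<bar>s\<bar> < d \<Longrightarrow> 0 < \<bar>t\<bar> \<Longrightarrow> \<bar>t\<bar> < d \<Longrightarrow> \<bar>Q s - Q t\<bar> \<le> e/3"
      using real_cauchy[of "e/3"] by auto
    obtain N where N: "1 / real (Suc N) < d" using d(1) nat_approx_posE by blast
    obtain N' where N': "\<And>n. n \<ge> N' \<Longrightarrow> \<bar>a n - l\<bar> < e/3"
      using LIMSEQ_D[OF l, of "e/3"] \<open>0 < e\<close> by auto
    define n where "n = max N N'"
    have "1 / real (Suc n) \<le> 1 / real (Suc N)" by (intro divide_left_mono) (auto simp: n_def)
    then have sm: "1 / real (Suc n) < d" using N by linarith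
    have "\<bar>Q t - l\<bar> < e" if "t \<noteq> 0" "\<bar>t\<bar> < d" for t
    proof -
      have "\<bar>Q t - a n\<bar> \<le> e/3" unfolding a_def by (rule d(2)) (use that sm in auto)
      moreover have "\<bar>a n - l\<bar> < e/3" by (rule N') (simp add: n_def)
      ultimately show ?thesis using \<open>0 < e\<close> by linarith
    qed
    then show "\<exists>s>0. \<forall>x. x \<noteq> 0 \<and> norm (x - 0) < s \<longrightarrow> norm (Q x - l) < e"
      using d(1) by auto
  qed
  then show ?thesis by blast
qed

section \<open>Directional derivatives and Rademacher's theorem in several variables\<close>

definition diff_quot :: "('a::real_vector \<Rightarrow> real) \<Rightarrow> 'a \<Rightarrow> 'a \<Rightarrow> real \<Rightarrow> real" where
  "diff_quot f v z t = (f (z + t *\<^sub>R v) - f z) / t"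

text \<open>Taking the limit along one fixed sequence yields a total Borel function that agrees with
  the directional derivative wherever the latter exists.\<close>

definition dir_deriv :: "('a::real_vector \<Rightarrow> real) \<Rightarrow> 'a \<Rightarrow> 'a \<Rightarrow> real" where
  "dir_deriv f v z = lim (\<lambda>n. diff_quot f v z (1 / real (Suc n)))"

lemma dir_deriv_eqI:
  assumes "(diff_quot f v z \<longlongrightarrow> l) (at 0)"
  shows "dir_deriv f v z = l" "(\<lambda>n. diff_quot f v z (1 / real (Suc n))) \<longlonglongrightarrow> l"
proof -
  have "filterlim (\<lambda>n. 1 / real (Suc n)) (at 0) sequentially"
    unfolding filterlim_at using LIMSEQ_Suc[OF lim_1_over_n] by simp
  then show "(\<lambda>n. diff_quot f v z (1 / real (Suc n))) \<longlonglongrightarrow> l"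
    by (rule filterlim_compose[OF assms])
  then show "dir_deriv f v z = l" unfolding dir_deriv_def by (rule limI)
qed

text \<open>Adding \<open>C\<close> turns both functions into nonnegative densities. The resulting
  measures agree on boxes, an intersection-stable generator, so they coincide, and densities are
  unique almost everywhere.\<close>

lemma AE_eq_if_box_integral_eq:
  fixes g h :: "'a::euclidean_space \<Rightarrow> real"
  assumes [measurable]: "g \<in> borel_measurable borel" "h \<in> borel_measurable borel"
    and gC: "AE z in lborel. \<bar>g z\<bar> \<le> C" and hC: "AE z in lborel. \<bar>h z\<bar> \<le> C"
    and eq: "\<And>l u. (\<integral>z. indicator (box l u) z * g z \<partial>lborel) = (\<integral>z. indicator (box l u) z * h z \<partial>lborel)"
  shows "AE z in lborel. g z = h z"
proof -
  have box: "emeasure (density lborel (\<lambda>z. ennreal (k z + C))) (box l u) =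
      ennreal ((\<integral>z. indicator (box l u) z * k z \<partial>lborel) + C * measure lborel (box l u))"
    if [measurable]: "k \<in> borel_measurable borel" and kC: "AE z in lborel. \<bar>k z\<bar> \<le> C" for k l u
  proof -
    have fin: "emeasure lborel (box l u) < \<infinity>" by (rule emeasure_lborel_box_finite)
    have i0: "integrable lborel (\<lambda>z. C * indicator (box l u) z)"
      by (intro integrable_mult_right integrable_real_indicator) (use fin in auto)
    have i1: "integrable lborel (\<lambda>z. indicator (box l u) z * k z)"
      by (rule Bochner_Integration.integrable_bound[OF i0], measurable)
        (use kC in eventually_elim, auto simp: indicator_def)
    have "emeasure (density lborel (\<lambda>z. ennreal (k z + C))) (box l u) =
       (\<integral>\<^sup>+z. ennreal (indicator (box l u) z * k z + C * indicator (box l u) z) \<partial>lborel)"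
      by (subst emeasure_density) (auto intro!: nn_integral_cong simp: indicator_def)
    also have "\<dots> = ennreal (\<integral>z. indicator (box l u) z * k z + C * indicator (box l u) z \<partial>lborel)"
      by (rule nn_integral_eq_integral[OF Bochner_Integration.integrable_add[OF i1 i0]])
        (use kC in eventually_elim, auto simp: indicator_def)
    also have "(\<integral>z. indicator (box l u) z * k z + C * indicator (box l u) z \<partial>lborel) =
       (\<integral>z. indicator (box l u) z * k z \<partial>lborel) + C * measure lborel (box l u)"
      by (subst Bochner_Integration.integral_add[OF i1 i0]) simp
    finally show ?thesis .
  qed
  have "density lborel (\<lambda>z. ennreal (g z + C)) = density lborel (\<lambda>z. ennreal (h z + C))"
  proof (rule measure_eqI_generator_eq)
    let ?E = "range (\<lambda>(a, b). box a b::'a set)"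
    show "Int_stable ?E" by (auto simp: Int_stable_def box_Int_box)
    show "?E \<subseteq> Pow UNIV" "sets (density lborel (\<lambda>z. ennreal (g z + C))) = sigma_sets UNIV ?E"
      "sets (density lborel (\<lambda>z. ennreal (h z + C))) = sigma_sets UNIV ?E"
      by (simp_all add: borel_eq_box)
    let ?A = "\<lambda>n::nat. box (- (real n *\<^sub>R One)) (real n *\<^sub>R One) :: 'a set"
    show "range ?A \<subseteq> ?E" "(\<Union>i. ?A i) = UNIV"
      unfolding UN_box_eq_UNIV by auto
    show "emeasure (density lborel (\<lambda>z. ennreal (g z + C))) (?A i) \<noteq> \<infinity>" for i
      by (subst box) (auto simp: gC)
    show "emeasure (density lborel (\<lambda>z. ennreal (g z + C))) X = emeasure (density lborel (\<lambda>z. ennreal (h z + C))) X"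
      if "X \<in> ?E" for X
      using that by (auto simp: box gC hC eq)
  qed
  then have "AE z in lborel. ennreal (g z + C) = ennreal (h z + C)"
    by (subst (asm) sigma_finite_measure.density_unique_iff[OF sigma_finite_lborel]) auto
  with gC hC show ?thesis
    by eventually_elim (auto simp: abs_le_iff)
qed

context
  fixes f :: "'a::euclidean_space \<Rightarrow> real" and L :: real
  assumes lip: "\<And>x y. \<bar>f x - f y\<bar> \<le> L * norm (x - y)"
begin

lemma lipschitz_const_nonneg: "0 \<le> L"
proof -
  obtain b :: 'a where "b \<in> Basis" using nonempty_Basis by blast
  then show ?thesis using lip[of b 0] by simp
qed

lemma lipschitz_continuous: "continuous_on A f"
  by (rule lipschitz_on_continuous_on[of L], rule lipschitz_onI)
    (use lip lipschitz_const_nonneg in \<open>auto simp: dist_real_def dist_norm\<close>)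

lemma lipschitz_borel: "f \<in> borel_measurable borel"
  using lipschitz_continuous by (rule borel_measurable_continuous_onI)

lemma diff_quot_le: "\<bar>diff_quot f v z t\<bar> \<le> L * norm v"
proof (cases "t = 0")
  case False
  then show ?thesis using lip[of "z + t *\<^sub>R v" z]
    by (simp add: diff_quot_def abs_divide field_simps)
qed (simp add: diff_quot_def lipschitz_const_nonneg)

lemma diff_quot_borel: "(\<lambda>z. diff_quot f v z t) \<in> borel_measurable borel"
  unfolding diff_quot_def using lipschitz_borel by measurable

text \<open>The exceptional set \<open>N\<close> is Borel and, by the one-variable theorem, meets
  every line in direction \<open>v\<close> in a null set; Fubini and translation invariance then
  make \<open>N\<close> itself null.\<close>

lemma AE_directional_derivative: "AE z in lborel. \<exists>l. (diff_quot f v z \<longlongrightarrow> l) (at 0)"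
proof -
  note [measurable] = diff_quot_borel
  define R where "R n = {t \<in> \<rat>. 0 < \<bar>t\<bar> \<and> \<bar>t\<bar> < 1 / real (Suc n)}" for n
  have R_count: "countable (R n)" for n
    by (rule countable_subset[OF _ countable_rat]) (auto simp: R_def)
  \<comment> \<open>Failure of the rational Cauchy criterion: some gap
    \<open>1 / real (Suc k)\<close> persists at all scales.\<close>
  define N where "N = (\<Union>k. \<Inter>n. \<Union>s\<in>R n. \<Union>t\<in>R n.
      {z. 1 / real (Suc k) < \<bar>diff_quot f v z s - diff_quot f v z t\<bar>})"
  have N[measurable]: "N \<in> sets borel"
    unfolding N_def
    by (intro sets.countable_UN' sets.countable_INT'' R_count) (auto intro!: R_count sets.countable_UN')
  have conv: "\<exists>l. (diff_quot f v z \<longlongrightarrow> l) (at 0)" if "z \<notin> N" for z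
  proof (rule tendsto_at_0_if_Cauchy_on_rationals)
    show "isCont (diff_quot f v z) t" if "t \<noteq> 0" for t
    proof -
      have "isCont (\<lambda>t. f (z + t *\<^sub>R v)) t"
        by (rule continuous_at_compose[unfolded o_def, of _ _ f])
          (use lipschitz_continuous[of UNIV] in \<open>auto simp: continuous_on_eq_continuous_at intro!: continuous_intros\<close>)
      then show ?thesis using that unfolding diff_quot_def[abs_def] by (intro continuous_intros) auto
    qed
    fix e :: real assume "0 < e"
    then obtain k where k: "1 / real (Suc k) < e" using nat_approx_posE by blast
    have "\<exists>n. \<forall>s\<in>R n. \<forall>t\<in>R n. \<bar>diff_quot f v z s - diff_quot f v z t\<bar> \<le> 1 / real (Suc k)"
      using \<open>z \<notin> N\<close> unfolding N_def by (simp add: not_less del: of_nat_Suc)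
    then obtain n where n: "\<And>s t. s \<in> R n \<Longrightarrow> t \<in> R n \<Longrightarrow> \<bar>diff_quot f v z s - diff_quot f v z t\<bar> \<le> 1 / real (Suc k)"
      by blast
    have "\<bar>diff_quot f v z s - diff_quot f v z t\<bar> \<le> e" if "s \<in> R n" "t \<in> R n" for s t
      using n[OF that] k by linarith
    then show "\<exists>d>0. \<forall>s\<in>\<rat>. \<forall>t\<in>\<rat>. 0 < \<bar>s\<bar> \<and> \<bar>s\<bar> < d \<and> 0 < \<bar>t\<bar> \<and> \<bar>t\<bar> < d \<longrightarrow>
        \<bar>diff_quot f v z s - diff_quot f v z t\<bar> \<le> e"
      by (intro exI[of _ "1 / real (Suc n)"] conjI) (simp_all add: R_def del: of_nat_Suc)
  qed
  \<comment> \<open>The converse inclusion puts the trace of \<open>N\<close> on a line inside the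
    non-differentiability set of the restriction of \<open>f\<close> to that line.\<close>
  have not_N: "z \<notin> N" if lim: "(diff_quot f v z \<longlongrightarrow> l) (at 0)" for z l
  proof
    assume "z \<in> N"
    then obtain k where k: "\<And>n. \<exists>s\<in>R n. \<exists>t\<in>R n. 1 / real (Suc k) < \<bar>diff_quot f v z s - diff_quot f v z t\<bar>"
      unfolding N_def by auto
    obtain d where d: "d > 0" "\<And>t. t \<noteq> 0 \<Longrightarrow> \<bar>t\<bar> < d \<Longrightarrow> \<bar>diff_quot f v z t - l\<bar> < 1 / real (Suc k) / 2"
      using LIM_D[OF lim, of "1 / real (Suc k) / 2"] by auto
    obtain n where n: "1 / real (Suc n) < d" using d(1) nat_approx_posE by blast
    obtain s t where st: "s \<in> R n" "t \<in> R n" "1 / real (Suc k) < \<bar>diff_quot f v z s - diff_quot f v z t\<bar>"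
      using k by blast
    have "\<bar>diff_quot f v z s - l\<bar> < 1 / real (Suc k) / 2" "\<bar>diff_quot f v z t - l\<bar> < 1 / real (Suc k) / 2"
    proof -
      have "x \<noteq> 0 \<and> \<bar>x\<bar> < d" if "x \<in> R n" for x
        using that n by (simp add: R_def del: of_nat_Suc)
      then show "\<bar>diff_quot f v z s - l\<bar> < 1 / real (Suc k) / 2" "\<bar>diff_quot f v z t - l\<bar> < 1 / real (Suc k) / 2"
        using d(2) st by blast+
    qed
    moreover have "\<bar>diff_quot f v z s - diff_quot f v z t\<bar> \<le> \<bar>diff_quot f v z s - l\<bar> + \<bar>diff_quot f v z t - l\<bar>"
      using abs_triangle_ineq4[of "diff_quot f v z s - l" "diff_quot f v z t - l"] by simp
    ultimately have "\<bar>diff_quot f v z s - diff_quot f v z t\<bar> < 1 / real (Suc k) / 2 + 1 / real (Suc k) / 2"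
      by (meson add_strict_mono order_le_less_trans)
    then show False using st(3) by (simp only: field_sum_of_halves)
  qed
  have line_null: "(\<integral>\<^sup>+t. indicator N (z + t *\<^sub>R v) \<partial>(lborel :: real measure)) = 0" for z
  proof -
    define g where "g t = f (z + t *\<^sub>R v)" for t
    have "\<bar>g x - g y\<bar> \<le> (L * norm v) * \<bar>x - y\<bar>" for x y
      using lip[of "z + x *\<^sub>R v" "z + y *\<^sub>R v"]
      by (simp add: g_def algebra_simps flip: scaleR_diff_left)
    then have neg: "negligible {t. \<not> g differentiable (at t)}" by (rule lipschitz_real_differentiable_ae)
    have sub: "{t. z + t *\<^sub>R v \<in> N} \<subseteq> {t. \<not> g differentiable (at t)}"
    proof clarify
      fix t assume "z + t *\<^sub>R v \<in> N" "g differentiable (at t)"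
      then obtain D where "(g has_field_derivative D) (at t)"
        using real_differentiable_def by blast
      then have "((\<lambda>h. (g (t + h) - g t) / h) \<longlongrightarrow> D) (at 0)" by (simp add: DERIV_def)
      then have "(diff_quot f v (z + t *\<^sub>R v) \<longlongrightarrow> D) (at 0)"
        by (simp add: g_def diff_quot_def[abs_def] algebra_simps)
      then show False using not_N \<open>z + t *\<^sub>R v \<in> N\<close> by blast
    qed
    have m: "{t. z + t *\<^sub>R v \<in> N} \<in> sets borel" by measurable
    have "{t. z + t *\<^sub>R v \<in> N} \<in> null_sets lebesgue"
      using negligible_subset[OF neg sub] negligible_iff_null_sets by blast
    then have "emeasure lborel {t. z + t *\<^sub>R v \<in> N} = 0"
      using m by (simp add: null_sets_def emeasure_completion)
    moreover have "(\<integral>\<^sup>+t. indicator N (z + t *\<^sub>R v) \<partial>(lborel :: real measure)) =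
        (\<integral>\<^sup>+t. indicator {t. z + t *\<^sub>R v \<in> N} t \<partial>lborel)"
      by (intro nn_integral_cong) (auto simp: indicator_def)
    ultimately show ?thesis using m by simp
  qed
  have shift: "(\<integral>\<^sup>+z. indicator N (z + t *\<^sub>R v) \<partial>lborel) = emeasure lborel N" for t
  proof -
    have "(\<integral>\<^sup>+z. indicator N (z + t *\<^sub>R v) \<partial>lborel) = (\<integral>\<^sup>+z. indicator N z \<partial>distr lborel borel ((+) (t *\<^sub>R v)))"
      by (subst nn_integral_distr) (auto simp: add.commute)
    then show ?thesis by (simp add: lborel_distr_plus)
  qed
  \<comment> \<open>Integrating over \<open>z\<close> first gives the measure of \<open>N\<close>
    for every \<open>t\<close>, hence that measure times infinity in total; integrating over
    \<open>t\<close> first gives 0.\<close>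
  have "(\<integral>\<^sup>+t. \<integral>\<^sup>+z. indicator N (z + t *\<^sub>R v) \<partial>lborel \<partial>(lborel :: real measure)) =
     (\<integral>\<^sup>+z. \<integral>\<^sup>+t. indicator N (z + t *\<^sub>R v) \<partial>(lborel :: real measure) \<partial>lborel)"
    by (rule lborel_pair.Fubini') measurable
  then have "emeasure lborel N * \<infinity> = 0"
    by (simp add: shift line_null)
  then have "emeasure lborel N = 0" by (simp add: ennreal_mult_eq_top_iff)
  then have "N \<in> null_sets lborel" by auto
  then show ?thesis by (rule AE_I'[where N = N]) (use conv in auto)
qed

lemma dir_deriv_borel: "dir_deriv f v \<in> borel_measurable borel"
  unfolding dir_deriv_def[abs_def] by (rule borel_measurable_lim_metric) (rule diff_quot_borel)

lemma dir_deriv_le: "AE z in lborel. \<bar>dir_deriv f v z\<bar> \<le> L * norm v"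
  using AE_directional_derivative[of v]
proof eventually_elim
  case (elim z)
  then obtain l where "(diff_quot f v z \<longlongrightarrow> l) (at 0)" by blast
  note l = dir_deriv_eqI[OF this]
  have "\<bar>l\<bar> \<le> L * norm v"
    by (rule LIMSEQ_le_const2[OF tendsto_rabs[OF l(2)]]) (use diff_quot_le in auto)
  then show ?case using l by simp
qed

text \<open>Convergence can fail only on the boundary of the box, which is null.\<close>

lemma shifted_indicator_tendsto:
  fixes l u :: 'a
  shows "AE z in lborel. (\<lambda>n. indicator (box l u) (z - (1 / real (Suc n)) *\<^sub>R v) :: real)
    \<longlonglongrightarrow> indicator (box l u) z"
proof -
  have "cbox l u - box l u \<in> null_sets lebesgue"
    using negligible_frontier_interval[of l u] by (simp add: negligible_iff_null_sets)
  then have "cbox l u - box l u \<in> null_sets lborel"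
    by (simp add: null_sets_completion_iff)
  then have "AE z in lborel. z \<notin> cbox l u - box l u" by (rule AE_not_in)
  then show ?thesis
  proof eventually_elim
    case (elim z)
    have "(\<lambda>n. z - (1 / real (Suc n)) *\<^sub>R v) \<longlonglongrightarrow> z - 0 *\<^sub>R v"
      using LIMSEQ_Suc[OF lim_1_over_n] by (intro tendsto_intros)
    then have lim: "(\<lambda>n. z - (1 / real (Suc n)) *\<^sub>R v) \<longlonglongrightarrow> z" by simp
    show ?case
    proof (cases "z \<in> box l u")
      case True
      have "\<forall>\<^sub>F n in sequentially. z - (1 / real (Suc n)) *\<^sub>R v \<in> box l u"
        using topological_tendstoD[OF lim open_box True] .
      then show ?thesis using True
        by (intro tendsto_eventually) (auto elim!: eventually_mono)
    next
      case False
      then have "z \<in> - cbox l u" using elim by auto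
      then have "\<forall>\<^sub>F n in sequentially. z - (1 / real (Suc n)) *\<^sub>R v \<in> - cbox l u"
        using topological_tendstoD[OF lim, of "- cbox l u"] by (simp add: closed_cbox open_Compl)
      then have "\<forall>\<^sub>F n in sequentially. indicator (box l u) (z - (1 / real (Suc n)) *\<^sub>R v) = (0::real)"
        by (rule eventually_mono) (use box_subset_cbox in \<open>auto simp: indicator_def\<close>)
      then show ?thesis using False by (intro tendsto_eventually) auto
    qed
  qed
qed

lemma AE_dir_deriv_LIMSEQ:
  "AE z in lborel. (\<lambda>n. diff_quot f v z (1 / real (Suc n))) \<longlonglongrightarrow> dir_deriv f v z"
  using AE_directional_derivative[of v] by eventually_elim (metis dir_deriv_eqI)

text \<open>The quotient in direction \<open>v + w\<close> splits into one for \<open>v\<close> at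
  \<open>z\<close> and one for \<open>w\<close> at the moving base point z + tv. Under the integral,
  a translation transfers this shift to the indicator of the box, where it disappears in the
  limit.\<close>

lemma box_integral_dir_deriv_add:
  fixes l u :: 'a
  shows "(\<integral>z. indicator (box l u) z * dir_deriv f (v + w) z \<partial>lborel) =
    (\<integral>z. indicator (box l u) z * dir_deriv f v z \<partial>lborel) + (\<integral>z. indicator (box l u) z * dir_deriv f w z \<partial>lborel)"
proof -
  note [measurable] = lipschitz_borel diff_quot_borel dir_deriv_borel
  let ?B = "box l u" and ?h = "\<lambda>n. 1 / real (Suc n)"
  \<comment> \<open>One ball \<open>S\<close> holds the box and all its shifts, which have length at
    most \<open>norm v\<close>; its indicator supplies the dominating functions.\<close>
  obtain r where r: "?B \<subseteq> ball 0 r" using bounded_box bounded_subset_ballD by blast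
  define S where "S = cball (0::'a) (r + norm v)"
  have [measurable]: "S \<in> sets borel" by (simp add: S_def)
  have S_int: "integrable lborel (\<lambda>z. c * indicator S z :: real)" for c
    by (intro integrable_mult_right integrable_real_indicator)
      (use emeasure_lborel_cball_finite[of 0 "r + norm v"] in \<open>simp_all add: S_def\<close>)
  have h1: "norm (?h n *\<^sub>R v) \<le> norm v" for n
    by (simp add: field_simps)
  have B_S: "indicator ?B z \<le> (indicator S z :: real)" "indicator ?B (z - ?h n *\<^sub>R v) \<le> (indicator S z :: real)" for z n
  proof -
    show "indicator ?B z \<le> (indicator S z :: real)"
    proof -
      have "z \<in> S" if "z \<in> ?B"
      proof -
        have "norm z < r" using r that by auto
        then show ?thesis using norm_ge_zero[of v] unfolding S_def by (simp del: norm_ge_zero)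
      qed
      then show ?thesis by (auto simp: indicator_def)
    qed
    have "z \<in> S" if "z - ?h n *\<^sub>R v \<in> ?B"
    proof -
      have "norm (z - ?h n *\<^sub>R v) < r" using subsetD[OF r that] by simp
      then show ?thesis using norm_triangle_sub[of z "?h n *\<^sub>R v"] h1[of n] by (simp add: S_def)
    qed
    then show "indicator ?B (z - ?h n *\<^sub>R v) \<le> (indicator S z :: real)"
      by (auto simp: indicator_def)
  qed
  have dom: "\<bar>a * diff_quot f x z t\<bar> \<le> L * norm x * indicator S z"
    if "0 \<le> a" "a \<le> indicator S z" for a x z t
    using mult_mono[OF that(2) diff_quot_le[of x z t]] that lipschitz_const_nonneg
    by (simp add: abs_mult mult.commute)
  have lim1: "(\<lambda>n. \<integral>z. indicator ?B z * diff_quot f x z (?h n) \<partial>lborel) \<longlonglongrightarrow>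
      (\<integral>z. indicator ?B z * dir_deriv f x z \<partial>lborel)" for x
  proof (rule integral_dominated_convergence[where w = "\<lambda>z. L * norm x * indicator S z"])
    show "AE z in lborel. (\<lambda>n. indicator ?B z * diff_quot f x z (?h n)) \<longlonglongrightarrow> indicator ?B z * dir_deriv f x z"
      using AE_dir_deriv_LIMSEQ[of x] by eventually_elim (rule tendsto_mult_left)
    show "integrable lborel (\<lambda>z. L * norm x * indicator S z)" by (rule S_int)
  qed (use B_S in \<open>auto intro!: dom\<close>)
  have lim2: "(\<lambda>n. \<integral>z. indicator ?B (z - ?h n *\<^sub>R v) * diff_quot f w z (?h n) \<partial>lborel) \<longlonglongrightarrow>
      (\<integral>z. indicator ?B z * dir_deriv f w z \<partial>lborel)"
  proof (rule integral_dominated_convergence[where w = "\<lambda>z. L * norm w * indicator S z"])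
    show "AE z in lborel. (\<lambda>n. indicator ?B (z - ?h n *\<^sub>R v) * diff_quot f w z (?h n)) \<longlonglongrightarrow> indicator ?B z * dir_deriv f w z"
      using AE_dir_deriv_LIMSEQ[of w] shifted_indicator_tendsto[of l u v] by eventually_elim (rule tendsto_mult)
    show "integrable lborel (\<lambda>z. L * norm w * indicator S z)" by (rule S_int)
  qed (use B_S in \<open>auto intro!: dom\<close>)
  have int: "integrable lborel (\<lambda>z. indicator ?B z * diff_quot f x z (?h n))" for x n
    by (rule Bochner_Integration.integrable_bound[OF S_int[of "L * norm x"]])
      (use B_S in \<open>auto intro!: dom order_trans[OF dom]\<close>)
  have int2: "integrable lborel (\<lambda>z. indicator ?B (z - ?h n *\<^sub>R v) * diff_quot f w z (?h n))" for n
    by (rule Bochner_Integration.integrable_bound[OF S_int[of "L * norm w"]])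
      (use B_S in \<open>auto intro!: dom order_trans[OF dom]\<close>)
  have split: "diff_quot f (v + w) z t = diff_quot f v z t + diff_quot f w (t *\<^sub>R v + z) t" for z t
    by (simp add: diff_quot_def algebra_simps add_divide_distrib diff_divide_distrib)
  have shift: "(\<integral>z. indicator ?B z * diff_quot f w (c + z) t \<partial>lborel) =
     (\<integral>z. indicator ?B (z - c) * diff_quot f w z t \<partial>lborel)" for c t
  proof -
    have "(\<integral>z. indicator ?B (z - c) * diff_quot f w z t \<partial>lborel) =
      (\<integral>z. indicator ?B (z - c) * diff_quot f w z t \<partial>distr lborel borel ((+) c))"
      by (simp add: lborel_distr_plus)
    also have "\<dots> = (\<integral>z. indicator ?B z * diff_quot f w (c + z) t \<partial>lborel)"
      by (subst integral_distr) auto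
    finally show ?thesis ..
  qed
  have int3: "integrable lborel (\<lambda>z. indicator ?B z * diff_quot f w (?h n *\<^sub>R v + z) (?h n))" for n
    by (rule Bochner_Integration.integrable_bound[OF S_int[of "L * norm w"]])
      (use B_S in \<open>auto intro!: dom order_trans[OF dom] simp: abs_mult mult.commute lipschitz_const_nonneg
         intro!: mult_mono diff_quot_le\<close>)
  have "(\<integral>z. indicator ?B z * diff_quot f (v + w) z (?h n) \<partial>lborel) =
      (\<integral>z. indicator ?B z * diff_quot f v z (?h n) \<partial>lborel) +
      (\<integral>z. indicator ?B (z - ?h n *\<^sub>R v) * diff_quot f w z (?h n) \<partial>lborel)" for n
    unfolding split distrib_left shift[symmetric]
    by (rule Bochner_Integration.integral_add[OF int int3])
  then have "(\<lambda>n. \<integral>z. indicator ?B z * diff_quot f (v + w) z (?h n) \<partial>lborel) \<longlonglongrightarrow>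
     (\<integral>z. indicator ?B z * dir_deriv f v z \<partial>lborel) + (\<integral>z. indicator ?B z * dir_deriv f w z \<partial>lborel)"
    using tendsto_add[OF lim1[of v] lim2] by simp
  then show ?thesis by (rule LIMSEQ_unique[OF lim1])
qed

lemma AE_dir_deriv_add: "AE z in lborel. dir_deriv f (v + w) z = dir_deriv f v z + dir_deriv f w z"
proof (rule AE_eq_if_box_integral_eq[where C = "L * norm v + L * norm w"])
  note [measurable] = dir_deriv_borel
  note le = dir_deriv_le
  show "dir_deriv f (v + w) \<in> borel_measurable borel"
    "(\<lambda>z. dir_deriv f v z + dir_deriv f w z) \<in> borel_measurable borel" by measurable
  show "AE z in lborel. \<bar>dir_deriv f (v + w) z\<bar> \<le> L * norm v + L * norm w"
    using le[of "v + w"]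
  proof eventually_elim
    case (elim z)
    also have "L * norm (v + w) \<le> L * (norm v + norm w)"
      by (intro mult_left_mono norm_triangle_ineq lipschitz_const_nonneg)
    finally show ?case by (simp add: algebra_simps)
  qed
  show "AE z in lborel. \<bar>dir_deriv f v z + dir_deriv f w z\<bar> \<le> L * norm v + L * norm w"
    using le[of v] le[of w] by eventually_elim linarith
  fix l u
  have "integrable lborel (\<lambda>z. indicator (box l u) z * dir_deriv f x z)" for x
  proof (rule Bochner_Integration.integrable_bound)
    show "integrable lborel (\<lambda>z. L * norm x * indicator (box l u) z :: real)"
      by (intro integrable_mult_right integrable_real_indicator) (use emeasure_lborel_box_finite[of l u] in auto)
    show "AE z in lborel. norm (indicator (box l u) z * dir_deriv f x z) \<le> norm (L * norm x * indicator (box l u) z)"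
      using le[of x] by eventually_elim (auto simp: indicator_def)
  qed measurable
  then show "(\<integral>z. indicator (box l u) z * dir_deriv f (v + w) z \<partial>lborel) =
     (\<integral>z. indicator (box l u) z * (dir_deriv f v z + dir_deriv f w z) \<partial>lborel)"
    by (simp add: box_integral_dir_deriv_add distrib_left)
qed

lemma AE_dir_deriv_scaleR: "AE z in lborel. dir_deriv f (c *\<^sub>R v) z = c * dir_deriv f v z"
  using AE_directional_derivative[of v]
proof eventually_elim
  case (elim z)
  then obtain l where l: "(diff_quot f v z \<longlongrightarrow> l) (at 0)" by blast
  have "(diff_quot f (c *\<^sub>R v) z \<longlongrightarrow> c * l) (at 0)"
  proof (cases "c = 0")
    case True
    then show ?thesis by (simp add: diff_quot_def[abs_def])
  next
    case False
    have "filterlim (\<lambda>t. t * c) (at 0) (at 0)"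
      using False by (auto simp: filterlim_at eventually_at_filter intro!: tendsto_eq_intros)
    then have "((\<lambda>t. c * diff_quot f v z (t * c)) \<longlongrightarrow> c * l) (at 0)"
      by (intro tendsto_mult_left filterlim_compose[OF l])
    moreover have "(\<lambda>t. c * diff_quot f v z (t * c)) = diff_quot f (c *\<^sub>R v) z"
      using False by (auto simp: diff_quot_def)
    ultimately show ?thesis by simp
  qed
  then show ?case using l by (simp add: dir_deriv_eqI)
qed

lemma AE_dir_deriv_linear:
  "AE z in lborel. dir_deriv f v z = (\<Sum>b\<in>Basis. (v \<bullet> b) * dir_deriv f b z)"
proof -
  have "AE z in lborel. dir_deriv f (\<Sum>b\<in>F. (v \<bullet> b) *\<^sub>R b) z = (\<Sum>b\<in>F. (v \<bullet> b) * dir_deriv f b z)"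
    if "finite F" for F :: "'a set"
    using that
  proof induction
    case empty
    then show ?case using AE_dir_deriv_scaleR[of 0 0] by simp
  next
    case (insert x F)
    from insert.IH AE_dir_deriv_add[of "(v \<bullet> x) *\<^sub>R x" "\<Sum>b\<in>F. (v \<bullet> b) *\<^sub>R b"] AE_dir_deriv_scaleR[of "v \<bullet> x" x]
    show ?case by eventually_elim (use insert.hyps in simp)
  qed
  from this[of Basis] show ?thesis by (simp add: euclidean_representation)
qed

text \<open>Off one null set, the derivatives in a countable dense set of directions exist and are
  given by one linear map. Compactness of the sphere leaves finitely many directions to control
  uniformly, and the Lipschitz bound covers the directions in between.\<close>

theorem lipschitz_differentiable_ae_real: "AE z in lborel. f differentiable (at z)"
proof -
  obtain V :: "'a set" where V: "countable V" "\<And>X. open X \<Longrightarrow> X \<noteq> {} \<Longrightarrow> \<exists>d\<in>V. d \<in> X"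
    using countable_dense_exists by metis
  have "AE z in lborel. \<forall>v\<in>V. (\<exists>l. (diff_quot f v z \<longlongrightarrow> l) (at 0)) \<and>
      dir_deriv f v z = (\<Sum>b\<in>Basis. (v \<bullet> b) * dir_deriv f b z)"
    using V(1) AE_directional_derivative AE_dir_deriv_linear
    by (subst AE_ball_countable) auto
  then show ?thesis
  proof eventually_elim
    case (elim z)
    define A where "A v = (\<Sum>b\<in>Basis. (v \<bullet> b) * dir_deriv f b z)" for v
    have A: "bounded_linear A"
      unfolding A_def by (intro bounded_linear_sum bounded_linear_mult_left bounded_linear_inner_left
        bounded_linear_compose[OF bounded_linear_mult_left])
    then obtain K where K: "0 < K" "\<And>x. norm (A x) \<le> norm x * K"
      using bounded_linear.pos_bounded by blast
    have lim: "(diff_quot f v z \<longlongrightarrow> A v) (at 0)" if "v \<in> V" for v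
      using elim that unfolding A_def by (metis dir_deriv_eqI(1))
    have "(f has_derivative A) (at z)"
      unfolding has_derivative_at_alt
    proof (intro conjI A allI impI)
      fix e :: real assume "0 < e"
      \<comment> \<open>Three errors are summed: 1 for the quotient in the net direction
        \<open>v\<close>, \<open>L\<close> for replacing \<open>w\<close> by \<open>v\<close> in
        \<open>f\<close>, and \<open>K\<close> for the same replacement in \<open>A\<close>.\<close>
      define \<epsilon> where "\<epsilon> = e / (1 + L + K)"
      have pos: "0 < 1 + L + K" using K lipschitz_const_nonneg by linarith
      then have "0 < \<epsilon>" using \<open>0 < e\<close> by (simp add: \<epsilon>_def)
      have "sphere (0::'a) 1 \<subseteq> (\<Union>v\<in>V. ball v \<epsilon>)"
      proof
        fix w :: 'a
        have "ball w \<epsilon> \<noteq> {}" using \<open>0 < \<epsilon>\<close> by simp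
        then obtain v where "v \<in> V" "v \<in> ball w \<epsilon>" using V(2) open_ball by blast
        then show "w \<in> (\<Union>v\<in>V. ball v \<epsilon>)" by (auto simp: dist_commute)
      qed
      then obtain F where F: "F \<subseteq> V" "finite F" "sphere 0 1 \<subseteq> (\<Union>v\<in>F. ball v \<epsilon>)"
        using compactE_image[OF compact_sphere, of V "\<lambda>v. ball v \<epsilon>"] open_ball by metis
      have "\<forall>v\<in>F. \<forall>\<^sub>F t in at 0. \<bar>diff_quot f v z t - A v\<bar> < \<epsilon>"
        using F(1) lim tendstoD[OF _ \<open>0 < \<epsilon>\<close>] by (fastforce simp: dist_real_def)
      then have "\<forall>\<^sub>F t in at 0. \<forall>v\<in>F. \<bar>diff_quot f v z t - A v\<bar> < \<epsilon>"
        using F(2) by (simp add: eventually_ball_finite)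
      then obtain d where d: "0 < d" "\<And>t v. t \<noteq> 0 \<Longrightarrow> \<bar>t\<bar> < d \<Longrightarrow> v \<in> F \<Longrightarrow> \<bar>diff_quot f v z t - A v\<bar> < \<epsilon>"
        unfolding eventually_at by (auto simp: dist_real_def)
      show "\<exists>d>0. \<forall>y. norm (y - z) < d \<longrightarrow> norm (f y - f z - A (y - z)) \<le> e * norm (y - z)"
      proof (intro exI[of _ d] conjI allI impI d(1))
        fix y assume y: "norm (y - z) < d"
        show "norm (f y - f z - A (y - z)) \<le> e * norm (y - z)"
        proof (cases "y = z")
          case True
          then show ?thesis using A by (simp add: linear_simps)
        next
          case False
          define t where "t = norm (y - z)"
          define w where "w = (1 / t) *\<^sub>R (y - z)"
          have t: "0 < t" using False by (simp add: t_def)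
          have yz: "y = z + t *\<^sub>R w" using t by (simp add: w_def)
          have "w \<in> sphere 0 1" using t by (simp add: w_def t_def)
          then obtain v where v: "v \<in> F" "norm (w - v) < \<epsilon>" using F(3) by (auto simp: dist_norm norm_minus_commute)
          have "\<bar>diff_quot f v z t - A v\<bar> < \<epsilon>" using d(2)[of t v] t y v by (simp add: t_def)
          then have 1: "\<bar>f (z + t *\<^sub>R v) - f z - t * A v\<bar> \<le> \<epsilon> * t"
            using t by (simp add: diff_quot_def abs_le_iff abs_less_iff field_simps)
          have "\<bar>f y - f (z + t *\<^sub>R v)\<bar> \<le> L * norm (t *\<^sub>R (w - v))"
            using lip[of y "z + t *\<^sub>R v"] by (simp add: yz algebra_simps)
          also have "\<dots> \<le> L * (t * \<epsilon>)"
            using v t lipschitz_const_nonneg by (intro mult_left_mono) auto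
          finally have 2: "\<bar>f y - f (z + t *\<^sub>R v)\<bar> \<le> L * (t * \<epsilon>)" .
          have "\<bar>A (w - v)\<bar> \<le> \<epsilon> * K"
            using K(2)[of "w - v"] v K(1) by (simp add: order_trans[OF _ mult_right_mono[of _ \<epsilon> K]])
          then have "t * \<bar>A (w - v)\<bar> \<le> t * (\<epsilon> * K)" using t by (intro mult_left_mono) auto
          moreover have "A (y - z) - t * A v = t * A (w - v)"
            using A by (simp add: yz linear_simps algebra_simps)
          ultimately have 3: "\<bar>A (y - z) - t * A v\<bar> \<le> t * (\<epsilon> * K)"
            using t by (simp add: abs_mult)
          have "\<bar>f y - f z - A (y - z)\<bar> \<le> \<epsilon> * t + L * (t * \<epsilon>) + t * (\<epsilon> * K)"
            using 1 2 3 by linarith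
          also have "\<dots> = \<epsilon> * (1 + L + K) * t" by (simp add: algebra_simps)
          also have "\<dots> = e * t" using pos by (simp add: \<epsilon>_def)
          finally show ?thesis by (simp add: t_def)
        qed
      qed
    qed
    then show ?case by (auto simp: differentiable_def)
  qed
qed

end

theorem lipschitz_differentiable_ae:
  fixes f :: "'a::euclidean_space \<Rightarrow> 'b::euclidean_space"
  assumes lip: "\<And>x y. norm (f x - f y) \<le> L * norm (x - y)"
  shows "AE z in lborel. f differentiable (at z)"
proof -
  have "\<bar>f x \<bullet> b - f y \<bullet> b\<bar> \<le> L * norm (x - y)" if "b \<in> Basis" for x y b
    using Basis_le_norm[OF that, of "f x - f y"] lip[of x y] by (simp add: inner_diff_left)
  then have "\<forall>b\<in>Basis. AE z in lborel. (\<lambda>z. f z \<bullet> b) differentiable (at z)"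
    by (intro ballI lipschitz_differentiable_ae_real)
  then have "AE z in lborel. \<forall>b\<in>Basis. (\<lambda>z. f z \<bullet> b) differentiable (at z)"
    by (intro AE_finite_allI) auto
  then show ?thesis
    by eventually_elim (subst differentiable_componentwise_within, blast)
qed

section \<open>Symmetric derivatives and volume\<close>

text \<open>The mixed second difference of \<open>u\<close> is unchanged when \<open>v\<close> and
  \<open>w\<close> are swapped; the mean value theorem and the expansion of \<open>J\<close> at
  \<open>z\<close> show that it is s^2 (Av . w) up to o(s^2).\<close>

lemma derivative_of_gradient_symmetric:
  fixes u :: "'a::euclidean_space \<Rightarrow> real"
  assumes grad: "\<And>x. (u has_derivative (\<lambda>h. J x \<bullet> h)) (at x)"
    and A: "(J has_derivative A) (at z)"
  shows "A v \<bullet> w = v \<bullet> A w"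
proof -
  interpret A: bounded_linear A using A by (rule has_derivative_bounded_linear)
  have second_diff: "\<exists>d>0. \<forall>s. 0 < s \<and> s < d \<longrightarrow>
      \<bar>(u (z + s *\<^sub>R v + s *\<^sub>R w) - u (z + s *\<^sub>R w)) - (u (z + s *\<^sub>R v) - u z) - s\<^sup>2 * (A v \<bullet> w)\<bar> \<le> e * s\<^sup>2"
    if "0 < e" for e v w
  proof -
    \<comment> \<open>Chosen to dominate 2(|v| + |w|)|w|, the factor in the final error; the added
      ones keep it positive.\<close>
    define C where "C = (2 * (norm v + norm w) + 1) * (norm w + 1)"
    have C: "0 < C" by (auto simp: C_def intro!: mult_pos_pos add_nonneg_pos)
    obtain d where d: "d > 0" "\<And>y. norm (y - z) < d \<Longrightarrow> norm (J y - J z - A (y - z)) \<le> e / C * norm (y - z)"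
      using A[unfolded has_derivative_at_alt] \<open>0 < e\<close> C by (meson divide_pos_pos)
    define d' where "d' = d / (norm v + norm w + 1)"
    have n: "0 < norm v + norm w + 1" by (simp add: add_nonneg_pos)
    have "\<bar>(u (z + s *\<^sub>R v + s *\<^sub>R w) - u (z + s *\<^sub>R w)) - (u (z + s *\<^sub>R v) - u z) - s\<^sup>2 * (A v \<bullet> w)\<bar> \<le> e * s\<^sup>2"
      if s: "0 < s" "s < d'" for s
    proof -
      \<comment> \<open>\<open>g 1 - g 0\<close> is the second difference, and the derivative of
        \<open>g\<close> involves \<open>J\<close> only at two points within
        \<open>s * (norm v + norm w)\<close> of \<open>z\<close>.\<close>
      define g where "g \<theta> = u (z + s *\<^sub>R v + (\<theta> * s) *\<^sub>R w) - u (z + (\<theta> * s) *\<^sub>R w)" for \<theta>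
      have g': "(g has_real_derivative s * ((J (z + s *\<^sub>R v + (\<theta> * s) *\<^sub>R w) - J (z + (\<theta> * s) *\<^sub>R w)) \<bullet> w)) (at \<theta>)" for \<theta>
        unfolding g_def has_field_derivative_def
        by (rule derivative_eq_intros has_derivative_compose[OF _ grad] refl)+
          (simp add: fun_eq_iff inner_diff_left algebra_simps)
      obtain \<theta> where \<theta>: "0 < \<theta>" "\<theta> < 1" "g 1 - g 0 = (1 - 0) * (s * ((J (z + s *\<^sub>R v + (\<theta> * s) *\<^sub>R w) - J (z + (\<theta> * s) *\<^sub>R w)) \<bullet> w))"
        using MVT2[of 0 1 g] g' by force
      define p q where "p = s *\<^sub>R v + (\<theta> * s) *\<^sub>R w" and "q = (\<theta> * s) *\<^sub>R w"
      have le: "norm p \<le> s * (norm v + norm w)" "norm q \<le> s * (norm v + norm w)"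
      proof -
        have t: "norm ((\<theta> * s) *\<^sub>R w) \<le> s * norm w" using \<theta> s by (simp add: mult_left_le_one_le mult_right_mono)
        have "norm p \<le> norm (s *\<^sub>R v) + norm ((\<theta> * s) *\<^sub>R w)" unfolding p_def by (rule norm_triangle_ineq)
        then show "norm p \<le> s * (norm v + norm w)" using t s by (simp add: algebra_simps)
        show "norm q \<le> s * (norm v + norm w)" using t s unfolding q_def
          by (simp add: algebra_simps add_increasing)
      qed
      have "s * (norm v + norm w) < d"
      proof -
        have "s * (norm v + norm w + 1) < d" using s n by (simp add: d'_def field_simps)
        then show ?thesis using s by (simp add: algebra_simps)
      qed
      then have pq: "norm (J (z + p) - J z - A p) \<le> e / C * norm p" "norm (J (z + q) - J z - A q) \<le> e / C * norm q"
        using d(2)[of "z + p"] d(2)[of "z + q"] le by auto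
      have "norm (J (z + p) - J (z + q) - s *\<^sub>R A v) = norm ((J (z + p) - J z - A p) - (J (z + q) - J z - A q))"
        by (simp add: p_def q_def A.add A.scaleR algebra_simps)
      also have "\<dots> \<le> e / C * norm p + e / C * norm q"
        using pq norm_triangle_ineq4 by (smt (verit))
      also have "\<dots> \<le> e / C * (s * (norm v + norm w)) + e / C * (s * (norm v + norm w))"
        using le \<open>0 < e\<close> C by (intro add_mono mult_left_mono) auto
      finally have J: "norm (J (z + p) - J (z + q) - s *\<^sub>R A v) \<le> e / C * s * (2 * (norm v + norm w))"
        by (simp add: algebra_simps)
      have "\<bar>(g 1 - g 0) - s\<^sup>2 * (A v \<bullet> w)\<bar> = s * \<bar>(J (z + p) - J (z + q) - s *\<^sub>R A v) \<bullet> w\<bar>"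
      proof -
        have "(g 1 - g 0) - s\<^sup>2 * (A v \<bullet> w) = s * ((J (z + p) - J (z + q) - s *\<^sub>R A v) \<bullet> w)"
          using \<theta>(3) by (simp add: p_def q_def inner_diff_left power2_eq_square algebra_simps)
        then show ?thesis using s by (simp add: abs_mult)
      qed
      also have "\<dots> \<le> s * (norm (J (z + p) - J (z + q) - s *\<^sub>R A v) * norm w)"
        using s by (intro mult_left_mono Cauchy_Schwarz_ineq2) auto
      also have "\<dots> \<le> s * (e / C * s * (2 * (norm v + norm w)) * norm w)"
        using s J by (intro mult_left_mono mult_right_mono) auto
      also have "\<dots> \<le> s * (e / C * s * C)"
      proof -
        have "2 * (norm v + norm w) * norm w \<le> C"
          unfolding C_def by (intro mult_mono) auto
        then have "e / C * s * (2 * (norm v + norm w) * norm w) \<le> e / C * s * C"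
          using s \<open>0 < e\<close> C by (intro mult_left_mono) auto
        then show ?thesis using s by (intro mult_left_mono) (auto simp: mult.assoc)
      qed
      also have "\<dots> = e * s\<^sup>2" using C by (simp add: power2_eq_square)
      finally show ?thesis by (simp add: g_def algebra_simps)
    qed
    moreover have "0 < d'" using d n by (simp add: d'_def)
    ultimately show ?thesis by blast
  qed
  have "\<bar>A v \<bullet> w - A w \<bullet> v\<bar> \<le> e" if "0 < e" for e
  proof -
    obtain d1 where d1: "d1 > 0" "\<And>s. 0 < s \<and> s < d1 \<Longrightarrow> \<bar>(u (z + s *\<^sub>R v + s *\<^sub>R w) - u (z + s *\<^sub>R w)) - (u (z + s *\<^sub>R v) - u z) - s\<^sup>2 * (A v \<bullet> w)\<bar> \<le> e/2 * s\<^sup>2"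
      using second_diff[of "e/2" v w] \<open>0 < e\<close> by auto
    obtain d2 where d2: "d2 > 0" "\<And>s. 0 < s \<and> s < d2 \<Longrightarrow> \<bar>(u (z + s *\<^sub>R w + s *\<^sub>R v) - u (z + s *\<^sub>R v)) - (u (z + s *\<^sub>R w) - u z) - s\<^sup>2 * (A w \<bullet> v)\<bar> \<le> e/2 * s\<^sup>2"
      using second_diff[of "e/2" w v] \<open>0 < e\<close> by auto
    define s where "s = min d1 d2 / 2"
    have s: "0 < s" "s < d1" "s < d2" using d1(1) d2(1) by (auto simp: s_def)
    have eq: "z + s *\<^sub>R w + s *\<^sub>R v = z + s *\<^sub>R v + s *\<^sub>R w" by simp
    have "\<bar>s\<^sup>2 * (A v \<bullet> w) - s\<^sup>2 * (A w \<bullet> v)\<bar> \<le> e / 2 * s\<^sup>2 + e / 2 * s\<^sup>2"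
      using d1(2)[of s] d2(2)[of s] s unfolding eq by linarith
    moreover have "s\<^sup>2 * (A v \<bullet> w) - s\<^sup>2 * (A w \<bullet> v) = s\<^sup>2 * (A v \<bullet> w - A w \<bullet> v)"
      by (simp add: right_diff_distrib)
    ultimately have "s\<^sup>2 * \<bar>A v \<bullet> w - A w \<bullet> v\<bar> \<le> s\<^sup>2 * e"
      by (simp add: abs_mult mult.commute[of e])
    then show ?thesis using s by simp
  qed
  then have "A v \<bullet> w - A w \<bullet> v = 0"
    by (metis abs_le_zero_iff field_le_epsilon add_0)
  then show ?thesis by (simp add: inner_commute)
qed

text \<open>A maximiser of the Rayleigh quotient on the unit sphere of \<open>V\<close> is an
  eigenvector, and its orthogonal complement in \<open>V\<close> is again invariant, so induction on
  the dimension applies. Quantifying over invariant subspaces is what lets the induction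
  run.\<close>

lemma self_adjoint_eigenbasis_subspace:
  fixes A :: "'a::euclidean_space \<Rightarrow> 'a"
  assumes A: "linear A" "\<And>x y. A x \<bullet> y = x \<bullet> A y"
    and V: "subspace V" "A ` V \<subseteq> V"
  shows "\<exists>B. B \<subseteq> V \<and> finite B \<and> pairwise orthogonal B \<and> span B = V \<and> (\<forall>b\<in>B. norm b = 1 \<and> (\<exists>l. A b = l *\<^sub>R b))"
  using V
proof (induction "dim V" arbitrary: V rule: less_induct)
  case less
  show ?case
  proof (cases "V = {0}")
    case True
    then show ?thesis by (intro exI[of _ "{}"]) auto
  next
    case False
    then obtain v where v: "v \<in> V" "v \<noteq> 0" using less.prems subspace_0 by blast
    have cont: "continuous_on S A" for S
      using A(1) by (simp add: linear_continuous_on linear_conv_bounded_linear)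
    have comp: "compact (sphere 0 1 \<inter> V)"
      using less.prems by (intro compact_Int_closed) (auto simp: closed_subspace)
    have "(1 / norm v) *\<^sub>R v \<in> sphere 0 1 \<inter> V"
      using v less.prems by (auto simp: subspace_scale)
    then have ne: "sphere 0 1 \<inter> V \<noteq> {}" by blast
    have "continuous_on (sphere 0 1 \<inter> V) (\<lambda>y. y \<bullet> A y)" by (intro continuous_intros cont)
    from continuous_attains_sup[OF comp ne this]
    obtain x where x: "x \<in> sphere 0 1 \<inter> V" "\<And>y. y \<in> sphere 0 1 \<inter> V \<Longrightarrow> y \<bullet> A y \<le> x \<bullet> A x"
      by blast
    define l where "l = x \<bullet> A x"
    have x1: "x \<bullet> x = 1" using x(1) by (simp add: norm_eq_1)
    have le: "y \<bullet> A y \<le> l * (y \<bullet> y)" if "y \<in> V" for y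
    proof (cases "y = 0")
      case True then show ?thesis using A(1) by (simp add: linear_0)
    next
      case False
      have "((1 / norm y) *\<^sub>R y) \<bullet> A ((1 / norm y) *\<^sub>R y) \<le> l"
        unfolding l_def using False that less.prems by (intro x(2)) (auto simp: subspace_scale)
      then have "(y \<bullet> A y) / (norm y)\<^sup>2 \<le> l"
        using A(1) by (simp add: linear_scale power2_eq_square)
      then show ?thesis using False by (simp add: field_simps power2_norm_eq_inner)
    qed
    define w where "w = A x - l *\<^sub>R x"
    have wV: "w \<in> V" using x less.prems by (auto simp: w_def intro!: subspace_diff subspace_scale)
    have wx: "w \<bullet> x = 0" using x1 by (simp add: w_def inner_diff_left l_def) (simp add: inner_commute)
    have "w \<bullet> w = 0"
    proof -
      \<comment> \<open>Maximality tested at \<open>x + t *\<^sub>R w\<close>: the residual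
        \<open>w\<close> is a direction of first-order increase unless it vanishes.\<close>
      have ineq: "2 * t * (w \<bullet> w) \<le> t\<^sup>2 * (l * (w \<bullet> w) - w \<bullet> A w)" for t
      proof -
        have e1: "(x + t *\<^sub>R w) \<bullet> A (x + t *\<^sub>R w) \<le> l * ((x + t *\<^sub>R w) \<bullet> (x + t *\<^sub>R w))"
          using x wV less.prems by (intro le) (auto intro!: subspace_add subspace_scale)
        have e2: "(x + t *\<^sub>R w) \<bullet> A (x + t *\<^sub>R w) = l + 2 * t * (A x \<bullet> w) + t\<^sup>2 * (w \<bullet> A w)"
          using A(1) A(2)[of x w] by (simp add: linear_add linear_scale l_def inner_left_distrib inner_right_distrib
              power2_eq_square algebra_simps inner_commute)
        have e3: "(x + t *\<^sub>R w) \<bullet> (x + t *\<^sub>R w) = 1 + t\<^sup>2 * (w \<bullet> w)"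
          using x1 wx by (simp add: inner_left_distrib inner_right_distrib power2_eq_square inner_commute)
        have e4: "A x \<bullet> w = w \<bullet> w"
          using wx arg_cong[OF w_def, of "\<lambda>y. y \<bullet> w"] by (simp add: inner_diff_left inner_commute[of x w])
        show ?thesis using e1 unfolding e2 e3 e4 by (simp add: algebra_simps)
      qed
      show ?thesis
      proof (rule ccontr)
        assume "w \<bullet> w \<noteq> 0"
        then have pos: "0 < w \<bullet> w" by simp
        \<comment> \<open>With t = (w . w)/k the quadratic term is only t (w . w), half of the
          linear term it would have to dominate.\<close>
        define k where "k = \<bar>l * (w \<bullet> w) - w \<bullet> A w\<bar> + 1"
        define t where "t = (w \<bullet> w) / k"
        have k: "0 < k" "l * (w \<bullet> w) - w \<bullet> A w \<le> k" by (auto simp: k_def)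
        have t: "0 < t" using pos k by (simp add: t_def)
        have "2 * t * (w \<bullet> w) \<le> t\<^sup>2 * k"
          by (rule order_trans[OF ineq]) (intro mult_left_mono k(2), simp)
        also have "\<dots> = t * (w \<bullet> w)" using k by (simp add: t_def power2_eq_square)
        finally show False using t pos by simp
      qed
    qed
    then have Ax: "A x = l *\<^sub>R x" by (simp add: w_def)
    define V' where "V' = V \<inter> {y. x \<bullet> y = 0}"
    have V': "subspace V'" unfolding V'_def using less.prems(1) subspace_hyperplane by (rule subspace_inter)
    have AV': "A ` V' \<subseteq> V'"
    proof
      fix y assume "y \<in> A ` V'"
      then obtain y' where y': "y' \<in> V'" "y = A y'" by blast
      have "x \<bullet> A y' = A x \<bullet> y'" by (simp add: A(2))
      also have "\<dots> = 0" using y' by (simp add: Ax V'_def)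
      finally show "y \<in> V'" using y' less.prems by (auto simp: V'_def)
    qed
    have "x \<notin> V'" using x1 by (simp add: V'_def)
    then have "V' \<subset> V" using x unfolding V'_def by blast
    then have "span V' \<subset> span V"
      using V' less.prems(1) by (metis span_eq_iff)
    then have "dim V' < dim V" by (rule dim_psubset)
    then obtain B where B: "B \<subseteq> V'" "finite B" "pairwise orthogonal B" "span B = V'"
      "\<forall>b\<in>B. norm b = 1 \<and> (\<exists>l. A b = l *\<^sub>R b)"
      using less.hyps[OF _ V' AV'] by blast
    have "span (insert x B) = V"
    proof
      show "span (insert x B) \<subseteq> V" using x B less.prems by (intro span_minimal) (auto simp: V'_def)
      show "V \<subseteq> span (insert x B)"
      proof
        fix y assume "y \<in> V"
        have "y - (x \<bullet> y) *\<^sub>R x \<in> V'"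
          using \<open>y \<in> V\<close> x less.prems x1 by (auto simp: V'_def inner_diff_right intro!: subspace_diff subspace_scale)
        then show "y \<in> span (insert x B)" using B(4) by (auto simp: span_insert)
      qed
    qed
    moreover have "pairwise orthogonal (insert x B)"
      using B by (auto simp: pairwise_insert orthogonal_def V'_def inner_commute)
    ultimately show ?thesis
      using B x Ax by (intro exI[of _ "insert x B"]) (auto simp: V'_def)
  qed
qed

text \<open>The eigenvalues are nonnegative with arithmetic mean at most 1, so their geometric mean,
  and with it their product, is at most 1.\<close>

lemma abs_det_le_1_if_trace_le:
  fixes A :: "real^'n \<Rightarrow> real^'n"
  assumes A: "linear A" "\<And>x y. A x \<bullet> y = x \<bullet> A y" and pos: "\<And>x. 0 \<le> A x \<bullet> x"
    and tr: "trace (matrix A) \<le> real CARD('n)"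
  shows "\<bar>det (matrix A)\<bar> \<le> 1"
proof -
  obtain B where B: "finite B" "pairwise orthogonal B" "span B = UNIV"
    "\<And>b. b \<in> B \<Longrightarrow> norm b = 1" "\<And>b. b \<in> B \<Longrightarrow> \<exists>l. A b = l *\<^sub>R b"
    using self_adjoint_eigenbasis_subspace[OF A, of UNIV] by auto
  have "0 \<notin> B" using B(4)[of 0] by auto
  then have "independent B" by (rule pairwise_orthogonal_independent[OF B(2)])
  then have "card B = CARD('n)"
    using dim_span_eq_card_independent[of B] by (simp add: B(3))
  then obtain \<beta> :: "'n \<Rightarrow> real^'n" where \<beta>: "bij_betw \<beta> UNIV B"
    using B(1) finite_same_card_bij[of "UNIV :: 'n set" B] by auto
  \<comment> \<open>The columns are orthonormal eigenvectors, so conjugation by \<open>Q\<close>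
    diagonalises the matrix and preserves determinant and trace.\<close>
  define Q :: "real^'n^'n" where "Q = (\<chi> i j. \<beta> j $ i)"
  have col: "column j Q = \<beta> j" for j by (simp add: Q_def column_def vec_eq_iff)
  have \<beta>B: "\<beta> i \<in> B" for i using \<beta> by (auto simp: bij_betw_def)
  have \<beta>o: "\<beta> i \<bullet> \<beta> j = (if i = j then 1 else 0)" for i j
  proof (cases "i = j")
    case True then show ?thesis using B(4)[OF \<beta>B[of j]] by (simp add: norm_eq_1)
  next
    case False
    then have "\<beta> i \<noteq> \<beta> j" using \<beta> by (auto simp: bij_betw_def inj_on_def)
    then show ?thesis using B(2) \<beta>B False by (auto simp: pairwise_def orthogonal_def)
  qed
  have Q: "orthogonal_matrix Q"
    unfolding orthogonal_matrix_orthonormal_columns col by (auto simp: B(4)[OF \<beta>B] orthogonal_def \<beta>o)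
  obtain l where l: "\<And>i. A (\<beta> i) = l i *\<^sub>R \<beta> i" using B(5)[OF \<beta>B] by metis
  have l0: "0 \<le> l i" for i using pos[of "\<beta> i"] by (simp add: l \<beta>o)
  define D where "D = transpose Q ** (matrix A ** Q)"
  have AQ: "(matrix A ** Q) $ k $ j = l j * \<beta> j $ k" for k j
  proof -
    have "(matrix A ** Q) $ k $ j = (matrix A *v \<beta> j) $ k"
      by (simp add: matrix_matrix_mult_def matrix_vector_mult_def Q_def)
    also have "matrix A *v \<beta> j = A (\<beta> j)" by (rule matrix_works) (use A(1) in \<open>simp add: linear_matrix_vector_mul_eq\<close>)
    finally show ?thesis by (simp add: l)
  qed
  have D: "D $ i $ j = (if i = j then l j else 0)" for i j
  proof -
    have "D $ i $ j = (\<Sum>k\<in>UNIV. \<beta> i $ k * (l j * \<beta> j $ k))"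
      unfolding D_def by (subst matrix_matrix_mult_def) (simp add: AQ transpose_def, simp add: Q_def)
    also have "\<dots> = l j * (\<beta> i \<bullet> \<beta> j)"
      by (simp add: inner_vec_def sum_distrib_left algebra_simps)
    finally show ?thesis by (simp add: \<beta>o)
  qed
  have "det D = (\<Prod>i\<in>UNIV. l i)" by (subst det_diagonal) (auto simp: D)
  moreover have "det D = det (matrix A)"
    using det_orthogonal_matrix[OF Q] by (auto simp: D_def det_mul)
  ultimately have det: "det (matrix A) = (\<Prod>i\<in>UNIV. l i)" by simp
  have "trace D = trace ((matrix A ** Q) ** transpose Q)" unfolding D_def by (rule trace_mul_sym)
  also have "\<dots> = trace (matrix A)"
    using Q by (simp add: matrix_mul_assoc[symmetric] orthogonal_matrix_def)
  finally have "(\<Sum>i\<in>UNIV. l i) \<le> real CARD('n)" using tr by (simp add: trace_def D)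
  then have avg: "(\<Sum>i\<in>UNIV. l i / real CARD('n)) \<le> 1"
    by (simp add: divide_le_eq flip: sum_divide_distrib)
  define P where "P = (\<Prod>i\<in>UNIV. l i)"
  have "0 \<le> P" unfolding P_def by (intro prod_nonneg) (simp add: l0)
  have root: "P powr (1 / real CARD('n)) \<le> 1"
    unfolding P_def using arith_geom_mean[of "UNIV :: 'n set" l] l0 avg by simp
  have "P \<le> 1"
  proof (rule ccontr)
    assume "\<not> P \<le> 1"
    then have "1 < P powr (1 / real CARD('n))" by (intro gr_one_powr) auto
    then show False using root by simp
  qed
  then show ?thesis using \<open>0 \<le> P\<close> by (simp add: det P_def)
qed

text \<open>The change-of-variables theory lives on \<^typ>\<open>real^'n\<close>; indexing coordinates by the standard basis
  itself carries its results over to an arbitrary Euclidean space.\<close>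

typedef (overloaded) ('a::euclidean_space) basis_index = "Basis :: 'a set"
  using nonempty_Basis by blast

lemma range_Rep_basis_index: "range (Rep_basis_index :: 'a::euclidean_space basis_index \<Rightarrow> 'a) = Basis"
  using type_definition.Rep_range[OF type_definition_basis_index] .

lemma bij_Rep_basis_index: "bij_betw (Rep_basis_index :: 'a::euclidean_space basis_index \<Rightarrow> 'a) UNIV Basis"
  using range_Rep_basis_index by (auto simp: bij_betw_def inj_on_def Rep_basis_index_inject)

instance basis_index :: (euclidean_space) finite
proof
  show "finite (UNIV :: 'a basis_index set)"
    using bij_betw_finite[OF bij_Rep_basis_index] by simp
qed

text \<open>The change-of-variables results ask for a well-ordered finite index type; the order
  itself is arbitrary, pulled back from a numbering.\<close>

instantiation basis_index :: (euclidean_space) wellorder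
begin

definition "x \<le> y \<longleftrightarrow> to_nat_on UNIV x \<le> to_nat_on UNIV y" for x y :: "'a basis_index"

definition "x < y \<longleftrightarrow> to_nat_on UNIV x < to_nat_on UNIV y" for x y :: "'a basis_index"

instance
proof
  have inj: "inj (to_nat_on (UNIV :: 'a basis_index set))"
    by (rule inj_on_to_nat_on) (simp add: countable_finite)
  fix x y z :: "'a basis_index" and P
  show "(x < y) = (x \<le> y \<and> \<not> y \<le> x)" "x \<le> x" "x \<le> y \<or> y \<le> x"
    "x \<le> y \<Longrightarrow> y \<le> z \<Longrightarrow> x \<le> z"
    by (auto simp: less_eq_basis_index_def less_basis_index_def)
  show "x \<le> y \<Longrightarrow> y \<le> x \<Longrightarrow> x = y"
    using inj by (auto simp: less_eq_basis_index_def inj_def)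
  show "P x" if "\<And>x. (\<And>y. y < x \<Longrightarrow> P y) \<Longrightarrow> P x" for P
    by (induction "to_nat_on UNIV x" arbitrary: x rule: less_induct)
      (auto intro: that simp: less_basis_index_def)
qed

end

definition to_vec :: "'a::euclidean_space \<Rightarrow> real ^ 'a basis_index" where
  "to_vec x = (\<chi> i. x \<bullet> Rep_basis_index i)"

definition of_vec :: "real ^ 'a basis_index \<Rightarrow> 'a::euclidean_space" where
  "of_vec v = (\<Sum>i\<in>UNIV. (v $ i) *\<^sub>R Rep_basis_index i)"

lemma Rep_basis_index_Basis [simp]: "Rep_basis_index i \<in> Basis"
  by (rule Rep_basis_index)

lemma inner_Rep_basis_index: "Rep_basis_index i \<bullet> Rep_basis_index j = (if i = j then 1 else 0)"
  by (simp add: inner_Basis Rep_basis_index_inject)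

lemma sum_Rep_basis_index: "(\<Sum>i\<in>UNIV. f (Rep_basis_index i :: 'a::euclidean_space)) = sum f Basis"
  using sum.reindex_bij_betw[OF bij_Rep_basis_index, of f] .

lemma of_vec_to_vec [simp]: "of_vec (to_vec x) = x"
  by (simp add: of_vec_def to_vec_def sum_Rep_basis_index[of "\<lambda>b. (x \<bullet> b) *\<^sub>R b"] euclidean_representation)

lemma to_vec_of_vec [simp]: "to_vec (of_vec v) = v"
  by (simp add: of_vec_def to_vec_def vec_eq_iff inner_sum_left inner_Rep_basis_index if_distrib cong: if_cong)

lemma linear_to_vec: "linear to_vec"
  by (rule linearI) (auto simp: to_vec_def vec_eq_iff inner_left_distrib)

lemma linear_of_vec: "linear of_vec"
  by (rule linearI) (auto simp: of_vec_def scaleR_add_left sum.distrib scaleR_sum_right)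

lemma inner_to_vec: "to_vec x \<bullet> v = x \<bullet> of_vec v"
  by (simp add: to_vec_def of_vec_def inner_vec_def inner_sum_right mult.commute)

lemma card_basis_index: "CARD('a::euclidean_space basis_index) = DIM('a)"
  using bij_betw_same_card[OF bij_Rep_basis_index] by simp

lemma borel_to_vec [measurable]: "to_vec \<in> borel_measurable borel"
  using linear_to_vec
  by (intro borel_measurable_continuous_onI linear_continuous_on) (simp add: linear_conv_bounded_linear)

lemma borel_of_vec [measurable]: "of_vec \<in> borel_measurable borel"
  using linear_of_vec
  by (intro borel_measurable_continuous_onI linear_continuous_on) (simp add: linear_conv_bounded_linear)

lemma of_vec_axis: "of_vec (axis i 1) = Rep_basis_index i"
  by (simp add: of_vec_def axis_def if_distrib[of "\<lambda>c. c *\<^sub>R _"] cong: if_cong)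

text \<open>The preimage of a box is a box with the same side lengths, and box volumes determine
  Lebesgue measure.\<close>

lemma distr_of_vec: "distr lborel borel (of_vec :: _ \<Rightarrow> 'a::euclidean_space) = lborel"
proof (rule lborel_eqI[symmetric])
  fix l u :: 'a assume le: "\<And>b. b \<in> Basis \<Longrightarrow> l \<bullet> b \<le> u \<bullet> b"
  have "of_vec -` box l u = box (to_vec l) (to_vec u)"
  proof -
    have "of_vec v \<in> box l u \<longleftrightarrow> (\<forall>i. l \<bullet> Rep_basis_index i < of_vec v \<bullet> Rep_basis_index i \<and> of_vec v \<bullet> Rep_basis_index i < u \<bullet> Rep_basis_index i)" for v
      unfolding mem_box range_Rep_basis_index[symmetric] by blast
    moreover have "of_vec v \<bullet> Rep_basis_index i = v $ i" for v :: "real ^ 'a basis_index" and i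
      using arg_cong[OF to_vec_of_vec[of v], of "\<lambda>v. v $ i"] by (simp add: to_vec_def)
    ultimately show ?thesis by (auto simp: mem_box_cart to_vec_def)
  qed
  then have "emeasure (distr lborel borel of_vec) (box l u) = emeasure lborel (box (to_vec l) (to_vec u))"
    by (subst emeasure_distr) auto
  also have "\<dots> = (\<Prod>b\<in>Basis. (to_vec u - to_vec l) \<bullet> b)"
  proof (rule emeasure_lborel_box)
    fix b :: "real ^ 'a basis_index" assume "b \<in> Basis"
    then obtain i where "b = axis i 1" by (auto simp: Basis_vec_def)
    then show "to_vec l \<bullet> b \<le> to_vec u \<bullet> b" using le by (simp add: inner_to_vec of_vec_axis)
  qed
  also have "(\<Prod>b\<in>Basis. (to_vec u - to_vec l) \<bullet> b) = (\<Prod>i\<in>UNIV. (to_vec u - to_vec l) $ i)"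
    by (simp add: Basis_vec_def UNION_singleton_eq_range prod.reindex axis_eq_axis inj_on_def inner_axis)
  also have "\<dots> = (\<Prod>b\<in>Basis. (u - l) \<bullet> b)"
    using prod.reindex_bij_betw[OF bij_Rep_basis_index, of "\<lambda>b. (u - l) \<bullet> b"] by (simp add: to_vec_def inner_diff_left)
  finally show "emeasure (distr lborel borel of_vec) (box l u) = ennreal (\<Prod>b\<in>Basis. (u - l) \<bullet> b)" by simp
qed simp

lemma emeasure_of_vec_vimage: "S \<in> sets borel \<Longrightarrow> emeasure lborel (of_vec -` S) = emeasure lborel (S :: 'a::euclidean_space set)"
  by (subst (2) distr_of_vec[symmetric]) (simp add: emeasure_distr)

lemma emeasure_to_vec_vimage:
  fixes T :: "(real ^ 'a::euclidean_space basis_index) set"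
  assumes "T \<in> sets borel"
  shows "to_vec -` T \<in> sets borel" "emeasure lborel (to_vec -` T) = emeasure lborel T"
proof -
  show m: "to_vec -` T \<in> sets borel"
    using measurable_sets[OF borel_to_vec assms] by simp
  have "of_vec -` (to_vec -` T) = T" by auto
  then show "emeasure lborel (to_vec -` T) = emeasure lborel T"
    using emeasure_of_vec_vimage[OF m] by simp
qed

text \<open>In coordinates the Jacobian determinant is at most 1 by
  \<open>abs_det_le_1_if_trace_le\<close>, so the image has no larger volume. The image is only
  Lebesgue measurable, so the conclusion offers a Borel superset of it.\<close>

lemma volume_image_le_if_trace_le:
  fixes f :: "'a::euclidean_space \<Rightarrow> 'a"
  assumes S: "S \<in> sets borel" "emeasure lborel S < \<infinity>"
    and f: "\<And>x. x \<in> S \<Longrightarrow> (f has_derivative A x) (at x)"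
    and sym: "\<And>x v w. x \<in> S \<Longrightarrow> A x v \<bullet> w = v \<bullet> A x w"
    and pos: "\<And>x v. x \<in> S \<Longrightarrow> 0 \<le> A x v \<bullet> v"
    and tr: "\<And>x. x \<in> S \<Longrightarrow> (\<Sum>b\<in>Basis. A x b \<bullet> b) \<le> DIM('a)"
  shows "\<exists>T\<in>sets borel. f ` S \<subseteq> T \<and> emeasure lborel T \<le> emeasure lborel S"
proof -
  define S' where "S' = of_vec -` S"
  define F where "F = to_vec \<circ> f \<circ> of_vec"
  define A' where "A' v = to_vec \<circ> A (of_vec v) \<circ> of_vec" for v
  have S'b: "S' \<in> sets borel" using measurable_sets[OF borel_of_vec S(1)] by (simp add: S'_def)
  have S'e: "emeasure lborel S' = emeasure lborel S" using S by (simp add: S'_def emeasure_of_vec_vimage)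
  have S'l: "S' \<in> lmeasurable"
    using S'b S'e S(2) by (simp add: fmeasurable_def emeasure_completion)
  have bl: "bounded_linear to_vec" "bounded_linear of_vec"
    using linear_to_vec linear_of_vec by (simp_all add: linear_conv_bounded_linear)
  have deriv: "(F has_derivative A' v) (at v within S')" if "v \<in> S'" for v
  proof -
    have "(f \<circ> of_vec has_derivative A (of_vec v) \<circ> of_vec) (at v)"
      using that by (intro diff_chain_at[OF bounded_linear_imp_has_derivative[OF bl(2)] f]) (simp add: S'_def)
    then have "(to_vec \<circ> (f \<circ> of_vec) has_derivative to_vec \<circ> (A (of_vec v) \<circ> of_vec)) (at v)"
      by (rule diff_chain_at[OF _ bounded_linear_imp_has_derivative[OF bl(1)]])
    then show ?thesis
      unfolding F_def A'_def by (simp add: comp_assoc has_derivative_at_withinI)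
  qed
  have det: "\<bar>det (matrix (A' v))\<bar> \<le> 1" if "v \<in> S'" for v
  proof (rule abs_det_le_1_if_trace_le)
    have v: "of_vec v \<in> S" using that by (simp add: S'_def)
    have "linear (A (of_vec v))"
      using f[OF v] has_derivative_bounded_linear linear_conv_bounded_linear by blast
    then show "linear (A' v)"
      unfolding A'_def by (intro linear_compose linear_of_vec linear_to_vec)
    show "A' v x \<bullet> y = x \<bullet> A' v y" for x y
    proof -
      have "A' v x \<bullet> y = A (of_vec v) (of_vec x) \<bullet> of_vec y" by (simp add: A'_def inner_to_vec)
      also have "\<dots> = A (of_vec v) (of_vec y) \<bullet> of_vec x"
        using sym[OF v, of "of_vec x" "of_vec y"] by (simp add: inner_commute)
      also have "\<dots> = A' v y \<bullet> x" by (simp add: A'_def inner_to_vec)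
      finally show ?thesis by (simp add: inner_commute)
    qed
    show "0 \<le> A' v x \<bullet> x" for x
      using pos[OF v] by (simp add: A'_def inner_to_vec)
    have "trace (matrix (A' v)) = (\<Sum>i\<in>UNIV. A (of_vec v) (Rep_basis_index i) \<bullet> Rep_basis_index i)"
      by (simp add: trace_def matrix_def A'_def of_vec_axis to_vec_def)
    also have "\<dots> = (\<Sum>b\<in>Basis. A (of_vec v) b \<bullet> b)" by (rule sum_Rep_basis_index)
    finally show "trace (matrix (A' v)) \<le> real CARD('a basis_index)"
      using tr[OF v] by (simp add: card_basis_index)
  qed
  have int: "(\<lambda>v. \<bar>det (matrix (A' v))\<bar>) integrable_on S'"
  proof (rule measurable_bounded_by_integrable_imp_integrable)
    show "(\<lambda>v. \<bar>det (matrix (A' v))\<bar>) \<in> borel_measurable (lebesgue_on S')"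
      using borel_measurable_det_Jacobian[OF fmeasurableD[OF S'l] deriv] by (rule borel_measurable_abs)
    show "(\<lambda>_. 1 :: real) integrable_on S'" using S'l by (rule integrable_on_const)
    show "S' \<in> sets lebesgue" using S'l by blast
  qed (use det in auto)
  have img: "F ` S' \<in> lmeasurable" "measure lebesgue (F ` S') \<le> 1 * measure lebesgue S'"
    using measurable_bounded_differentiable_image[OF S'l deriv int det]
      measure_bounded_differentiable_image[OF S'l deriv int det] by auto
  then have "emeasure lebesgue (F ` S') \<le> emeasure lebesgue S'"
    using S'l by (simp add: emeasure_eq_measure2 ennreal_leI)
  then have le: "emeasure lebesgue (F ` S') \<le> emeasure lborel S" using S'b S'e by (simp add: emeasure_completion)
  \<comment> \<open>A Lebesgue set is a Borel set plus a part of a Borel null set; enlarging that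
    part to the whole of \<open>N\<close> costs no measure.\<close>
  obtain N where N: "N \<in> null_sets lborel" "null_part lborel (F ` S') \<subseteq> N"
    using null_part[OF fmeasurableD[OF img(1)]] by blast
  define C where "C = main_part lborel (F ` S') \<union> N"
  have m: "main_part lborel (F ` S') \<in> sets lborel" by (rule main_part_sets[OF fmeasurableD[OF img(1)]])
  then have C: "C \<in> sets borel" using N(1) by (auto simp: C_def)
  have sub: "F ` S' \<subseteq> C"
    using main_part_null_part_Un[OF fmeasurableD[OF img(1)]] N(2) by (auto simp: C_def)
  have "emeasure lborel C = emeasure lborel (main_part lborel (F ` S'))"
    unfolding C_def using m N(1) by (intro emeasure_Un_null_set) auto
  also have "\<dots> = emeasure lebesgue (F ` S')"
    by (rule emeasure_completion[OF fmeasurableD[OF img(1)], symmetric])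
  finally have "emeasure lborel (to_vec -` C) \<le> emeasure lborel S"
    using le emeasure_to_vec_vimage[OF C] by simp
  moreover have "f ` S \<subseteq> to_vec -` C"
  proof -
    have "to_vec (f x) \<in> F ` S'" if "x \<in> S" for x
      using that by (intro image_eqI[of _ _ "to_vec x"]) (auto simp: F_def S'_def)
    then show ?thesis using sub by auto
  qed
  ultimately show ?thesis using emeasure_to_vec_vimage(1)[OF C] by blast
qed

section \<open>Cyclical monotonicity\<close>

text \<open>\<open>Suc i mod n\<close> closes the cycle at \<open>i = n - 1\<close>. Since the
  squared norms cancel, the inequality says that shifting first coordinates along the cycle never
  lowers the total squared distance.\<close>

definition cyclically_monotone :: "('a::real_inner \<times> 'a) set \<Rightarrow> bool" where
  "cyclically_monotone \<Gamma> \<longleftrightarrow> (\<forall>n p. (\<forall>i<n. p i \<in> \<Gamma>) \<longrightarrow>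
     (\<Sum>i<n. fst (p (Suc i mod n)) \<bullet> snd (p i)) \<le> (\<Sum>i<n. fst (p i) \<bullet> snd (p i)))"

text \<open>Rockafellar's construction: \<open>\<phi>\<close> is the supremum of the affine
  functions obtained from chains in \<open>\<Gamma>\<close> starting at \<open>p0\<close>. Cyclic
  monotonicity bounds it at \<open>fst p0\<close>, and the slope bound \<open>R\<close> spreads
  finiteness to the whole space.\<close>

lemma cyclically_monotone_potential:
  fixes \<Gamma> :: "('a::real_inner \<times> 'a) set"
  assumes cyc: "cyclically_monotone \<Gamma>" and ne: "\<Gamma> \<noteq> {}"
    and R: "\<And>q. q \<in> \<Gamma> \<Longrightarrow> norm (snd q) \<le> R"
  obtains \<phi> where "\<And>x x'. \<bar>\<phi> x - \<phi> x'\<bar> \<le> R * norm (x - x')"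
    and "\<And>x x' t. 0 \<le> t \<Longrightarrow> t \<le> 1 \<Longrightarrow> \<phi> ((1 - t) *\<^sub>R x + t *\<^sub>R x') \<le> (1 - t) * \<phi> x + t * \<phi> x'"
    and "\<And>x y x'. (x, y) \<in> \<Gamma> \<Longrightarrow> \<phi> x + y \<bullet> (x' - x) \<le> \<phi> x'"
proof -
  obtain p0 where p0: "p0 \<in> \<Gamma>" using ne by blast
  \<comment> \<open>A chain is \<open>p 0, ..., p k\<close>; its affine function \<open>a\<close>
    has slope \<open>snd (p k)\<close>.\<close>
  define S where "S = {(k :: nat, p). p 0 = p0 \<and> (\<forall>i\<le>k. p i \<in> \<Gamma>)}"
  define a where "a = (\<lambda>(k :: nat, p :: nat \<Rightarrow> 'a \<times> 'a) x. snd (p k) \<bullet> (x - fst (p k)) +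
      (\<Sum>i<k. snd (p i) \<bullet> (fst (p (Suc i)) - fst (p i))))"
  have S_ne: "S \<noteq> {}" using p0 by (auto simp: S_def intro!: exI[of _ "\<lambda>_. p0"])
  have a_diff: "a c x - a c x' = snd (snd c (fst c)) \<bullet> (x - x')" for c x x'
    by (simp add: a_def split_beta inner_diff_right)
  have a_lip: "a c x \<le> a c x' + R * norm (x - x')" if "c \<in> S" for c x x'
  proof -
    have "snd c (fst c) \<in> \<Gamma>" using that by (auto simp: S_def)
    then have "norm (snd (snd c (fst c))) \<le> R" by (rule R)
    moreover have "snd (snd c (fst c)) \<bullet> (x - x') \<le> norm (snd (snd c (fst c))) * norm (x - x')"
      by (rule norm_cauchy_schwarz)
    ultimately have "snd (snd c (fst c)) \<bullet> (x - x') \<le> R * norm (x - x')"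
      by (meson mult_right_mono norm_ge_zero order_trans)
    then show ?thesis using a_diff[of c x x'] by linarith
  qed
  \<comment> \<open>Evaluating at \<open>fst p0\<close> closes the chain into a cycle of length
    \<open>Suc k\<close>.\<close>
  have a0: "a c (fst p0) \<le> 0" if "c \<in> S" for c
  proof -
    obtain k p where ckp: "c = (k, p)" by fastforce
    then have c: "c = (k, p)" "p 0 = p0" "\<forall>i\<le>k. p i \<in> \<Gamma>" using that by (auto simp: S_def)
    have "\<forall>i<Suc k. p i \<in> \<Gamma>" using c by auto
    then have "(\<Sum>i<Suc k. fst (p (Suc i mod Suc k)) \<bullet> snd (p i)) \<le> (\<Sum>i<Suc k. fst (p i) \<bullet> snd (p i))"
      using cyc unfolding cyclically_monotone_def by blast
    moreover have "(\<Sum>i<Suc k. fst (p (Suc i mod Suc k)) \<bullet> snd (p i)) =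
        (\<Sum>i<k. fst (p (Suc i)) \<bullet> snd (p i)) + fst p0 \<bullet> snd (p k)"
      using c by simp
    ultimately show ?thesis
      by (simp add: a_def c inner_diff_right sum_subtractf inner_commute algebra_simps)
  qed
  define \<phi> where "\<phi> x = (SUP c\<in>S. a c x)" for x
  have bdd: "bdd_above ((\<lambda>c. a c x) ` S)" for x
  proof (rule bdd_aboveI2)
    fix c assume "c \<in> S"
    then show "a c x \<le> R * norm (x - fst p0)" using a_lip[of c x "fst p0"] a0[of c] by linarith
  qed
  have upper: "a c x \<le> \<phi> x" if "c \<in> S" for c x
    unfolding \<phi>_def using bdd that by (rule cSUP_upper2) simp
  have least: "\<phi> x \<le> M" if "\<And>c. c \<in> S \<Longrightarrow> a c x \<le> M" for x M
    unfolding \<phi>_def using S_ne that by (rule cSUP_least)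
  have lip: "\<phi> x \<le> \<phi> x' + R * norm (x - x')" for x x'
  proof (rule least)
    fix c assume "c \<in> S"
    then show "a c x \<le> \<phi> x' + R * norm (x - x')"
      using a_lip[of c x x'] upper[of c x'] by linarith
  qed
  show ?thesis
  proof
    show "\<bar>\<phi> x - \<phi> x'\<bar> \<le> R * norm (x - x')" for x x'
      using lip[of x x'] lip[of x' x] by (simp add: abs_le_iff norm_minus_commute)
    show "\<phi> ((1 - t) *\<^sub>R x + t *\<^sub>R x') \<le> (1 - t) * \<phi> x + t * \<phi> x'" if "0 \<le> t" "t \<le> 1" for x x' t
    proof (rule least)
      fix c assume "c \<in> S"
      have "a c ((1 - t) *\<^sub>R x + t *\<^sub>R x') = (1 - t) * a c x + t * a c x'"
        by (simp add: a_def split_beta inner_diff_right inner_add_right algebra_simps)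
      also have "\<dots> \<le> (1 - t) * \<phi> x + t * \<phi> x'"
        using that upper[OF \<open>c \<in> S\<close>] by (intro add_mono mult_left_mono) auto
      finally show "a c ((1 - t) *\<^sub>R x + t *\<^sub>R x') \<le> (1 - t) * \<phi> x + t * \<phi> x'" .
    qed
    fix x y x' assume xy: "(x, y) \<in> \<Gamma>"
    have "\<phi> x \<le> \<phi> x' - y \<bullet> (x' - x)"
    proof (rule least)
      fix c assume "c \<in> S"
      obtain k p where ckp: "c = (k, p)" by fastforce
      then have c: "c = (k, p)" "p 0 = p0" "\<forall>i\<le>k. p i \<in> \<Gamma>" using \<open>c \<in> S\<close> by (auto simp: S_def)
      \<comment> \<open>Appending \<open>(x, y)\<close> to a chain adds y . (x' - x), which is the
        subgradient inequality after taking suprema.\<close>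
      define q where "q = p(Suc k := (x, y))"
      have "(Suc k, q) \<in> S" using c xy by (auto simp: S_def q_def)
      then have "a (Suc k, q) x' \<le> \<phi> x'" by (rule upper)
      moreover have "a (Suc k, q) x' = y \<bullet> (x' - x) + a c x"
        by (simp add: a_def c q_def)
      ultimately show "a c x \<le> \<phi> x' - y \<bullet> (x' - x)" by simp
    qed
    then show "\<phi> x + y \<bullet> (x' - x) \<le> \<phi> x'" by simp
  qed
qed

text \<open>\<open>J z\<close> minimises t phi + (1-t)|x|^2/2 - z . x, and \<open>u\<close> is the
  corresponding maximum, a convex conjugate with gradient \<open>J\<close>. Strong convexity yields
  the first inequality, hence the Lipschitz constant 1/(1-t). For a pair in \<open>\<Gamma>\<close>,
  \<open>y\<close> is a subgradient of phi at \<open>x\<close>, which makes \<open>x\<close> the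
  minimiser for its interpolant.\<close>

lemma interpolation_resolvent:
  fixes \<Gamma> :: "('a::euclidean_space \<times> 'a) set"
  assumes cyc: "cyclically_monotone \<Gamma>" and ne: "\<Gamma> \<noteq> {}"
    and R: "\<And>q. q \<in> \<Gamma> \<Longrightarrow> norm (snd q) \<le> R" and t: "0 < t" "t < 1"
  obtains J u where "\<And>z z'. (1 - t) * (norm (J z - J z'))\<^sup>2 \<le> (J z - J z') \<bullet> (z - z')"
    and "\<And>z. (u has_derivative (\<lambda>h. J z \<bullet> h)) (at z)"
    and "\<And>x y. (x, y) \<in> \<Gamma> \<Longrightarrow> J ((1 - t) *\<^sub>R x + t *\<^sub>R y) = x"
proof -
  obtain \<phi> where lip: "\<And>x x'. \<bar>\<phi> x - \<phi> x'\<bar> \<le> R * norm (x - x')"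
    and conv: "\<And>x x' t. 0 \<le> t \<Longrightarrow> t \<le> 1 \<Longrightarrow> \<phi> ((1 - t) *\<^sub>R x + t *\<^sub>R x') \<le> (1 - t) * \<phi> x + t * \<phi> x'"
    and sub: "\<And>x y x'. (x, y) \<in> \<Gamma> \<Longrightarrow> \<phi> x + y \<bullet> (x' - x) \<le> \<phi> x'"
    using cyclically_monotone_potential[OF cyc ne R] by metis
  have R0: "0 \<le> R" using R ne by (metis ex_in_conv norm_ge_zero order_trans surj_pair)
  define F where "F z x = t * \<phi> x + (1 - t) / 2 * (x \<bullet> x) - z \<bullet> x" for z x
  have cont: "continuous_on A \<phi>" for A
    by (rule lipschitz_on_continuous_on[of R], rule lipschitz_onI)
      (use lip R0 in \<open>auto simp: dist_real_def dist_norm\<close>)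
  have "\<exists>x. \<forall>x'. F z x \<le> F z x'" for z
  proof -
    \<comment> \<open>Beyond this radius the quadratic term outweighs the linear growth
      \<open>t * R + norm z\<close>, so \<open>F z\<close> is at least \<open>F z 0\<close> there
      and a minimum over the ball is global.\<close>
    define r where "r = 2 * (t * R + norm z) / (1 - t)"
    have r0: "0 \<le> r" using R0 t by (simp add: r_def)
    have "continuous_on (cball 0 r) (F z)" unfolding F_def by (intro continuous_intros cont)
    then obtain x where x: "x \<in> cball 0 r" "\<And>x'. x' \<in> cball 0 r \<Longrightarrow> F z x \<le> F z x'"
      using continuous_attains_inf[of "cball 0 r" "F z"] r0 by auto
    have "F z x \<le> F z x'" for x'
    proof (cases "norm x' \<le> r")
      case True then show ?thesis using x by simp
    next
      case False
      have "F z x \<le> F z 0" using x r0 by simp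
      also have "\<dots> \<le> F z x'"
      proof -
        have 1: "\<phi> 0 - \<phi> x' \<le> R * norm x'" using lip[of 0 x'] by simp
        have 2: "z \<bullet> x' \<le> norm z * norm x'" by (rule norm_cauchy_schwarz)
        have "0 \<le> norm x' * ((1 - t) / 2 * norm x' - (t * R + norm z))"
          using False t by (intro mult_nonneg_nonneg) (auto simp: r_def field_simps)
        also have "\<dots> = (1 - t) / 2 * (x' \<bullet> x') - t * (R * norm x') - norm z * norm x'"
          by (simp add: algebra_simps dot_square_norm power2_eq_square)
        also have "\<dots> \<le> (1 - t) / 2 * (x' \<bullet> x') - t * (\<phi> 0 - \<phi> x') - z \<bullet> x'"
          using 1 2 t by (intro diff_mono order_refl mult_left_mono) auto
        finally show ?thesis by (simp add: F_def algebra_simps)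
      qed
      finally show ?thesis .
    qed
    then show ?thesis by blast
  qed
  then obtain J where J: "\<And>z x'. F z (J z) \<le> F z x'" by metis
  have strong: "F z (J z) + (1 - t) / 2 * (norm (x' - J z))\<^sup>2 \<le> F z x'" for z x'
  proof -
    define x where "x = J z"
    define K where "K = (1 - t) / 2 * (norm (x' - x))\<^sup>2"
    have "\<theta> * K \<le> F z x' - F z x" if \<theta>: "0 < \<theta>" "\<theta> < 1" for \<theta>
    proof -
      \<comment> \<open>\<open>s\<close> is the position on the segment from \<open>x\<close> to
        \<open>x'\<close>. Dividing the minimality of \<open>x\<close> by \<open>s\<close> leaves
        the factor 1 - s = \<open>\<theta>\<close>, which may approach 1.\<close>
      define s where "s = 1 - \<theta>"
      have s: "0 < s" "s < 1" using \<theta> by (auto simp: s_def)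
      define y where "y = (1 - s) *\<^sub>R x + s *\<^sub>R x'"
      have sq: "y \<bullet> y = (1 - s) * (x \<bullet> x) + s * (x' \<bullet> x') - s * (1 - s) * (norm (x' - x))\<^sup>2"
        by (simp add: y_def power2_norm_eq_inner inner_diff_left inner_diff_right inner_add_left inner_add_right
            inner_commute[of x' x] algebra_simps)
      have zy: "z \<bullet> y = (1 - s) * (z \<bullet> x) + s * (z \<bullet> x')" by (simp add: y_def inner_add_right)
      have "t * \<phi> y \<le> t * ((1 - s) * \<phi> x + s * \<phi> x')"
        unfolding y_def using s t conv by (intro mult_left_mono) auto
      then have Fy: "F z y \<le> (1 - s) * F z x + s * F z x' - s * (1 - s) * K"
        unfolding F_def sq zy K_def by (simp add: field_simps)
      have "F z x \<le> F z y" unfolding x_def by (rule J)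
      also note Fy
      finally have "0 \<le> s * (F z x' - F z x - \<theta> * K)" by (simp add: s_def algebra_simps)
      then show ?thesis using s by (simp add: zero_le_mult_iff)
    qed
    then have "K \<le> F z x' - F z x" by (rule field_le_mult_one_interval)
    then show ?thesis by (simp add: K_def x_def)
  qed
  have coco: "(1 - t) * (norm (J z - J z'))\<^sup>2 \<le> (J z - J z') \<bullet> (z - z')" for z z'
  proof -
    \<comment> \<open>In the sum of the two growth inequalities everything cancels except the terms
      linear in \<open>z\<close> and \<open>z'\<close>.\<close>
    have "F z (J z') - F z (J z) + (F z' (J z) - F z' (J z')) = (J z - J z') \<bullet> (z - z')"
      by (simp add: F_def inner_diff_left inner_diff_right inner_commute)
    moreover have "(1 - t) / 2 * (norm (J z - J z'))\<^sup>2 \<le> F z (J z') - F z (J z)"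
      using strong[of z "J z'"] by (simp add: norm_minus_commute)
    moreover have "(1 - t) / 2 * (norm (J z - J z'))\<^sup>2 \<le> F z' (J z) - F z' (J z')"
      using strong[of z' "J z"] by simp
    ultimately show ?thesis by argo
  qed
  have coco': "norm (J z - J z') \<le> norm (z - z') / (1 - t)" for z z'
  proof (cases "J z = J z'")
    case False
    have "norm (J z - J z') * ((1 - t) * norm (J z - J z')) \<le> norm (J z - J z') * norm (z - z')"
      using coco[of z z'] norm_cauchy_schwarz[of "J z - J z'" "z - z'"] by (simp add: power2_eq_square algebra_simps)
    then have "(1 - t) * norm (J z - J z') \<le> norm (z - z')"
      by (rule mult_left_le_imp_le) (use False in simp)
    then show ?thesis using t by (simp add: pos_le_divide_eq mult.commute)
  qed (use t in auto)
  define u where "u z = - F z (J z)" for z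
  \<comment> \<open>\<open>u\<close> is a supremum of affine functions, and the one attaining it at
    \<open>z\<close> has slope \<open>J z\<close>.\<close>
  have grad_le: "u z + J z \<bullet> (z' - z) \<le> u z'" for z z'
    using J[of z' "J z"] by (simp add: u_def F_def inner_diff_right inner_commute)
  have "(u has_derivative (\<lambda>h. J z \<bullet> h)) (at z)" for z
    unfolding has_derivative_at_alt
  proof (intro conjI allI impI bounded_linear_inner_right)
    fix e :: real assume "0 < e"
    show "\<exists>d>0. \<forall>y. norm (y - z) < d \<longrightarrow> norm (u y - u z - J z \<bullet> (y - z)) \<le> e * norm (y - z)"
    proof (intro exI[of _ "e * (1 - t)"] conjI allI impI)
      fix y assume y: "norm (y - z) < e * (1 - t)"
      have "u y - u z - J z \<bullet> (y - z) \<le> (J y - J z) \<bullet> (y - z)"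
        using grad_le[of y z] by (simp add: inner_diff_left inner_diff_right)
      also have "\<dots> \<le> norm (J y - J z) * norm (y - z)" by (rule norm_cauchy_schwarz)
      also have "\<dots> \<le> e * norm (y - z)"
      proof (rule mult_right_mono)
        have "norm (y - z) / (1 - t) \<le> e" using y t by (simp add: field_simps)
        then show "norm (J y - J z) \<le> e" using coco'[of y z] by linarith
      qed simp
      finally show "norm (u y - u z - J z \<bullet> (y - z)) \<le> e * norm (y - z)"
        using grad_le[of z y] by simp
    qed (use \<open>0 < e\<close> t in auto)
  qed
  moreover have "J ((1 - t) *\<^sub>R x + t *\<^sub>R y) = x" if xy: "(x, y) \<in> \<Gamma>" for x y
  proof -
    \<comment> \<open>The subgradient inequality makes \<open>F z\<close> grow quadratically from
      \<open>x\<close>; since \<open>J z\<close> is also a minimiser, the two coincide.\<close>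
    define z where "z = (1 - t) *\<^sub>R x + t *\<^sub>R y"
    define w where "w = J z"
    have "z \<bullet> w - z \<bullet> x = (1 - t) * (x \<bullet> (w - x)) + t * (y \<bullet> (w - x))"
      by (simp add: z_def inner_add_left inner_diff_right algebra_simps)
    moreover have "w \<bullet> w - x \<bullet> x = 2 * (x \<bullet> (w - x)) + (norm (w - x))\<^sup>2"
      by (simp add: power2_norm_eq_inner inner_diff_left inner_diff_right inner_commute)
    moreover have "F z w - F z x = t * (\<phi> w - \<phi> x) + (1 - t) / 2 * (w \<bullet> w - x \<bullet> x) - (z \<bullet> w - z \<bullet> x)"
      by (simp add: F_def algebra_simps diff_divide_distrib)
    ultimately have "F z w - F z x = t * (\<phi> w - \<phi> x) + (1 - t) / 2 * (2 * (x \<bullet> (w - x)) + (norm (w - x))\<^sup>2)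
        - ((1 - t) * (x \<bullet> (w - x)) + t * (y \<bullet> (w - x)))"
      by (simp only:)
    also have "\<dots> = t * (\<phi> w - (\<phi> x + y \<bullet> (w - x))) + (1 - t) / 2 * (norm (w - x))\<^sup>2"
      by algebra
    moreover have "0 \<le> t * (\<phi> w - (\<phi> x + y \<bullet> (w - x)))"
      using sub[OF xy, of w] t by (intro mult_nonneg_nonneg) auto
    ultimately have "F z x + (1 - t) / 2 * (norm (J z - x))\<^sup>2 \<le> F z (J z)"
      unfolding w_def by linarith
    moreover have "F z (J z) \<le> F z x" by (rule J)
    ultimately have "(1 - t) / 2 * (norm (J z - x))\<^sup>2 \<le> 0" by linarith
    then show ?thesis using t by (simp add: z_def mult_le_0_iff)
  qed
  ultimately show ?thesis using coco that by blast
qed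

definition measure_support :: "'b::topological_space measure \<Rightarrow> 'b set" where
  "measure_support M = {x. \<forall>U. open U \<longrightarrow> x \<in> U \<longrightarrow> 0 < emeasure M U}"

text \<open>By second countability the complement is covered by countably many null basis
  sets.\<close>

lemma AE_in_measure_support:
  fixes M :: "'b::second_countable_topology measure"
  assumes "sets M = sets borel"
  shows "AE x in M. x \<in> measure_support M"
proof -
  obtain B :: "'b set set" where B: "countable B" "topological_basis B"
    using ex_countable_basis by blast
  define N where "N = \<Union>{U \<in> B. emeasure M U = 0}"
  have "N \<in> null_sets M"
    unfolding N_def using B assms
    by (intro null_sets_UN'[of _ "\<lambda>U. U", simplified])
      (auto simp: null_sets_def topological_basis_open intro: countable_subset)
  moreover have "x \<in> N" if x: "x \<notin> measure_support M" for x
  proof -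
    obtain U where U: "open U" "x \<in> U" "emeasure M U = 0"
      using x unfolding measure_support_def by (auto simp: zero_less_iff_neq_zero)
    obtain V where V: "V \<in> B" "x \<in> V" "V \<subseteq> U" using topological_basisE[OF B(2) U(1,2)] .
    have "emeasure M V = 0"
      using emeasure_mono[OF V(3), of M] U assms by simp
    then show ?thesis using V by (auto simp: N_def)
  qed
  ultimately show ?thesis by (intro AE_I'[of N]) auto
qed

lemma transport_cost_2: "transport_cost 2 \<gamma> = (\<integral>\<^sup>+p. ennreal ((norm (fst p - snd p))\<^sup>2) \<partial>\<gamma>)"
  unfolding transport_cost_def by (intro nn_integral_cong) (auto simp: split_beta powr_numeral)

lemma bij_betw_Suc_mod:
  assumes "0 < n"
  shows "bij_betw (\<lambda>i. Suc i mod n) {..<n} {..<n}"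
proof -
  have "(\<lambda>i. Suc i mod n) ` {..<n} = {..<n}"
  proof
    show "{..<n} \<subseteq> (\<lambda>i. Suc i mod n) ` {..<n}"
    proof
      fix j assume "j \<in> {..<n}"
      then show "j \<in> (\<lambda>i. Suc i mod n) ` {..<n}"
        by (intro image_eqI[of _ _ "if j = 0 then n - 1 else j - 1"]) auto
    qed
  qed (use assms in auto)
  then show ?thesis by (simp add: bij_betw_def eq_card_imp_inj_on)
qed

text \<open>If the support violated cyclic monotonicity, then, sampling $n$ independent points from the plan,
  cyclically permuting the first coordinates whenever this lowers the total cost, and keeping a
  uniformly chosen pair would give a strictly cheaper plan.\<close>

lemma optimal_plan_cyclically_monotone:
  fixes \<mu> \<nu> :: "'a::euclidean_space measure"
  assumes opt: "optimal_plan 2 \<mu> \<nu> \<eta>" and prob: "prob_space \<mu>" and fin: "transport_cost 2 \<eta> < \<infinity>"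
  shows "cyclically_monotone (measure_support \<eta>)"
  unfolding cyclically_monotone_def
proof (intro allI impI)
  fix n :: nat and p :: "nat \<Rightarrow> 'a \<times> 'a"
  assume p: "\<forall>i<n. p i \<in> measure_support \<eta>"
  have se [measurable_cong, simp]: "sets \<eta> = sets borel"
    and margs: "distr \<eta> borel fst = \<mu>" "distr \<eta> borel snd = \<nu>"
    and cost: "transport_cost 2 \<eta> = wasserstein_pow 2 \<mu> \<nu>"
    using opt by (auto simp: optimal_plan_def transport_plans_def)
  have sp [simp]: "space \<eta> = UNIV" using sets_eq_imp_space_eq[OF se] by simp
  have proj: "(fst :: 'a \<times> 'a \<Rightarrow> 'a) \<in> borel_measurable borel" "(snd :: 'a \<times> 'a \<Rightarrow> 'a) \<in> borel_measurable borel"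
    by (intro borel_measurable_continuous_onI continuous_intros)+
  then have "fst \<in> borel_measurable \<eta>" by (simp cong: measurable_cong_sets)
  then interpret \<eta>: prob_space \<eta>
    using prob_space_distrD[of fst \<eta> borel] prob margs by simp
  show "(\<Sum>i<n. fst (p (Suc i mod n)) \<bullet> snd (p i)) \<le> (\<Sum>i<n. fst (p i) \<bullet> snd (p i))"
  proof (rule ccontr)
    define s where "s i = Suc i mod n" for i
    assume "\<not> (\<Sum>i<n. fst (p (Suc i mod n)) \<bullet> snd (p i)) \<le> (\<Sum>i<n. fst (p i) \<bullet> snd (p i))"
    then have viol: "(\<Sum>i<n. fst (p i) \<bullet> snd (p i)) < (\<Sum>i<n. fst (p (s i)) \<bullet> snd (p i))"
      by (simp add: s_def)
    then have n: "0 < n" by (cases n) auto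
    have s_less: "s i < n" for i using n by (simp add: s_def)
    have s_bij: "bij_betw s {..<n} {..<n}" unfolding s_def by (rule bij_betw_Suc_mod[OF n])
    define P where "P = PiM {..<n} (\<lambda>_. \<eta>)"
    interpret P: prob_space P unfolding P_def by (intro prob_space_PiM \<eta>.prob_space_axioms)
    have comp: "(\<lambda>\<omega>. \<omega> i) \<in> measurable P borel" if "i < n" for i
    proof -
      have "(\<lambda>\<omega>. \<omega> i) \<in> measurable P \<eta>"
        unfolding P_def using that by (intro measurable_component_singleton) auto
      then show ?thesis by (simp cong: measurable_cong_sets)
    qed
    have comp_distr: "(\<integral>\<^sup>+\<omega>. f (\<omega> i) \<partial>P) = (\<integral>\<^sup>+q. f q \<partial>\<eta>)"
      if "i < n" and [measurable]: "f \<in> borel_measurable borel" for i and f :: "'a \<times> 'a \<Rightarrow> ennreal"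
    proof -
      have "distr P \<eta> (\<lambda>\<omega>. \<omega> i) = \<eta>"
        unfolding P_def using that(1) \<eta>.prob_space_axioms by (intro distr_PiM_component) auto
      then have "(\<integral>\<^sup>+q. f q \<partial>\<eta>) = (\<integral>\<^sup>+q. f q \<partial>distr P \<eta> (\<lambda>\<omega>. \<omega> i))" by simp
      also have "\<dots> = (\<integral>\<^sup>+\<omega>. f (\<omega> i) \<partial>P)"
        using comp[OF that(1)] by (intro nn_integral_distr) (auto cong: measurable_cong_sets)
      finally show ?thesis ..
    qed
    \<comment> \<open>The event that the cyclic shift strictly lowers the cost of the sampled
      pairs.\<close>
    define E where "E = {\<omega> \<in> space P. (\<Sum>i<n. fst (\<omega> i) \<bullet> snd (\<omega> i)) < (\<Sum>i<n. fst (\<omega> (s i)) \<bullet> snd (\<omega> i))}"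
    have E [measurable]: "E \<in> sets P"
    proof -
      have "(\<lambda>\<omega>. \<Sum>i<n. fst (\<omega> i) \<bullet> snd (\<omega> i)) \<in> borel_measurable P"
        "(\<lambda>\<omega>. \<Sum>i<n. fst (\<omega> (s i)) \<bullet> snd (\<omega> i)) \<in> borel_measurable P"
        using s_less by (auto intro!: borel_measurable_sum borel_measurable_inner measurable_compose[OF comp] proj)
      then show ?thesis unfolding E_def by measurable
    qed
    define w where "w i \<omega> = (if \<omega> \<in> E then (fst (\<omega> (s i)), snd (\<omega> i)) else \<omega> i)" for i :: nat and \<omega> :: "nat \<Rightarrow> 'a \<times> 'a"
    have w: "w i \<in> measurable P borel" if "i < n" for i
    proof -
      have "(\<lambda>\<omega>. (fst (\<omega> (s i)), snd (\<omega> i))) \<in> measurable P borel"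
        using that s_less by (intro borel_measurable_Pair measurable_compose[OF comp] proj) auto
      then show ?thesis unfolding w_def[abs_def] using comp[OF that] E by measurable
    qed
    define Q where "Q = measure_pmf (pmf_of_set {..<n}) \<Otimes>\<^sub>M P"
    \<comment> \<open>\<open>i mod n\<close> makes every index admissible, so \<open>W\<close> is
      measurable on all of \<open>nat\<close>; the uniform law only charges indices below
      \<open>n\<close>.\<close>
    define W where "W = (\<lambda>(i, \<omega>). w (i mod n) \<omega>)"
    have W [measurable]: "W \<in> measurable Q borel"
    proof -
      have "(\<lambda>(i, \<omega>). w (i mod n) \<omega>) \<in> measurable (count_space UNIV \<Otimes>\<^sub>M P) borel"
        using n by (intro measurable_pair_measure_countable1) (auto intro: w)
      then show ?thesis unfolding W_def Q_def by (simp cong: measurable_cong_sets sets_pair_measure_cong)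
    qed
    define \<zeta> where "\<zeta> = distr Q borel W"
    have \<zeta>: "(\<integral>\<^sup>+q. f q \<partial>\<zeta>) = (\<integral>\<^sup>+\<omega>. (\<Sum>i<n. f (w i \<omega>)) \<partial>P) / n"
      if [measurable]: "f \<in> borel_measurable borel" for f :: "'a \<times> 'a \<Rightarrow> ennreal"
    proof -
      have "(\<integral>\<^sup>+q. f q \<partial>\<zeta>) = (\<integral>\<^sup>+x. f (W x) \<partial>Q)"
        unfolding \<zeta>_def by (rule nn_integral_distr[OF W]) simp
      also have "\<dots> = (\<integral>\<^sup>+i. \<integral>\<^sup>+\<omega>. f (W (i, \<omega>)) \<partial>P \<partial>measure_pmf (pmf_of_set {..<n}))"
        unfolding Q_def by (rule P.nn_integral_fst[symmetric]) (use W in \<open>simp add: Q_def\<close>)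
      also have "\<dots> = (\<Sum>i<n. \<integral>\<^sup>+\<omega>. f (W (i, \<omega>)) \<partial>P) / n"
        using n by (subst nn_integral_pmf_of_set) auto
      also have "(\<Sum>i<n. \<integral>\<^sup>+\<omega>. f (W (i, \<omega>)) \<partial>P) = (\<Sum>i<n. \<integral>\<^sup>+\<omega>. f (w i \<omega>) \<partial>P)"
        by (intro sum.cong) (auto simp: W_def)
      also have "\<dots> = (\<integral>\<^sup>+\<omega>. (\<Sum>i<n. f (w i \<omega>)) \<partial>P)"
        by (rule nn_integral_sum[symmetric]) (auto intro!: measurable_compose[OF w])
      finally show ?thesis .
    qed
    have \<eta>_avg: "(\<integral>\<^sup>+\<omega>. (\<Sum>i<n. f (\<omega> i)) \<partial>P) / n = (\<integral>\<^sup>+q. f q \<partial>\<eta>)"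
      if [measurable]: "f \<in> borel_measurable borel" for f :: "'a \<times> 'a \<Rightarrow> ennreal"
    proof -
      have "(\<integral>\<^sup>+\<omega>. (\<Sum>i<n. f (\<omega> i)) \<partial>P) = (\<Sum>i<n. \<integral>\<^sup>+\<omega>. f (\<omega> i) \<partial>P)"
        by (rule nn_integral_sum) (auto intro!: measurable_compose[OF comp])
      also have "\<dots> = of_nat n * (\<integral>\<^sup>+q. f q \<partial>\<eta>)" by (simp add: comp_distr)
      finally show ?thesis using n
        by (simp add: ennreal_of_nat_eq_real_of_nat mult_divide_eq_ennreal mult.commute[of "ennreal (real n)"])
    qed
    have [simp]: "sets \<zeta> = sets borel" by (simp add: \<zeta>_def)
    \<comment> \<open>Only the sum over all \<open>i\<close> enters the law of the randomly chosen
      pair, so a permutation of the first coordinates leaves both marginals unchanged.\<close>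
    have marg: "distr \<zeta> borel h = distr \<eta> borel h"
      if [measurable]: "h \<in> borel_measurable borel"
        and inv: "\<And>f \<omega>. \<omega> \<in> E \<Longrightarrow> (\<Sum>i<n. f (h (fst (\<omega> (s i)), snd (\<omega> i)))) = (\<Sum>i<n. f (h (\<omega> i)) :: ennreal)"
      for h :: "'a \<times> 'a \<Rightarrow> 'a"
    proof (rule measure_eqI)
      fix A assume "A \<in> sets (distr \<zeta> borel h)"
      then have [measurable]: "A \<in> sets borel" by simp
      have eq: "(\<Sum>i<n. indicator A (h (w i \<omega>)) :: ennreal) = (\<Sum>i<n. indicator A (h (\<omega> i)))" for \<omega>
        using inv[of \<omega> "indicator A"] by (cases "\<omega> \<in> E") (simp_all add: w_def)
      have e: "emeasure (distr M borel h) A = (\<integral>\<^sup>+q. indicator A (h q) \<partial>M)" if "sets M = sets borel" for M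
      proof -
        have [measurable_cong]: "sets M = sets borel" by fact
        have "emeasure (distr M borel h) A = (\<integral>\<^sup>+x. indicator A x \<partial>distr M borel h)" by simp
        also have "\<dots> = (\<integral>\<^sup>+q. indicator A (h q) \<partial>M)" by (rule nn_integral_distr) measurable
        finally show ?thesis .
      qed
      have m: "(\<lambda>q. indicator A (h q) :: ennreal) \<in> borel_measurable borel" by measurable
      show "emeasure (distr \<zeta> borel h) A = emeasure (distr \<eta> borel h) A"
        by (simp add: e \<zeta>[OF m] eq \<eta>_avg[OF m])
    qed simp
    have "distr \<zeta> borel fst = \<mu>"
    proof -
      have "distr \<zeta> borel fst = distr \<eta> borel fst"
      proof (rule marg)
        show "(\<Sum>i<n. f (fst (fst (\<omega> (s i)), snd (\<omega> i)))) = (\<Sum>i<n. f (fst (\<omega> i)) :: ennreal)" for f \<omega>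
          using sum.reindex_bij_betw[OF s_bij, of "\<lambda>i. f (fst (\<omega> i))"] by simp
      qed (rule proj)
      then show ?thesis by (simp add: margs)
    qed
    moreover have "distr \<zeta> borel snd = \<nu>"
      using marg[of snd] proj by (simp add: margs)
    ultimately have \<zeta>_plan: "\<zeta> \<in> transport_plans \<mu> \<nu>" by (simp add: transport_plans_def)
    define c where "c q = (norm (fst q - snd q))\<^sup>2" for q :: "'a \<times> 'a"
    have c [measurable]: "c \<in> borel_measurable borel" unfolding c_def[abs_def]
      by (intro borel_measurable_continuous_onI continuous_intros)
    \<comment> \<open>The cost splits into two sums of squares, both invariant under the shift, and
      the inner products compared in \<open>E\<close>.\<close>
    have c_sum: "(\<Sum>i<n. c (q i)) = (\<Sum>i<n. (norm (fst (q i)))\<^sup>2) + (\<Sum>i<n. (norm (snd (q i)))\<^sup>2) - 2 * (\<Sum>i<n. fst (q i) \<bullet> snd (q i))" for q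
      by (simp add: c_def power2_norm_eq_inner inner_diff_left inner_diff_right inner_commute sum.distrib sum_subtractf sum_distrib_left algebra_simps)
    have c_E: "(\<Sum>i<n. c (w i \<omega>)) < (\<Sum>i<n. c (\<omega> i))" if "\<omega> \<in> E" for \<omega>
    proof -
      have "(\<Sum>i<n. (norm (fst (\<omega> (s i))))\<^sup>2) = (\<Sum>i<n. (norm (fst (\<omega> i)))\<^sup>2)"
        by (rule sum.reindex_bij_betw[OF s_bij, of "\<lambda>i. (norm (fst (\<omega> i)))\<^sup>2"])
      moreover have "(\<Sum>i<n. fst (\<omega> i) \<bullet> snd (\<omega> i)) < (\<Sum>i<n. fst (\<omega> (s i)) \<bullet> snd (\<omega> i))"
        using that by (simp add: E_def)
      ultimately show ?thesis using that unfolding c_sum by (simp add: w_def)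
    qed
    have K: "(\<integral>\<^sup>+q. ennreal (c q) \<partial>\<eta>) < \<infinity>" "(\<integral>\<^sup>+q. ennreal (c q) \<partial>\<eta>) \<le> (\<integral>\<^sup>+q. ennreal (c q) \<partial>\<zeta>)"
      using fin cost \<zeta>_plan by (auto simp: transport_cost_2 c_def wasserstein_pow_def intro: INF_lower2)
    have le: "ennreal (\<Sum>i<n. c (w i \<omega>)) \<le> ennreal (\<Sum>i<n. c (\<omega> i))" for \<omega>
      using c_E[of \<omega>] by (cases "\<omega> \<in> E") (auto simp: w_def intro: ennreal_leI)
    have c0: "0 \<le> c q" for q by (simp add: c_def)
    \<comment> \<open>On \<open>E\<close> the cost drops strictly and elsewhere it is unchanged, so
      a non-null \<open>E\<close> would contradict optimality.\<close>
    have emE: "emeasure P E = 0"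
    proof (rule ccontr)
      assume nz: "emeasure P E \<noteq> 0"
      have fin_w: "(\<integral>\<^sup>+\<omega>. (\<Sum>i<n. ennreal (c (\<omega> i))) \<partial>P) < \<infinity>"
      proof -
        have "(\<integral>\<^sup>+\<omega>. (\<Sum>i<n. ennreal (c (\<omega> i))) \<partial>P) = (\<Sum>i<n. \<integral>\<^sup>+\<omega>. ennreal (c (\<omega> i)) \<partial>P)"
          by (rule nn_integral_sum) (auto intro!: measurable_compose[OF comp])
        also have "\<dots> = of_nat n * (\<integral>\<^sup>+q. ennreal (c q) \<partial>\<eta>)"
          by (simp add: comp_distr[of _ "\<lambda>q. ennreal (c q)"])
        finally show ?thesis using K(1) by (simp add: ennreal_mult_less_top ennreal_of_nat_eq_real_of_nat)
      qed
      have m1: "(\<lambda>\<omega>. ennreal (\<Sum>i<n. c (w i \<omega>))) \<in> borel_measurable P"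
        "(\<lambda>\<omega>. ennreal (\<Sum>i<n. c (\<omega> i))) \<in> borel_measurable P"
        by (auto intro!: measurable_compose[OF _ measurable_ennreal] borel_measurable_sum measurable_compose[OF w c] measurable_compose[OF comp c])
      have "(\<integral>\<^sup>+\<omega>. ennreal (\<Sum>i<n. c (w i \<omega>)) \<partial>P) < (\<integral>\<^sup>+\<omega>. ennreal (\<Sum>i<n. c (\<omega> i)) \<partial>P)"
      proof (rule nn_integral_less[OF m1])
        have "(\<integral>\<^sup>+\<omega>. ennreal (\<Sum>i<n. c (w i \<omega>)) \<partial>P) \<le> (\<integral>\<^sup>+\<omega>. ennreal (\<Sum>i<n. c (\<omega> i)) \<partial>P)"
          by (intro nn_integral_mono le)
        then show "(\<integral>\<^sup>+\<omega>. ennreal (\<Sum>i<n. c (w i \<omega>)) \<partial>P) \<noteq> \<infinity>"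
          using fin_w by (auto simp: c0 top_unique)
        show "AE \<omega> in P. ennreal (\<Sum>i<n. c (w i \<omega>)) \<le> ennreal (\<Sum>i<n. c (\<omega> i))" by (simp add: le)
        show "\<not> (AE \<omega> in P. ennreal (\<Sum>i<n. c (\<omega> i)) \<le> ennreal (\<Sum>i<n. c (w i \<omega>)))"
        proof
          assume "AE \<omega> in P. ennreal (\<Sum>i<n. c (\<omega> i)) \<le> ennreal (\<Sum>i<n. c (w i \<omega>))"
          then have "AE \<omega> in P. \<omega> \<notin> E"
          proof eventually_elim
            case (elim \<omega>)
            then show ?case using c_E[of \<omega>] by (force simp: ennreal_le_iff sum_nonneg c0)
          qed
          then have "emeasure P E = 0"
            using AE_iff_null_sets[OF E] by blast
          then show False using nz by simp
        qed
      qed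
      then have less: "(\<integral>\<^sup>+\<omega>. (\<Sum>i<n. ennreal (c (w i \<omega>))) \<partial>P) < (\<integral>\<^sup>+\<omega>. (\<Sum>i<n. ennreal (c (\<omega> i))) \<partial>P)"
        by (simp add: c0)
      have cancel: "x / of_nat n * of_nat n = x" for x :: ennreal
        using n by (simp add: ennreal_divide_times ennreal_divide_self ennreal_of_nat_eq_real_of_nat)
      have m: "(\<lambda>q. ennreal (c q)) \<in> borel_measurable borel" using c by measurable
      have "(\<integral>\<^sup>+\<omega>. (\<Sum>i<n. ennreal (c (\<omega> i))) \<partial>P) / of_nat n \<le> (\<integral>\<^sup>+\<omega>. (\<Sum>i<n. ennreal (c (w i \<omega>))) \<partial>P) / of_nat n"
        using K(2) unfolding \<zeta>[OF m] \<eta>_avg[OF m] .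
      then have "(\<integral>\<^sup>+\<omega>. (\<Sum>i<n. ennreal (c (\<omega> i))) \<partial>P) \<le> (\<integral>\<^sup>+\<omega>. (\<Sum>i<n. ennreal (c (w i \<omega>))) \<partial>P)"
        using mult_right_mono[of _ _ "of_nat n :: ennreal"] by (metis cancel zero_le)
      then show False using less by simp
    qed
    \<comment> \<open>The strict violation at \<open>p\<close> persists on small balls by
      continuity. As the \<open>p i\<close> are support points, the product of these balls has
      positive mass, although it lies in the null event \<open>E\<close>.\<close>
    have "\<exists>r>0. \<forall>\<omega>. (\<forall>i<n. \<omega> i \<in> ball (p i) r) \<longrightarrow> (\<Sum>i<n. fst (\<omega> i) \<bullet> snd (\<omega> i)) < (\<Sum>i<n. fst (\<omega> (s i)) \<bullet> snd (\<omega> i))"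
    proof (rule ccontr)
      assume neg: "\<not> ?thesis"
      have "\<exists>\<omega>. (\<forall>i<n. \<omega> i \<in> ball (p i) r) \<and> (\<Sum>i<n. fst (\<omega> (s i)) \<bullet> snd (\<omega> i)) \<le> (\<Sum>i<n. fst (\<omega> i) \<bullet> snd (\<omega> i))"
        if "0 < r" for r
        using neg that by (simp only: not_less not_ex not_all not_imp de_Morgan_conj) (erule allE[of _ r], simp)
      then have "\<forall>k. \<exists>\<omega>. (\<forall>i<n. \<omega> i \<in> ball (p i) (1 / real (Suc k))) \<and> (\<Sum>i<n. fst (\<omega> (s i)) \<bullet> snd (\<omega> i)) \<le> (\<Sum>i<n. fst (\<omega> i) \<bullet> snd (\<omega> i))"
        by simp
      from choice[OF this] obtain \<omega> where \<omega>': "\<forall>k. (\<forall>i<n. \<omega> k i \<in> ball (p i) (1 / real (Suc k))) \<and>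
          (\<Sum>i<n. fst (\<omega> k (s i)) \<bullet> snd (\<omega> k i)) \<le> (\<Sum>i<n. fst (\<omega> k i) \<bullet> snd (\<omega> k i))"
        by (elim exE)
      then have \<omega>: "\<And>k i. i < n \<Longrightarrow> \<omega> k i \<in> ball (p i) (1 / real (Suc k))"
        "\<And>k. (\<Sum>i<n. fst (\<omega> k (s i)) \<bullet> snd (\<omega> k i)) \<le> (\<Sum>i<n. fst (\<omega> k i) \<bullet> snd (\<omega> k i))"
        by blast+
      have lim: "(\<lambda>k. \<omega> k i) \<longlonglongrightarrow> p i" if "i < n" for i
      proof (rule metric_LIMSEQ_I)
        fix r :: real assume "0 < r"
        then obtain N where N: "1 / real (Suc N) < r" using nat_approx_posE by blast
        have "dist (\<omega> k i) (p i) < r" if "N \<le> k" for k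
        proof -
          have "dist (\<omega> k i) (p i) < 1 / real (Suc k)" using \<omega>(1)[OF \<open>i < n\<close>, of k] by (simp add: dist_commute)
          also have "\<dots> \<le> 1 / real (Suc N)" using that by (intro divide_left_mono) auto
          finally show ?thesis using N by simp
        qed
        then show "\<exists>N. \<forall>k\<ge>N. dist (\<omega> k i) (p i) < r" by blast
      qed
      have "(\<Sum>i<n. fst (p (s i)) \<bullet> snd (p i)) \<le> (\<Sum>i<n. fst (p i) \<bullet> snd (p i))"
      proof (rule LIMSEQ_le)
        show "(\<lambda>k. \<Sum>i<n. fst (\<omega> k (s i)) \<bullet> snd (\<omega> k i)) \<longlonglongrightarrow> (\<Sum>i<n. fst (p (s i)) \<bullet> snd (p i))"
          by (intro tendsto_intros lim s_less) auto
        show "(\<lambda>k. \<Sum>i<n. fst (\<omega> k i) \<bullet> snd (\<omega> k i)) \<longlonglongrightarrow> (\<Sum>i<n. fst (p i) \<bullet> snd (p i))"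
          by (intro tendsto_intros lim) auto
      qed (use \<omega>(2) in blast)
      then show False using viol by simp
    qed
    then obtain r where r: "0 < r" "\<And>\<omega>. (\<forall>i<n. \<omega> i \<in> ball (p i) r) \<Longrightarrow> (\<Sum>i<n. fst (\<omega> i) \<bullet> snd (\<omega> i)) < (\<Sum>i<n. fst (\<omega> (s i)) \<bullet> snd (\<omega> i))"
      by blast
    have "(\<Prod>i<n. emeasure \<eta> (ball (p i) r)) = emeasure P (PiE {..<n} (\<lambda>i. ball (p i) r))"
    proof -
      interpret PP: product_prob_space "\<lambda>_. \<eta>" "{..<n}" ..
      show ?thesis unfolding P_def by (subst PP.emeasure_PiM) auto
    qed
    also have "\<dots> \<le> emeasure P E"
    proof (rule emeasure_mono[OF _ E])
      show "PiE {..<n} (\<lambda>i. ball (p i) r) \<subseteq> E"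
        using r(2) by (fastforce simp: E_def P_def space_PiM PiE_def Pi_def)
    qed
    finally have "(\<Prod>i<n. emeasure \<eta> (ball (p i) r)) = 0" using emE by simp
    moreover have "0 < emeasure \<eta> (ball (p i) r)" if "i < n" for i
      using p that r(1) by (simp add: measure_support_def)
    ultimately show False by (auto simp: prod_zero_iff) (metis less_irrefl)
  qed
qed

section \<open>Displacement interpolation\<close>

lemma has_derivative_diff_quot_LIMSEQ:
  fixes f :: "'a::real_normed_vector \<Rightarrow> 'b::real_normed_vector"
  assumes "(f has_derivative A) (at z)"
  shows "((\<lambda>s. (1 / s) *\<^sub>R (f (z + s *\<^sub>R v) - f z)) \<longlongrightarrow> A v) (at 0)"
proof (rule LIM_I)
  interpret A: bounded_linear A using assms by (rule has_derivative_bounded_linear)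
  fix r :: real assume "0 < r"
  define e where "e = r / (norm v + 1)"
  have n: "0 < norm v + 1" by (simp add: add_nonneg_pos)
  then have "0 < e" using \<open>0 < r\<close> by (simp add: e_def)
  then obtain d where d: "0 < d" "\<And>y. norm (y - z) < d \<Longrightarrow> norm (f y - f z - A (y - z)) \<le> e * norm (y - z)"
    using assms unfolding has_derivative_at_alt by blast
  have "norm ((1 / s) *\<^sub>R (f (z + s *\<^sub>R v) - f z) - A v) < r" if "s \<noteq> 0" "norm s < d / (norm v + 1)" for s
  proof -
    have "\<bar>s\<bar> * (norm v + 1) < d" using that n by (simp add: pos_less_divide_eq)
    then have "\<bar>s\<bar> * norm v < d" by (simp add: algebra_simps)
    then have le: "norm (f (z + s *\<^sub>R v) - f z - s *\<^sub>R A v) \<le> e * (\<bar>s\<bar> * norm v)"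
      using d(2)[of "z + s *\<^sub>R v"] by (simp add: A.scaleR)
    have "(1 / s) *\<^sub>R (f (z + s *\<^sub>R v) - f z) - A v = (1 / s) *\<^sub>R (f (z + s *\<^sub>R v) - f z - s *\<^sub>R A v)"
      using that by (simp add: scaleR_diff_right)
    then have "norm ((1 / s) *\<^sub>R (f (z + s *\<^sub>R v) - f z) - A v) = (1 / \<bar>s\<bar>) * norm (f (z + s *\<^sub>R v) - f z - s *\<^sub>R A v)"
      by (simp only: norm_scaleR) simp
    also have "\<dots> \<le> (1 / \<bar>s\<bar>) * (e * (\<bar>s\<bar> * norm v))"
      by (intro mult_left_mono le) simp
    also have "\<dots> = e * norm v" using that by simp
    also have "\<dots> < e * (norm v + 1)" using \<open>0 < e\<close> by simp
    also have "\<dots> = r" using n by (simp add: e_def)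
    finally show ?thesis .
  qed
  then show "\<exists>s>0. \<forall>x. x \<noteq> 0 \<and> norm (x - 0) < s \<longrightarrow> norm ((1 / x) *\<^sub>R (f (z + x *\<^sub>R v) - f z) - A v) < r"
    using d(1) n by (intro exI[of _ "d / (norm v + 1)"]) simp
qed

lemma null_set_image_lipschitz:
  fixes f :: "'a::euclidean_space \<Rightarrow> 'a"
  assumes lip: "\<And>x y. norm (f x - f y) \<le> L * norm (x - y)" and N: "N \<in> null_sets lborel"
  shows "\<exists>T\<in>null_sets lborel. f ` N \<subseteq> T"
proof -
  have "N \<in> null_sets lebesgue" using N by (rule null_sets_completionI)
  then have "negligible N" by (simp add: negligible_iff_null_sets)
  then have "negligible (f ` N)"
    using lip by (intro negligible_locally_Lipschitz_image) (auto intro!: exI[of _ UNIV] exI[of _ L])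
  then have "f ` N \<in> null_sets (completion lborel)" by (simp add: negligible_iff_null_sets)
  then show ?thesis by (auto simp: null_sets_completion_iff2)
qed

text \<open>The inequality passes to the limit of difference quotients as c|Av|^2 <= Av . v, and
  Cauchy-Schwarz turns this into c|Av| <= |v|. The second bound is what keeps the derivative of the
  companion map \<open>Y\<close> positive semidefinite later on.\<close>

lemma resolvent_derivative:
  fixes J :: "'a::euclidean_space \<Rightarrow> 'a"
  assumes coco: "\<And>z z'. c * (norm (J z - J z'))\<^sup>2 \<le> (J z - J z') \<bullet> (z - z')" and c: "0 < c"
    and A: "(J has_derivative A) (at z)"
  shows "0 \<le> A v \<bullet> v" "c * (A v \<bullet> v) \<le> v \<bullet> v"
proof -
  define q where "q s = (1 / s) *\<^sub>R (J (z + s *\<^sub>R v) - J z)" for s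
  have lim: "(q \<longlongrightarrow> A v) (at 0)"
    using has_derivative_diff_quot_LIMSEQ[OF A, of v] by (simp add: q_def[abs_def])
  have ineq: "c * (norm (q s))\<^sup>2 \<le> q s \<bullet> v" if "s \<noteq> 0" for s
  proof -
    have "c * (norm (s *\<^sub>R q s))\<^sup>2 \<le> (s *\<^sub>R q s) \<bullet> (s *\<^sub>R v)"
      using coco[of "z + s *\<^sub>R v" z] that by (simp add: q_def)
    then have "s\<^sup>2 * (c * (norm (q s))\<^sup>2) \<le> s\<^sup>2 * (q s \<bullet> v)"
      by (simp add: power_mult_distrib power2_eq_square algebra_simps)
    then show ?thesis using that by simp
  qed
  have le: "c * (norm (A v))\<^sup>2 \<le> A v \<bullet> v"
  proof (rule tendsto_le)
    show "((\<lambda>s. q s \<bullet> v) \<longlongrightarrow> A v \<bullet> v) (at 0)" "((\<lambda>s. c * (norm (q s))\<^sup>2) \<longlongrightarrow> c * (norm (A v))\<^sup>2) (at 0)"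
      by (intro tendsto_intros lim)+
    show "\<forall>\<^sub>F s in at 0. c * (norm (q s))\<^sup>2 \<le> q s \<bullet> v"
      using ineq by (simp add: eventually_at_filter)
  qed simp
  show "0 \<le> A v \<bullet> v" by (rule order_trans[OF _ le]) (use c in simp)
  have "norm (A v) * (c * norm (A v)) \<le> norm (A v) * norm v"
    using le norm_cauchy_schwarz[of "A v" v] by (simp add: power2_eq_square algebra_simps)
  then have n: "c * norm (A v) \<le> norm v" by (cases "A v = 0") auto
  have "c * (A v \<bullet> v) \<le> c * (norm (A v) * norm v)"
    using c norm_cauchy_schwarz[of "A v" v] by (intro mult_left_mono) auto
  also have "\<dots> \<le> norm v * norm v" using mult_right_mono[OF n norm_ge_zero[of v]] by (simp add: algebra_simps)
  finally show "c * (A v \<bullet> v) \<le> v \<bullet> v" by (simp add: dot_square_norm power2_eq_square)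
qed

text \<open>For $(x,y)$ in a cyclically monotone set, $x = J(z)$ and $y = Y(z)$ are recovered from
  $z = (1-t)x + ty$ by gradient maps with $(1-t) DJ + t DY = I$. At almost every $z$ one of the two
  has trace at most the dimension, so by AM-GM its Jacobian determinant is at most $1$.\<close>

lemma interpolation_le_lborel_bounded:
  fixes \<eta> :: "('a::euclidean_space \<times> 'a) measure"
  assumes se: "sets \<eta> = sets borel"
    and cyc: "cyclically_monotone \<Gamma>" and ne: "\<Gamma> \<noteq> {}"
    and R: "\<And>q. q \<in> \<Gamma> \<Longrightarrow> norm (snd q) \<le> R"
    and m1: "\<And>A. A \<in> sets borel \<Longrightarrow> emeasure \<eta> (fst -` A) \<le> emeasure lborel A"
    and m2: "\<And>A. A \<in> sets borel \<Longrightarrow> emeasure \<eta> (snd -` A) \<le> emeasure lborel A"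
    and t: "0 < t" "t < 1" and Z: "Z \<in> sets borel"
    and S: "S \<in> sets \<eta>" "AE q in \<eta>. q \<in> S \<longrightarrow> q \<in> \<Gamma> \<and> (1 - t) *\<^sub>R fst q + t *\<^sub>R snd q \<in> Z"
  shows "emeasure \<eta> S \<le> emeasure lborel Z"
proof (cases "emeasure lborel Z = \<infinity>")
  case False
  then have Zfin: "emeasure lborel Z < \<infinity>" by (simp add: top.not_eq_extremum)
  obtain J u where coco: "\<And>z z'. (1 - t) * (norm (J z - J z'))\<^sup>2 \<le> (J z - J z') \<bullet> (z - z')"
    and grad: "\<And>z. (u has_derivative (\<lambda>h. J z \<bullet> h)) (at z)"
    and J: "\<And>x y. (x, y) \<in> \<Gamma> \<Longrightarrow> J ((1 - t) *\<^sub>R x + t *\<^sub>R y) = x"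
    using interpolation_resolvent[OF cyc ne R t] by blast
  have lip: "norm (J z - J z') \<le> 1 / (1 - t) * norm (z - z')" for z z'
  proof (cases "J z = J z'")
    case False
    have "norm (J z - J z') * ((1 - t) * norm (J z - J z')) \<le> norm (J z - J z') * norm (z - z')"
      using coco[of z z'] norm_cauchy_schwarz[of "J z - J z'" "z - z'"] by (simp add: power2_eq_square algebra_simps)
    then have "(1 - t) * norm (J z - J z') \<le> norm (z - z')"
      by (rule mult_left_le_imp_le) (use False in simp)
    then show ?thesis using t by (simp add: pos_le_divide_eq mult.commute)
  qed (use t in auto)
  define Y where "Y z = (1 / t) *\<^sub>R (z - (1 - t) *\<^sub>R J z)" for z
  have Y: "Y ((1 - t) *\<^sub>R x + t *\<^sub>R y) = y" if "(x, y) \<in> \<Gamma>" for x y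
    using t by (simp add: Y_def J[OF that])
  have "AE z in lborel. J differentiable (at z)" using lip by (rule lipschitz_differentiable_ae)
  then obtain N where N: "N \<in> null_sets lborel" "\<And>z. z \<notin> N \<Longrightarrow> J differentiable (at z)"
    by (elim AE_E) (auto simp: null_sets_def)
  define A where "A z = frechet_derivative J (at z)" for z
  have A: "(J has_derivative A z) (at z)" if "z \<notin> N" for z
    using N(2)[OF that] frechet_derivative_works unfolding A_def by blast
  have sym: "A z v \<bullet> w = v \<bullet> A z w" if "z \<notin> N" for z v w
    using grad A[OF that] by (rule derivative_of_gradient_symmetric)
  note pos = resolvent_derivative[OF coco _ A]
  \<comment> \<open>Written through \<open>dir_deriv\<close> so that it is Borel on the whole space;
    off \<open>N\<close> it is the trace of \<open>A z\<close>.\<close>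
  define tr where "tr z = (\<Sum>b\<in>Basis. dir_deriv (\<lambda>z. J z \<bullet> b) b z)" for z
  have tr: "tr z = (\<Sum>b\<in>Basis. A z b \<bullet> b)" if "z \<notin> N" for z
    unfolding tr_def
  proof (rule sum.cong[OF refl], rule dir_deriv_eqI(1))
    fix b :: 'a
    have "((\<lambda>s. ((1 / s) *\<^sub>R (J (z + s *\<^sub>R b) - J z)) \<bullet> b) \<longlongrightarrow> A z b \<bullet> b) (at 0)"
      by (intro tendsto_inner has_derivative_diff_quot_LIMSEQ A that tendsto_const)
    then show "(diff_quot (\<lambda>z. J z \<bullet> b) b z \<longlongrightarrow> A z b \<bullet> b) (at 0)"
      by (simp add: diff_quot_def[abs_def] inner_diff_left divide_inverse mult.commute)
  qed
  have tr_m: "tr \<in> borel_measurable borel"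
    unfolding tr_def[abs_def]
  proof (intro borel_measurable_sum dir_deriv_borel)
    fix b x y :: 'a assume "b \<in> Basis"
    then have "\<bar>(J x - J y) \<bullet> b\<bar> \<le> 1 / (1 - t) * norm (x - y)"
      by (rule order_trans[OF Basis_le_norm lip])
    then show "\<bar>J x \<bullet> b - J y \<bullet> b\<bar> \<le> 1 / (1 - t) * norm (x - y)"
      by (simp only: inner_diff_left)
  qed
  have N_b: "N \<in> sets borel" using N(1) by auto
  define Z1 where "Z1 = {z \<in> Z - N. tr z \<le> DIM('a)}"
  define Z2 where "Z2 = {z \<in> Z - N. DIM('a) < tr z}"
  have Z1: "Z1 \<in> sets borel" and Z2: "Z2 \<in> sets borel"
    unfolding Z1_def Z2_def using Z N_b tr_m by measurable
  have fin: "emeasure lborel Z1 < \<infinity>" "emeasure lborel Z2 < \<infinity>"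
    using Zfin Z emeasure_mono[of Z1 Z lborel] emeasure_mono[of Z2 Z lborel]
    by (auto simp: Z1_def Z2_def intro: le_less_trans)
  obtain T0 where T0: "T0 \<in> null_sets lborel" "J ` N \<subseteq> T0"
    using null_set_image_lipschitz[OF lip N(1)] by blast
  have "\<exists>T\<in>sets borel. J ` Z1 \<subseteq> T \<and> emeasure lborel T \<le> emeasure lborel Z1"
  proof (rule volume_image_le_if_trace_le[OF Z1 fin(1)])
    fix z assume "z \<in> Z1"
    then have z: "z \<notin> N" "tr z \<le> DIM('a)" by (auto simp: Z1_def)
    show "(J has_derivative A z) (at z)" by (rule A[OF z(1)])
    show "A z v \<bullet> w = v \<bullet> A z w" for v w by (rule sym[OF z(1)])
    show "0 \<le> A z v \<bullet> v" for v using pos(1) z(1) t by simp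
    show "(\<Sum>b\<in>Basis. A z b \<bullet> b) \<le> DIM('a)" using z by (simp add: tr)
  qed
  then obtain T1 where T1: "T1 \<in> sets borel" "J ` Z1 \<subseteq> T1" "emeasure lborel T1 \<le> emeasure lborel Z1" by blast
  define B where "B z v = (1 / t) *\<^sub>R (v - (1 - t) *\<^sub>R A z v)" for z v
  have "\<exists>T\<in>sets borel. Y ` Z2 \<subseteq> T \<and> emeasure lborel T \<le> emeasure lborel Z2"
  proof (rule volume_image_le_if_trace_le[OF Z2 fin(2)])
    fix z assume "z \<in> Z2"
    then have z: "z \<notin> N" "DIM('a) < tr z" by (auto simp: Z2_def)
    show "(Y has_derivative B z) (at z)"
      unfolding Y_def[abs_def] B_def[abs_def] by (auto intro!: derivative_eq_intros A[OF z(1)])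
    show "B z v \<bullet> w = v \<bullet> B z w" for v w
      using sym[OF z(1), of v w] by (simp add: B_def inner_diff_left inner_diff_right)
    show "0 \<le> B z v \<bullet> v" for v
      using pos(2)[OF _ z(1), of v] t by (simp add: B_def inner_diff_left)
    \<comment> \<open>Taking traces in (1-t) DJ + t DY = I: a trace of DJ above the dimension forces
      one of DY below it.\<close>
    have "(\<Sum>b\<in>Basis. B z b \<bullet> b) = (DIM('a) - (1 - t) * tr z) / t"
      by (simp add: B_def inner_diff_left tr[OF z(1)] sum_subtractf sum_distrib_left diff_divide_distrib
          sum_divide_distrib inner_Basis)
    also have "\<dots> \<le> DIM('a)"
    proof -
      have "(1 - t) * DIM('a) \<le> (1 - t) * tr z" using z(2) t by (intro mult_left_mono) auto
      then show ?thesis using t by (simp add: divide_le_eq algebra_simps)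
    qed
    finally show "(\<Sum>b\<in>Basis. B z b \<bullet> b) \<le> DIM('a)" .
  qed
  then obtain T2 where T2: "T2 \<in> sets borel" "Y ` Z2 \<subseteq> T2" "emeasure lborel T2 \<le> emeasure lborel Z2" by blast
  have proj: "(fst :: 'a \<times> 'a \<Rightarrow> 'a) \<in> borel_measurable borel" "(snd :: 'a \<times> 'a \<Rightarrow> 'a) \<in> borel_measurable borel"
    by (intro borel_measurable_continuous_onI continuous_intros)+
  have pre: "fst -` T \<in> sets \<eta>" "snd -` T \<in> sets \<eta>" if "T \<in> sets borel" for T :: "'a set"
    using measurable_sets[OF proj(1) that] measurable_sets[OF proj(2) that] by (simp_all add: se)
  have T0b: "T0 \<in> sets borel" using T0(1) by auto
  have "emeasure \<eta> S \<le> emeasure \<eta> ((fst -` T0 \<union> fst -` T1) \<union> snd -` T2)"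
  proof (rule emeasure_mono_AE)
    show "AE q in \<eta>. q \<in> S \<longrightarrow> q \<in> (fst -` T0 \<union> fst -` T1) \<union> snd -` T2"
      using S(2)
    proof eventually_elim
      case (elim q)
      show ?case
      proof
        assume "q \<in> S"
        define z where "z = (1 - t) *\<^sub>R fst q + t *\<^sub>R snd q"
        have q: "(fst q, snd q) \<in> \<Gamma>" "z \<in> Z" using elim \<open>q \<in> S\<close> by (auto simp: z_def)
        have "J z = fst q" "Y z = snd q" using J[OF q(1)] Y[OF q(1)] by (simp_all add: z_def)
        moreover have "z \<in> N \<or> z \<in> Z1 \<or> z \<in> Z2" using q(2) by (auto simp: Z1_def Z2_def)
        ultimately have "fst q \<in> T0 \<or> fst q \<in> T1 \<or> snd q \<in> T2"
          using T0(2) T1(2) T2(2) by (metis image_eqI subsetD)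
        then show "q \<in> (fst -` T0 \<union> fst -` T1) \<union> snd -` T2" by auto
      qed
    qed
  qed (use pre T0b T1 T2 in auto)
  also have "\<dots> \<le> emeasure \<eta> (fst -` T0 \<union> fst -` T1) + emeasure \<eta> (snd -` T2)"
    by (rule emeasure_subadditive) (use pre T0b T1 T2 in auto)
  also have "\<dots> \<le> (emeasure \<eta> (fst -` T0) + emeasure \<eta> (fst -` T1)) + emeasure \<eta> (snd -` T2)"
    by (intro add_right_mono emeasure_subadditive) (use pre T0b T1 T2 in auto)
  also have "\<dots> \<le> (emeasure lborel T0 + emeasure lborel T1) + emeasure lborel T2"
    by (intro add_mono m1 m2 T0b T1 T2)
  also have "\<dots> \<le> emeasure lborel Z1 + emeasure lborel Z2"
    using T0(1) T1(3) T2(3) by (simp add: null_sets_def add_mono)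
  also have "\<dots> = emeasure lborel (Z1 \<union> Z2)"
    by (rule plus_emeasure) (use Z1 Z2 in \<open>auto simp: Z1_def Z2_def\<close>)
  also have "\<dots> \<le> emeasure lborel Z"
    by (rule emeasure_mono) (use Z in \<open>auto simp: Z1_def Z2_def\<close>)
  finally show ?thesis .
qed simp

text \<open>Truncating to \<open>norm (snd q) \<le> n\<close> supplies the bound that the potential
  needs. Subsets of a cyclically monotone set stay cyclically monotone, and the truncated sets
  increase to the full preimage.\<close>

lemma interpolation_le_lborel:
  fixes \<eta> :: "('a::euclidean_space \<times> 'a) measure"
  assumes se: "sets \<eta> = sets borel"
    and cyc: "cyclically_monotone \<Gamma>" and \<Gamma>: "AE q in \<eta>. q \<in> \<Gamma>"
    and m1: "\<And>A. A \<in> sets borel \<Longrightarrow> emeasure \<eta> (fst -` A) \<le> emeasure lborel A"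
    and m2: "\<And>A. A \<in> sets borel \<Longrightarrow> emeasure \<eta> (snd -` A) \<le> emeasure lborel A"
    and t: "0 < t" "t < 1" and Z: "Z \<in> sets borel"
  shows "emeasure \<eta> ((\<lambda>q. (1 - t) *\<^sub>R fst q + t *\<^sub>R snd q) -` Z) \<le> emeasure lborel Z"
proof -
  define I where "I q = (1 - t) *\<^sub>R fst q + t *\<^sub>R snd q" for q :: "'a \<times> 'a"
  define S where "S n = I -` Z \<inter> {q. norm (snd q) \<le> real n}" for n
  have "I \<in> borel_measurable borel" unfolding I_def[abs_def]
    by (intro borel_measurable_continuous_onI continuous_intros)
  then have "I -` Z \<in> sets borel" using measurable_sets[OF _ Z, of I borel] by simp
  moreover have "{q :: 'a \<times> 'a. norm (snd q) \<le> real n} \<in> sets borel" for n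
    by (intro borel_closed closed_Collect_le continuous_intros)
  ultimately have S: "S n \<in> sets \<eta>" for n by (auto simp: S_def se)
  have "incseq S" by (auto simp: S_def incseq_def)
  then have "(SUP n. emeasure \<eta> (S n)) = emeasure \<eta> (\<Union>n. S n)"
    using S by (intro SUP_emeasure_incseq) auto
  also have "(\<Union>n. S n) = I -` Z" by (auto simp: S_def real_arch_simple)
  finally have sup: "emeasure \<eta> (I -` Z) = (SUP n. emeasure \<eta> (S n))" ..
  have "emeasure \<eta> (S n) \<le> emeasure lborel Z" for n
  proof (cases "\<Gamma> \<inter> {q. norm (snd q) \<le> real n} = {}")
    case True
    have "AE q in \<eta>. q \<notin> S n" using \<Gamma> by eventually_elim (use True in \<open>auto simp: S_def\<close>)
    then have "S n \<in> null_sets \<eta>" using AE_iff_null_sets[OF S] by blast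
    then show ?thesis by (simp add: null_setsD1)
  next
    case False
    have "cyclically_monotone (\<Gamma> \<inter> {q. norm (snd q) \<le> real n})"
      using cyc by (simp add: cyclically_monotone_def)
    then show ?thesis
      by (rule interpolation_le_lborel_bounded[OF se _ False _ m1 m2 t Z S, where R = "real n"])
        (use \<Gamma> in \<open>auto simp: S_def I_def elim!: eventually_mono\<close>)
  qed
  then show ?thesis
    using sup by (simp add: SUP_le_iff I_def[abs_def])
qed

section \<open>First variation of the projection\<close>

lemma borel_measurable_projections:
  "(fst :: 'a \<times> 'a \<Rightarrow> 'a::second_countable_topology) \<in> borel_measurable borel"
  "(snd :: 'a \<times> 'a \<Rightarrow> 'a) \<in> borel_measurable borel"
  by (intro borel_measurable_continuous_onI continuous_intros)+

lemma borel_measurable_quadratic_cost: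
  "(\<lambda>q :: 'a::euclidean_space \<times> 'a. ennreal ((norm (fst q - snd q))\<^sup>2)) \<in> borel_measurable borel"
  by (intro measurable_compose[OF _ measurable_ennreal] borel_measurable_continuous_onI continuous_intros)

lemma prob_measuresD:
  assumes "\<mu> \<in> prob_measures 2 \<Omega>"
  shows "sets \<mu> = sets borel" "prob_space \<mu>" "AE x in \<mu>. x \<in> \<Omega>"
    and "integrable \<mu> (\<lambda>x. (norm x)\<^sup>2)"
proof -
  show s [measurable_cong]: "sets \<mu> = sets borel" and "prob_space \<mu>" "AE x in \<mu>. x \<in> \<Omega>"
    using assms by (auto simp: prob_measures_def)
  have "(\<integral>\<^sup>+x. ennreal ((norm x)\<^sup>2) \<partial>\<mu>) < \<infinity>"
    using assms by (simp add: prob_measures_def powr_numeral)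
  then show "integrable \<mu> (\<lambda>x. (norm x)\<^sup>2)"
    by (intro integrableI_bounded) (auto simp: s cong: measurable_cong_sets)
qed

lemma integrable_inner_square:
  fixes f g :: "'b \<Rightarrow> 'a::euclidean_space"
  assumes [measurable]: "f \<in> borel_measurable M" "g \<in> borel_measurable M"
    and int: "integrable M (\<lambda>x. (norm (f x))\<^sup>2)" "integrable M (\<lambda>x. (norm (g x))\<^sup>2)"
  shows "integrable M (\<lambda>x. f x \<bullet> g x)" "integrable M (\<lambda>x. (norm (f x - g x))\<^sup>2)"
    "integrable M (\<lambda>x. (norm (f x + g x))\<^sup>2)"
proof -
  show i: "integrable M (\<lambda>x. f x \<bullet> g x)"
  proof (rule Bochner_Integration.integrable_bound[OF Bochner_Integration.integrable_add[OF int]])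
    have "\<bar>f x \<bullet> g x\<bar> \<le> (norm (f x))\<^sup>2 + (norm (g x))\<^sup>2" for x
    proof -
      have "\<bar>f x \<bullet> g x\<bar> \<le> norm (f x) * norm (g x)" by (rule Cauchy_Schwarz_ineq2)
      moreover have "0 \<le> (norm (f x) - norm (g x))\<^sup>2" "0 \<le> (norm (f x))\<^sup>2" "0 \<le> (norm (g x))\<^sup>2" by simp_all
      ultimately show ?thesis by (simp add: power2_diff)
    qed
    then show "AE x in M. norm (f x \<bullet> g x) \<le> norm ((norm (f x))\<^sup>2 + (norm (g x))\<^sup>2)" by simp
  qed measurable
  have "(norm (f x - g x))\<^sup>2 = (norm (f x))\<^sup>2 + (norm (g x))\<^sup>2 - 2 * (f x \<bullet> g x)" for x
    by (simp add: power2_norm_eq_inner inner_diff_left inner_diff_right inner_commute)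
  then show "integrable M (\<lambda>x. (norm (f x - g x))\<^sup>2)" using int i by simp
  have "(norm (f x + g x))\<^sup>2 = (norm (f x))\<^sup>2 + (norm (g x))\<^sup>2 + 2 * (f x \<bullet> g x)" for x
    by (simp add: power2_norm_eq_inner inner_add_left inner_add_right inner_commute)
  then show "integrable M (\<lambda>x. (norm (f x + g x))\<^sup>2)" using int i by simp
qed

lemma transport_planD:
  fixes \<mu> \<nu> :: "'a::euclidean_space measure"
  assumes \<gamma>: "\<gamma> \<in> transport_plans \<mu> \<nu>" and \<mu>: "\<mu> \<in> prob_measures 2 \<Omega>" and \<nu>: "\<nu> \<in> prob_measures 2 \<Omega>"
  shows "sets \<gamma> = sets borel" "prob_space \<gamma>"
    and "fst \<in> borel_measurable \<gamma>" "snd \<in> borel_measurable \<gamma>"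
    and "AE q in \<gamma>. fst q \<in> \<Omega> \<and> snd q \<in> \<Omega>"
    and "integrable \<gamma> (\<lambda>q. (norm (fst q))\<^sup>2)" "integrable \<gamma> (\<lambda>q. (norm (snd q))\<^sup>2)"
proof -
  show s: "sets \<gamma> = sets borel" using \<gamma> by (simp add: transport_plans_def)
  have d: "distr \<gamma> borel fst = \<mu>" "distr \<gamma> borel snd = \<nu>" using \<gamma> by (auto simp: transport_plans_def)
  show m: "fst \<in> borel_measurable \<gamma>" "snd \<in> borel_measurable \<gamma>"
    using borel_measurable_projections by (simp_all add: s cong: measurable_cong_sets)
  show "prob_space \<gamma>" using prob_space_distrD[OF m(1)] d prob_measuresD(2)[OF \<mu>] by simp
  have "AE q in \<gamma>. fst q \<in> \<Omega>" "AE q in \<gamma>. snd q \<in> \<Omega>"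
    using prob_measuresD(3)[OF \<mu>] prob_measuresD(3)[OF \<nu>] AE_distrD[OF m(1)] AE_distrD[OF m(2)] d by auto
  then show "AE q in \<gamma>. fst q \<in> \<Omega> \<and> snd q \<in> \<Omega>" by eventually_elim simp
  show "integrable \<gamma> (\<lambda>q. (norm (fst q))\<^sup>2)"
    using prob_measuresD(4)[OF \<mu>] unfolding d(1)[symmetric] by (subst (asm) integrable_distr_eq) (auto simp: m)
  show "integrable \<gamma> (\<lambda>q. (norm (snd q))\<^sup>2)"
    using prob_measuresD(4)[OF \<nu>] unfolding d(2)[symmetric] by (subst (asm) integrable_distr_eq) (auto simp: m)
qed

lemma bounded_density_le_lborel:
  assumes "\<rho> \<in> bounded_density_measures p \<Omega>" and A: "A \<in> sets borel"
  shows "emeasure \<rho> A \<le> emeasure lborel A"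
proof -
  obtain f :: "'a \<Rightarrow> real" where f: "f \<in> borel_measurable borel" "AE x in lborel. 0 \<le> f x \<and> f x \<le> 1"
    "\<rho> = density lborel (\<lambda>x. ennreal (f x))"
    using assms(1) by (auto simp: bounded_density_measures_def)
  have "emeasure \<rho> A = (\<integral>\<^sup>+x. ennreal (f x) * indicator A x \<partial>lborel)"
    using f(1) A unfolding f(3) by (subst emeasure_density) auto
  also have "\<dots> \<le> (\<integral>\<^sup>+x. indicator A x \<partial>lborel)"
    by (rule nn_integral_mono_AE, use f(2) in eventually_elim) (auto simp: indicator_def)
  also have "\<dots> = emeasure lborel A" using A by simp
  finally show ?thesis .
qed

text \<open>Domination gives absolute continuity. If the Radon-Nikodym density exceeded 1 on a
  non-null set \<open>S\<close>, the mass of \<open>S\<close>, finite under a probability measure,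
  would exceed its Lebesgue measure.\<close>

lemma bounded_density_measuresI:
  fixes \<rho> :: "'a::euclidean_space measure"
  assumes \<rho>: "\<rho> \<in> prob_measures p \<Omega>"
    and le: "\<And>A. A \<in> sets borel \<Longrightarrow> emeasure \<rho> A \<le> emeasure lborel A"
  shows "\<rho> \<in> bounded_density_measures p \<Omega>"
proof -
  have s: "sets \<rho> = sets borel" and "prob_space \<rho>" using \<rho> by (auto simp: prob_measures_def)
  then interpret \<rho>: prob_space \<rho> by simp
  have "absolutely_continuous lborel \<rho>"
    unfolding absolutely_continuous_def
  proof
    fix A assume "A \<in> null_sets (lborel :: 'a measure)"
    then have "A \<in> sets borel" "emeasure lborel A = 0" by auto
    then show "A \<in> null_sets \<rho>" using le[of A] by (simp add: null_sets_def s)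
  qed
  then obtain f where f: "f \<in> borel_measurable lborel" "density lborel f = \<rho>"
    using sigma_finite_measure.Radon_Nikodym[OF sigma_finite_lborel, of \<rho>] s by auto
  have fb [measurable]: "f \<in> borel_measurable borel" using f(1) by simp
  define S where "S = {x. 1 < f x}"
  have S [measurable]: "S \<in> sets borel" unfolding S_def by measurable
  have em: "emeasure \<rho> S = (\<integral>\<^sup>+x. f x * indicator S x \<partial>lborel)"
    unfolding f(2)[symmetric] by (rule emeasure_density) auto
  have "AE x in lborel. f x * indicator S x \<le> indicator S x"
  proof (rule ccontr)
    assume nle: "\<not> (AE x in lborel. f x * indicator S x \<le> indicator S x)"
    have mono: "indicator S x \<le> f x * indicator S x" for x
      by (auto simp: S_def indicator_def less_imp_le)
    have "(\<integral>\<^sup>+x. indicator S x \<partial>lborel) < (\<integral>\<^sup>+x. f x * indicator S x \<partial>lborel)"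
    proof (rule nn_integral_less)
      have "(\<integral>\<^sup>+x. indicator S x \<partial>lborel) \<le> (\<integral>\<^sup>+x. f x * indicator S x \<partial>lborel)"
        by (intro nn_integral_mono mono)
      also have "\<dots> < \<infinity>" unfolding em[symmetric] by (simp add: less_top[symmetric])
      finally show "(\<integral>\<^sup>+x. indicator S x \<partial>lborel) \<noteq> \<infinity>" by simp
    qed (use mono nle in auto)
    then show False using le[OF S] em by simp
  qed
  then have f1: "AE x in lborel. f x \<le> 1"
  proof eventually_elim
    case (elim x)
    show ?case
    proof (cases "x \<in> S")
      case True
      then show ?thesis using elim by simp
    qed (simp add: S_def not_less)
  qed
  have "\<rho> = density lborel (\<lambda>x. ennreal (enn2real (f x)))"
    unfolding f(2)[symmetric]
    by (rule density_cong, use f1 in \<open>auto elim!: eventually_mono intro!: ennreal_enn2real[symmetric] le_less_trans[OF _ ennreal_one_less_top]\<close>)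
  moreover have "AE x in lborel. 0 \<le> enn2real (f x) \<and> enn2real (f x) \<le> 1"
    using f1 by eventually_elim (auto intro: enn2real_leI)
  ultimately show ?thesis
    unfolding bounded_density_measures_def using \<rho> fb by (auto intro!: exI[of _ "\<lambda>x. enn2real (f x)"])
qed

text \<open>Makes the interpolants admissible in the projection problem. Convexity keeps them in
  \<open>\<Omega>\<close>, and optimality of \<open>\<eta>\<close> enters through cyclic
  monotonicity of its support.\<close>

lemma displacement_interpolation_in_bounded_density:
  fixes \<mu> \<nu> :: "'a::euclidean_space measure"
  assumes \<Omega>: "closed \<Omega>" "convex \<Omega>" and opt: "optimal_plan 2 \<mu> \<nu> \<eta>"
    and \<mu>: "\<mu> \<in> bounded_density_measures 2 \<Omega>" and \<nu>: "\<nu> \<in> bounded_density_measures 2 \<Omega>"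
    and t: "0 < t" "t < 1"
  shows "distr \<eta> borel (\<lambda>q. (1 - t) *\<^sub>R fst q + t *\<^sub>R snd q) \<in> bounded_density_measures 2 \<Omega>"
proof (rule bounded_density_measuresI)
  define I where "I q = (1 - t) *\<^sub>R fst q + t *\<^sub>R snd q" for q :: "'a \<times> 'a"
  have p: "\<mu> \<in> prob_measures 2 \<Omega>" "\<nu> \<in> prob_measures 2 \<Omega>"
    using \<mu> \<nu> by (auto simp: bounded_density_measures_def)
  have plan: "\<eta> \<in> transport_plans \<mu> \<nu>" using opt by (simp add: optimal_plan_def)
  note \<eta> = transport_planD[OF plan p]
  note [measurable] = \<eta>(3,4)
  interpret \<eta>: prob_space \<eta> by (rule \<eta>(2))
  have sp: "space \<eta> = UNIV" using sets_eq_imp_space_eq[OF \<eta>(1)] by simp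
  have I [measurable]: "I \<in> borel_measurable \<eta>" unfolding I_def[abs_def] by measurable
  have int: "integrable \<eta> (\<lambda>q. (norm (I q))\<^sup>2)"
    unfolding I_def using \<eta>(6,7) by (intro integrable_inner_square(3)) (auto simp: power_mult_distrib)
  have "(\<integral>\<^sup>+q. ennreal ((norm (I q))\<^sup>2) \<partial>\<eta>) < \<infinity>"
    using int by (simp add: nn_integral_eq_integral)
  then have "(\<integral>\<^sup>+x. ennreal (norm x powr 2) \<partial>distr \<eta> borel I) < \<infinity>"
    by (subst nn_integral_distr) (auto simp: powr_numeral)
  moreover have "AE x in distr \<eta> borel I. x \<in> \<Omega>"
  proof -
    have "AE q in \<eta>. I q \<in> \<Omega>"
      using \<eta>(5) by eventually_elim (use \<Omega>(2) t in \<open>auto simp: I_def intro: convexD\<close>)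
    then show ?thesis
      by (subst AE_distr_iff) (use \<Omega>(1) in \<open>auto intro: borel_closed\<close>)
  qed
  ultimately have "distr \<eta> borel I \<in> prob_measures 2 \<Omega>"
    using \<eta>.prob_space_distr[OF I] by (simp add: prob_measures_def)
  then show "distr \<eta> borel (\<lambda>q. (1 - t) *\<^sub>R fst q + t *\<^sub>R snd q) \<in> prob_measures 2 \<Omega>"
    by (simp add: I_def[abs_def])
  have "integrable \<eta> (\<lambda>q. (norm (fst q - snd q))\<^sup>2)"
    using \<eta>(6,7) by (intro integrable_inner_square(2)) auto
  then have "transport_cost 2 \<eta> < \<infinity>" by (simp add: transport_cost_2 nn_integral_eq_integral)
  then have cyc: "cyclically_monotone (measure_support \<eta>)"
    by (rule optimal_plan_cyclically_monotone[OF opt prob_measuresD(2)[OF p(1)]])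
  fix A :: "'a set" assume A: "A \<in> sets borel"
  have m: "emeasure \<eta> (fst -` B) = emeasure \<mu> B" "emeasure \<eta> (snd -` B) = emeasure \<nu> B"
    if "B \<in> sets borel" for B
  proof -
    have "distr \<eta> borel fst = \<mu>" "distr \<eta> borel snd = \<nu>" using plan by (auto simp: transport_plans_def)
    then show "emeasure \<eta> (fst -` B) = emeasure \<mu> B" "emeasure \<eta> (snd -` B) = emeasure \<nu> B"
      using that emeasure_distr[OF \<eta>(3) that] emeasure_distr[OF \<eta>(4) that] by (auto simp: sp)
  qed
  have "emeasure \<eta> (I -` A) \<le> emeasure lborel A"
    unfolding I_def[abs_def]
    by (rule interpolation_le_lborel[OF \<eta>(1) cyc AE_in_measure_support[OF \<eta>(1)] _ _ t A])
      (simp_all add: m bounded_density_le_lborel[OF \<mu>] bounded_density_le_lborel[OF \<nu>])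
  then show "emeasure (distr \<eta> borel (\<lambda>q. (1 - t) *\<^sub>R fst q + t *\<^sub>R snd q)) A \<le> emeasure lborel A"
    using emeasure_distr[OF I A] by (simp add: sp I_def[abs_def])
qed

text \<open>Phrased for random vectors \<open>X\<close>, \<open>Y\<close> on a common measure so
  that it serves both projections, with the two coordinates of the plan in either order.\<close>

lemma projection_first_variation:
  fixes X Y :: "'b \<Rightarrow> 'a::euclidean_space"
  assumes proj: "is_projection 2 \<Omega> \<mu> (distr \<eta> borel X)" and T: "optimal_map 2 \<Omega> (distr \<eta> borel X) \<mu> T"
    and K: "\<And>t. 0 < t \<Longrightarrow> t < 1 \<Longrightarrow> distr \<eta> borel (\<lambda>q. (1 - t) *\<^sub>R X q + t *\<^sub>R Y q) \<in> bounded_density_measures 2 \<Omega>"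
    and X [measurable]: "X \<in> borel_measurable \<eta>" and Y [measurable]: "Y \<in> borel_measurable \<eta>"
    and iX: "integrable \<eta> (\<lambda>q. (norm (X q))\<^sup>2)" and iY: "integrable \<eta> (\<lambda>q. (norm (Y q))\<^sup>2)"
    and iT: "integrable \<eta> (\<lambda>q. (norm (T (X q)))\<^sup>2)"
  shows "0 \<le> (\<integral>q. (X q - T (X q)) \<bullet> (Y q - X q) \<partial>\<eta>)"
proof -
  have Tm [measurable]: "T \<in> borel_measurable borel" and Td: "distr (distr \<eta> borel X) borel T = \<mu>"
    and Tc: "(\<integral>\<^sup>+x. ennreal (norm (x - T x) powr 2) \<partial>distr \<eta> borel X) = wasserstein_pow 2 (distr \<eta> borel X) \<mu>"
    using T by (auto simp: optimal_map_def)
  define a where "a q = X q - T (X q)" for q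
  define b where "b q = Y q - X q" for q
  have [measurable]: "a \<in> borel_measurable \<eta>" "b \<in> borel_measurable \<eta>"
    unfolding a_def[abs_def] b_def[abs_def] by measurable
  have ia: "integrable \<eta> (\<lambda>q. (norm (a q))\<^sup>2)" and ib: "integrable \<eta> (\<lambda>q. (norm (b q))\<^sup>2)"
    unfolding a_def b_def using iX iY iT by (auto intro!: integrable_inner_square(2))
  have iab: "integrable \<eta> (\<lambda>q. a q \<bullet> b q)"
    using ia ib by (intro integrable_inner_square(1)) auto
  have var: "0 \<le> 2 * t * (\<integral>q. a q \<bullet> b q \<partial>\<eta>) + t\<^sup>2 * (\<integral>q. (norm (b q))\<^sup>2 \<partial>\<eta>)" if t: "0 < t" "t < 1" for t
  proof -
    define Z where "Z q = (1 - t) *\<^sub>R X q + t *\<^sub>R Y q" for q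
    have [measurable]: "Z \<in> borel_measurable \<eta>" unfolding Z_def[abs_def] by measurable
    \<comment> \<open>The competitor keeps the old target \<open>T (X q)\<close> and moves only the
      source; it need not be optimal.\<close>
    define \<pi> where "\<pi> = distr \<eta> borel (\<lambda>q. (Z q, T (X q)))"
    have pm: "(\<lambda>q. (Z q, T (X q))) \<in> borel_measurable \<eta>" by (intro borel_measurable_Pair) measurable
    have "distr \<pi> borel fst = distr \<eta> borel Z" "distr \<pi> borel snd = \<mu>"
      unfolding \<pi>_def Td[symmetric]
      by (simp_all add: distr_distr[OF borel_measurable_projections(1) pm] distr_distr[OF borel_measurable_projections(2) pm]
          distr_distr[OF Tm X] o_def)
    then have \<pi>: "\<pi> \<in> transport_plans (distr \<eta> borel Z) \<mu>" by (simp add: transport_plans_def \<pi>_def)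
    have exp: "(norm (Z q - T (X q)))\<^sup>2 = (norm (a q))\<^sup>2 + 2 * t * (a q \<bullet> b q) + t\<^sup>2 * (norm (b q))\<^sup>2" for q
    proof -
      have "Z q - T (X q) = a q + t *\<^sub>R b q" by (simp add: Z_def a_def b_def algebra_simps)
      then have "(norm (Z q - T (X q)))\<^sup>2 = (a q + t *\<^sub>R b q) \<bullet> (a q + t *\<^sub>R b q)"
        by (simp only: power2_norm_eq_inner)
      also have "\<dots> = a q \<bullet> a q + 2 * t * (a q \<bullet> b q) + t\<^sup>2 * (b q \<bullet> b q)"
        unfolding inner_add_left inner_add_right inner_scaleR_left inner_scaleR_right inner_commute[of "b q" "a q"]
        by algebra
      finally show ?thesis by (simp only: power2_norm_eq_inner)
    qed
    have nonneg: "0 \<le> (norm (a q))\<^sup>2 + 2 * t * (a q \<bullet> b q) + t\<^sup>2 * (norm (b q))\<^sup>2" for q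
      unfolding exp[symmetric] by simp
    have "ennreal (\<integral>q. (norm (a q))\<^sup>2 \<partial>\<eta>) = (\<integral>\<^sup>+q. ennreal ((norm (a q))\<^sup>2) \<partial>\<eta>)"
      using ia by (simp add: nn_integral_eq_integral)
    also have "\<dots> = (\<integral>\<^sup>+x. ennreal (norm (x - T x) powr 2) \<partial>distr \<eta> borel X)"
      by (subst nn_integral_distr) (auto simp: a_def powr_numeral)
    also have "\<dots> \<le> wasserstein_pow 2 (distr \<eta> borel Z) \<mu>"
      using proj K[OF t] unfolding Tc is_projection_def is_arg_min_def Z_def[abs_def] by (auto simp: not_less)
    also have "\<dots> \<le> transport_cost 2 \<pi>" unfolding wasserstein_pow_def by (rule INF_lower[OF \<pi>])
    also have "\<dots> = (\<integral>\<^sup>+q. ennreal ((norm (Z q - T (X q)))\<^sup>2) \<partial>\<eta>)"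
      unfolding transport_cost_2 \<pi>_def using pm borel_measurable_quadratic_cost by (subst nn_integral_distr) auto
    also have "\<dots> = ennreal (\<integral>q. (norm (a q))\<^sup>2 + 2 * t * (a q \<bullet> b q) + t\<^sup>2 * (norm (b q))\<^sup>2 \<partial>\<eta>)"
      unfolding exp using ia ib iab nonneg by (intro nn_integral_eq_integral) auto
    finally have "(\<integral>q. (norm (a q))\<^sup>2 \<partial>\<eta>) \<le> (\<integral>q. (norm (a q))\<^sup>2 + 2 * t * (a q \<bullet> b q) + t\<^sup>2 * (norm (b q))\<^sup>2 \<partial>\<eta>)"
      by (subst (asm) ennreal_le_iff) (auto intro: Bochner_Integration.integral_nonneg nonneg)
    also have "\<dots> = (\<integral>q. (norm (a q))\<^sup>2 \<partial>\<eta>) + (2 * t * (\<integral>q. a q \<bullet> b q \<partial>\<eta>) + t\<^sup>2 * (\<integral>q. (norm (b q))\<^sup>2 \<partial>\<eta>))"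
      using ia ib iab by simp
    finally show ?thesis by simp
  qed
  define m where "m = (\<integral>q. a q \<bullet> b q \<partial>\<eta>)"
  define k where "k = (\<integral>q. (norm (b q))\<^sup>2 \<partial>\<eta>)"
  have k: "0 \<le> k" by (simp add: k_def)
  have "0 \<le> m"
  proof (rule ccontr)
    assume "\<not> 0 \<le> m"
    then have m: "m < 0" by simp
    \<comment> \<open>The second bound yields \<open>t * k \<le> - m\<close>, hence
      \<open>2 * m + t * k \<le> m < 0\<close>; the first keeps \<open>t\<close> below 1.\<close>
    define t where "t = min (1/2) (- m / (k + 1))"
    have t: "0 < t" "t < 1" using m k by (auto simp: t_def divide_neg_pos)
    have "t * k \<le> - m"
    proof -
      have "t \<le> - m / (k + 1)" unfolding t_def by (rule min.cobounded2)
      then have "t * (k + 1) \<le> - m" using k by (subst (asm) pos_le_divide_eq) auto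
      then show ?thesis using t by (simp add: algebra_simps)
    qed
    then have "t * (2 * m + t * k) < 0" using m t by (intro mult_pos_neg) auto
    then show False using var[OF t] by (simp add: m_def k_def power2_eq_square algebra_simps)
  qed
  then show ?thesis by (simp add: m_def a_def b_def)
qed

theorem theorem3p1:
  fixes \<Omega> :: "'a::euclidean_space set"
    and \<mu> \<nu> \<mu>' \<nu>' :: "'a measure"
    and \<eta> \<gamma> :: "('a \<times> 'a) measure"
    and T U :: "'a \<Rightarrow> 'a"
  assumes "closed \<Omega>" and "convex \<Omega>" and "emeasure lborel \<Omega> \<ge> 1"
    and "\<mu> \<in> prob_measures 2 \<Omega>" and "\<nu> \<in> prob_measures 2 \<Omega>"
    and "is_projection 2 \<Omega> \<mu> \<mu>'" and "is_projection 2 \<Omega> \<nu> \<nu>'"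
    and "optimal_plan 2 \<mu>' \<nu>' \<eta>"
    and "optimal_map 2 \<Omega> \<mu>' \<mu> T" and "optimal_map 2 \<Omega> \<nu>' \<nu> U"
    and "\<gamma> = distr \<eta> borel (\<lambda>(x, y). (T x, U y))"
  shows "\<gamma> \<in> transport_plans \<mu> \<nu> \<and>
    wasserstein_pow 2 \<mu>' \<nu>' \<le> (\<integral>\<^sup>+(x, y)\<in>\<Omega> \<times> \<Omega>. ennreal ((norm (x - y))\<^sup>2) \<partial>\<gamma>)"
proof -
  have \<mu>': "\<mu>' \<in> bounded_density_measures 2 \<Omega>" and \<nu>': "\<nu>' \<in> bounded_density_measures 2 \<Omega>"
    using assms(6,7) by (auto simp: is_projection_def is_arg_min_def)
  then have p: "\<mu>' \<in> prob_measures 2 \<Omega>" "\<nu>' \<in> prob_measures 2 \<Omega>"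
    by (auto simp: bounded_density_measures_def)
  have plan: "\<eta> \<in> transport_plans \<mu>' \<nu>'" and cost: "transport_cost 2 \<eta> = wasserstein_pow 2 \<mu>' \<nu>'"
    using assms(8) by (auto simp: optimal_plan_def)
  have d: "distr \<eta> borel fst = \<mu>'" "distr \<eta> borel snd = \<nu>'" using plan by (auto simp: transport_plans_def)
  note \<eta> = transport_planD[OF plan p]
  note [measurable] = \<eta>(3,4)
  have T [measurable]: "T \<in> borel_measurable borel" and Td: "distr \<mu>' borel T = \<mu>"
    and U [measurable]: "U \<in> borel_measurable borel" and Ud: "distr \<nu>' borel U = \<nu>"
    using assms(9,10) by (auto simp: optimal_map_def)
  have TU: "(\<lambda>q. (T (fst q), U (snd q))) \<in> borel_measurable \<eta>"
    by (intro borel_measurable_Pair) measurable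
  have \<gamma>_eq: "\<gamma> = distr \<eta> borel (\<lambda>q. (T (fst q), U (snd q)))"
    by (simp add: assms(11) split_beta')
  have dT: "distr \<eta> borel (\<lambda>q. T (fst q)) = \<mu>" and dU: "distr \<eta> borel (\<lambda>q. U (snd q)) = \<nu>"
    unfolding Td[symmetric] Ud[symmetric] d[symmetric]
    by (simp_all add: distr_distr[OF T \<eta>(3)] distr_distr[OF U \<eta>(4)] o_def)
  have \<gamma>_plan: "\<gamma> \<in> transport_plans \<mu> \<nu>"
    using dT dU unfolding transport_plans_def \<gamma>_eq
    by (simp add: distr_distr[OF borel_measurable_projections(1) TU] distr_distr[OF borel_measurable_projections(2) TU] o_def)
  have iT: "integrable \<eta> (\<lambda>q. (norm (T (fst q)))\<^sup>2)"
    using prob_measuresD(4)[OF assms(4)] unfolding dT[symmetric] by (subst (asm) integrable_distr_eq) auto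
  have iU: "integrable \<eta> (\<lambda>q. (norm (U (snd q)))\<^sup>2)"
    using prob_measuresD(4)[OF assms(5)] unfolding dU[symmetric] by (subst (asm) integrable_distr_eq) auto
  define D where "D q = fst q - snd q" for q :: "'a \<times> 'a"
  define E where "E q = T (fst q) - U (snd q)" for q :: "'a \<times> 'a"
  have K: "distr \<eta> borel (\<lambda>q. (1 - t) *\<^sub>R fst q + t *\<^sub>R snd q) \<in> bounded_density_measures 2 \<Omega>"
    if "0 < t" "t < 1" for t
    by (rule displacement_interpolation_in_bounded_density[OF assms(1,2,8) \<mu>' \<nu>' that])
  have v1: "0 \<le> (\<integral>q. (fst q - T (fst q)) \<bullet> (snd q - fst q) \<partial>\<eta>)"
    by (rule projection_first_variation) (use assms(6,9) K \<eta> iT in \<open>simp_all add: d\<close>)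
  have v2: "0 \<le> (\<integral>q. (snd q - U (snd q)) \<bullet> (fst q - snd q) \<partial>\<eta>)"
  proof (rule projection_first_variation)
    show "distr \<eta> borel (\<lambda>q. (1 - t) *\<^sub>R snd q + t *\<^sub>R fst q) \<in> bounded_density_measures 2 \<Omega>"
      if "0 < t" "t < 1" for t
      \<comment> \<open>Interpolating from the second coordinate at time \<open>t\<close> is
        interpolating from the first at time \<open>1 - t\<close>.\<close>
      using K[of "1 - t"] that by (simp add: add.commute)
  qed (use assms(7,10) \<eta> iU in \<open>simp_all add: d\<close>)
  have i1: "integrable \<eta> (\<lambda>q. (fst q - T (fst q)) \<bullet> (snd q - fst q))"
    and i2: "integrable \<eta> (\<lambda>q. (snd q - U (snd q)) \<bullet> (fst q - snd q))"
    using \<eta>(6,7) iT iU by (auto intro!: integrable_inner_square)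
  have iD: "integrable \<eta> (\<lambda>q. (norm (D q))\<^sup>2)" and iE: "integrable \<eta> (\<lambda>q. (norm (E q))\<^sup>2)"
    unfolding D_def E_def using \<eta>(6,7) iT iU by (auto intro!: integrable_inner_square)
  have pointwise: "(norm (D q))\<^sup>2 + (2 * ((fst q - T (fst q)) \<bullet> (snd q - fst q)) + 2 * ((snd q - U (snd q)) \<bullet> (fst q - snd q)))
      \<le> (norm (E q))\<^sup>2" for q
  proof -
    have "(fst q - T (fst q)) \<bullet> (snd q - fst q) + (snd q - U (snd q)) \<bullet> (fst q - snd q) = D q \<bullet> (E q - D q)"
      by (simp add: D_def E_def inner_diff_left inner_diff_right inner_commute)
    moreover have "(norm (E q))\<^sup>2 = (norm (D q))\<^sup>2 + 2 * (D q \<bullet> (E q - D q)) + (norm (E q - D q))\<^sup>2"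
      by (simp add: power2_norm_eq_inner inner_diff_left inner_diff_right inner_commute)
    moreover have "0 \<le> (norm (E q - D q))\<^sup>2" by simp
    ultimately show ?thesis by linarith
  qed
  have "(\<integral>q. (norm (D q))\<^sup>2 \<partial>\<eta>) \<le> (\<integral>q. (norm (D q))\<^sup>2 + (2 * ((fst q - T (fst q)) \<bullet> (snd q - fst q)) + 2 * ((snd q - U (snd q)) \<bullet> (fst q - snd q))) \<partial>\<eta>)"
    using v1 v2 iD i1 i2 by simp
  also have "\<dots> \<le> (\<integral>q. (norm (E q))\<^sup>2 \<partial>\<eta>)"
    using iD iE i1 i2 by (intro integral_mono pointwise) auto
  finally have le: "(\<integral>q. (norm (D q))\<^sup>2 \<partial>\<eta>) \<le> (\<integral>q. (norm (E q))\<^sup>2 \<partial>\<eta>)" .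
  note \<gamma> = transport_planD[OF \<gamma>_plan assms(4,5)]
  have "wasserstein_pow 2 \<mu>' \<nu>' = (\<integral>\<^sup>+q. ennreal ((norm (D q))\<^sup>2) \<partial>\<eta>)"
    by (simp add: cost[symmetric] transport_cost_2 D_def)
  also have "\<dots> \<le> (\<integral>\<^sup>+q. ennreal ((norm (E q))\<^sup>2) \<partial>\<eta>)"
    using le iD iE by (simp add: nn_integral_eq_integral ennreal_leI)
  also have "\<dots> = (\<integral>\<^sup>+q. ennreal ((norm (fst q - snd q))\<^sup>2) \<partial>\<gamma>)"
    unfolding \<gamma>_eq using TU borel_measurable_quadratic_cost by (subst nn_integral_distr) (auto simp: E_def)
  \<comment> \<open>The restriction to \<open>\<Omega> \<times> \<Omega>\<close> is harmless: both
    marginals of \<open>\<gamma>\<close> live on \<open>\<Omega>\<close>.\<close>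
  also have "\<dots> = (\<integral>\<^sup>+(x, y)\<in>\<Omega> \<times> \<Omega>. ennreal ((norm (x - y))\<^sup>2) \<partial>\<gamma>)"
    by (rule nn_integral_cong_AE, use \<gamma>(5) in eventually_elim) (auto simp: split_beta indicator_def)
  finally show ?thesis using \<gamma>_plan by blast
qed

end
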